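(* Let $V$ be a complex vector space of finite dimension $n$ equipped with a nondegenerate symmetric bilinear form $(\cdot|\cdot)$. If $n \leq 3$, then $X(V) = Y(V)$. If $n \geq 12$, then $Y(V) \subsetneq X(V)$.
   Context: $S^3V \subseteq V\otimes V\otimes V$ denotes the space of symmetric tensors. Identify $V$ with $V^*$ via $v \mapsto (v|\cdot)$. A tensor $T=\sum_i a_i\otimes b_i\otimes c_i \in V^{\otimes 3}$ then defines a bilinear multiplication $\mu_T: V\times V\to V$, $\mu_T(x,y)=\sum_i (a_i|x)(b_i|y)c_i$. For $T \in S^3V$, $\mu_T$ is commutative and satisfies $(\mu_T(x,y)|z)=(x|\mu_T(y,z))$. $X(V) := \{T \in S^3 V : \mu_T \text{ is associative}\}$, the affine variety defined by Robeva's (quadratic) equations. A tensor $T\in S^3V$ is strongly odeco if $T=\sum_{i=1}^k v_i^{\otimes 3}$ for some $k\ge 0$ and nonzero, pairwise orthogonal vectors $v_i\in V$ with $(v_i|v_i)\neq 0$ for all $i$. $Y(V)\subseteq S^3V$ is the Zariski closure of the set of strongly odeco tensors. *)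

theory Defs
  imports Complex_Main "HOL-Library.Function_Algebras"
begin

text \<open>
  The space is given by an additive group with a complex scalar multiplication \<open>scale\<close>; the set
  \<open>Basis\<close> is only a witness of finite dimension and enters none of the definitions below.
\<close>

locale nondegenerate_symmetric_form = finite_dimensional_vector_space scale Basis
  for scale :: "complex \<Rightarrow> 'v::ab_group_add \<Rightarrow> 'v" and Basis :: "'v set" +
  fixes form :: "'v \<Rightarrow> 'v \<Rightarrow> complex"
  assumes form_linear: "Vector_Spaces.linear scale (*) (form x)"
    and form_sym: "form x y = form y x"
    and form_nondegenerate: "(\<forall>y. form x y = 0) \<Longrightarrow> x = 0"


section \<open>Tensors\<close>

text \<open>
  Identifying \<open>V\<close> with its dual through the form, the elementary tensor of \<open>a\<close>, \<open>b\<close>, \<open>c\<close> is the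
  trilinear function below, and the third tensor power of \<open>V\<close> consists of the finite sums of
  elementary tensors. That this is a tensor product (universal property) is lemma
  \<open>tensor_universal\<close>. Addition of tensors is pointwise addition of functions.
\<close>

definition tensor3 :: "('v \<Rightarrow> 'v \<Rightarrow> complex) \<Rightarrow> 'v \<Rightarrow> 'v \<Rightarrow> 'v \<Rightarrow> ('v \<Rightarrow> 'v \<Rightarrow> 'v \<Rightarrow> complex)" where
  "tensor3 form a b c = (\<lambda>x y z. form a x * form b y * form c z)"

definition tensor_sum :: "('v \<Rightarrow> 'v \<Rightarrow> complex) \<Rightarrow> ('v \<times> 'v \<times> 'v) list \<Rightarrow> ('v \<Rightarrow> 'v \<Rightarrow> 'v \<Rightarrow> complex)" where
  "tensor_sum form ts = (\<Sum>(a, b, c)\<leftarrow>ts. tensor3 form a b c)"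

definition tensor_space :: "('v \<Rightarrow> 'v \<Rightarrow> complex) \<Rightarrow> ('v \<Rightarrow> 'v \<Rightarrow> 'v \<Rightarrow> complex) set" where
  "tensor_space form = range (tensor_sum form)"

definition tensor_scale :: "complex \<Rightarrow> ('v \<Rightarrow> 'v \<Rightarrow> 'v \<Rightarrow> complex) \<Rightarrow> ('v \<Rightarrow> 'v \<Rightarrow> 'v \<Rightarrow> complex)" where
  "tensor_scale r T = (\<lambda>x y z. r * T x y z)"

text \<open>
  Permuting the factors of a tensor amounts to permuting the arguments of the trilinear function;
  the two transpositions below generate all permutations.
\<close>

definition symmetric_tensors :: "('v \<Rightarrow> 'v \<Rightarrow> complex) \<Rightarrow> ('v \<Rightarrow> 'v \<Rightarrow> 'v \<Rightarrow> complex) set" where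
  "symmetric_tensors form =
    {T \<in> tensor_space form. \<forall>x y z. T x y z = T y x z \<and> T x y z = T x z y}"

text \<open>
  The description is independent of the chosen decomposition of \<open>T\<close>, see lemma
  \<open>tensor_mult_tensor_sum\<close>.
\<close>

definition tensor_mult ::
    "(complex \<Rightarrow> 'v::ab_group_add \<Rightarrow> 'v) \<Rightarrow> ('v \<Rightarrow> 'v \<Rightarrow> complex) \<Rightarrow>
     ('v \<Rightarrow> 'v \<Rightarrow> 'v \<Rightarrow> complex) \<Rightarrow> 'v \<Rightarrow> 'v \<Rightarrow> 'v" where
  "tensor_mult scale form T x y =
    (THE w. \<exists>ts. T = tensor_sum form ts \<and>
                 w = (\<Sum>(a, b, c)\<leftarrow>ts. scale (form a x * form b y) c))"

definition associative_tensors ::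
    "(complex \<Rightarrow> 'v::ab_group_add \<Rightarrow> 'v) \<Rightarrow> ('v \<Rightarrow> 'v \<Rightarrow> complex) \<Rightarrow>
     ('v \<Rightarrow> 'v \<Rightarrow> 'v \<Rightarrow> complex) set" where
  "associative_tensors scale form =
    {T \<in> symmetric_tensors form. \<forall>x y z.
       tensor_mult scale form T (tensor_mult scale form T x y) z =
       tensor_mult scale form T x (tensor_mult scale form T y z)}"


section \<open>Zariski closure\<close>

text \<open>
  Polynomial functions on a linear subspace \<open>W\<close>: the algebra generated by the linear functionals
  on \<open>W\<close>. Values outside \<open>W\<close> are irrelevant.
\<close>

inductive_set polynomial_functions ::
    "(complex \<Rightarrow> 'w::ab_group_add \<Rightarrow> 'w) \<Rightarrow> 'w set \<Rightarrow> ('w \<Rightarrow> complex) set"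
  for scale :: "complex \<Rightarrow> 'w::ab_group_add \<Rightarrow> 'w" and W :: "'w set" where
  const: "(\<lambda>_. r) \<in> polynomial_functions scale W"
| linear: "\<lbrakk>\<And>u v. u \<in> W \<Longrightarrow> v \<in> W \<Longrightarrow> f (u + v) = f u + f v;
            \<And>r u. u \<in> W \<Longrightarrow> f (scale r u) = r * f u\<rbrakk>
           \<Longrightarrow> f \<in> polynomial_functions scale W"
| add: "\<lbrakk>p \<in> polynomial_functions scale W; q \<in> polynomial_functions scale W\<rbrakk>
        \<Longrightarrow> (\<lambda>u. p u + q u) \<in> polynomial_functions scale W"
| mult: "\<lbrakk>p \<in> polynomial_functions scale W; q \<in> polynomial_functions scale W\<rbrakk>
         \<Longrightarrow> (\<lambda>u. p u * q u) \<in> polynomial_functions scale W"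

definition zariski_closure ::
    "(complex \<Rightarrow> 'w::ab_group_add \<Rightarrow> 'w) \<Rightarrow> 'w set \<Rightarrow> 'w set \<Rightarrow> 'w set" where
  "zariski_closure scale W A =
    {w \<in> W. \<forall>p \<in> polynomial_functions scale W. (\<forall>a \<in> A. p a = 0) \<longrightarrow> p w = 0}"


section \<open>Strongly odeco tensors\<close>

definition strongly_odeco :: "('v::zero \<Rightarrow> 'v \<Rightarrow> complex) \<Rightarrow> ('v \<Rightarrow> 'v \<Rightarrow> 'v \<Rightarrow> complex) \<Rightarrow> bool" where
  "strongly_odeco form T \<longleftrightarrow>
    (\<exists>(k::nat) (v :: nat \<Rightarrow> 'v).
       T = (\<Sum>i<k. tensor3 form (v i) (v i) (v i)) \<and>
       (\<forall>i<k. v i \<noteq> 0) \<and>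
       (\<forall>i<k. \<forall>j<k. i \<noteq> j \<longrightarrow> form (v i) (v j) = 0) \<and>
       (\<forall>i<k. form (v i) (v i) \<noteq> 0))"

definition odeco_variety :: "('v::zero \<Rightarrow> 'v \<Rightarrow> complex) \<Rightarrow> ('v \<Rightarrow> 'v \<Rightarrow> 'v \<Rightarrow> complex) set" where
  "odeco_variety form =
    zariski_closure tensor_scale (symmetric_tensors form)
      {T \<in> symmetric_tensors form. strongly_odeco form T}"


section \<open>Adequacy of the model of tensors\<close>

lemma tensor_sum_apply:
  "tensor_sum form ts x y z = (\<Sum>(a, b, c)\<leftarrow>ts. form a x * form b y * form c z)"
  by (induction ts) (auto simp: tensor_sum_def tensor3_def)

context nondegenerate_symmetric_form
begin

lemma form_add_right: "form x (y + z) = form x y + form x z"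
  and form_scale_right: "form x (scale r y) = r * form x y"
  using form_linear[of x] by (auto simp: Vector_Spaces.linear_iff)

lemma form_add_left: "form (x + y) z = form x z + form y z"
  and form_scale_left: "form (scale r x) z = r * form x z"
  by (simp_all add: form_sym[of _ z] form_add_right form_scale_right)

lemma form_zero_right [simp]: "form x 0 = 0"
  using form_scale_right[of x 0 0] by simp

lemma form_sum_left: "form (sum f S) z = (\<Sum>i\<in>S. form (f i) z)"
  by (induction S rule: infinite_finite_induct)
     (auto simp: form_add_left form_sym[of 0])

lemma form_eqI: "x = y" if "\<And>z. form x z = form y z"
proof -
  have "form (x - y) z = 0" for z
    using form_add_left[of "x - y" y z] that[of z] by simp
  then show ?thesis
    using form_nondegenerate[of "x - y"] by simp
qed

lemma form_mult_sum:
  "form (\<Sum>(a, b, c)\<leftarrow>ts. scale (form a x * form b y) c) z = tensor_sum form ts x y z"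
  by (induction ts)
     (auto simp: tensor_sum_apply form_add_left form_scale_left form_sym[of 0])

lemma tensor_mult_tensor_sum:
  "tensor_mult scale form (tensor_sum form ts) x y = (\<Sum>(a, b, c)\<leftarrow>ts. scale (form a x * form b y) c)"
  unfolding tensor_mult_def
proof (rule the_equality)
  fix w
  assume "\<exists>us. tensor_sum form ts = tensor_sum form us \<and>
               w = (\<Sum>(a, b, c)\<leftarrow>us. scale (form a x * form b y) c)"
  then show "w = (\<Sum>(a, b, c)\<leftarrow>ts. scale (form a x * form b y) c)"
    by (auto intro!: form_eqI simp: form_mult_sum)
qed blast

lemma tensor3_trilinear:
  "tensor3 form (a + a') b c = tensor3 form a b c + tensor3 form a' b c"
  "tensor3 form a (b + b') c = tensor3 form a b c + tensor3 form a b' c"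
  "tensor3 form a b (c + c') = tensor3 form a b c + tensor3 form a b c'"
  "tensor3 form (scale r a) b c = tensor_scale r (tensor3 form a b c)"
  "tensor3 form a (scale r b) c = tensor_scale r (tensor3 form a b c)"
  "tensor3 form a b (scale r c) = tensor_scale r (tensor3 form a b c)"
  by (auto simp: tensor3_def tensor_scale_def form_add_left form_scale_left algebra_simps fun_eq_iff)

lemma dual_basis:
  obtains d where "\<And>a. a = (\<Sum>b\<in>Basis. scale (form a (d b)) b)"
proof -
  interpret vector_space_pair scale scale ..
  define g where "g x = (\<Sum>b\<in>Basis. scale (form x b) b)" for x
  have lin: "Vector_Spaces.linear scale scale g"
    unfolding Vector_Spaces.linear_iff g_def
    by (auto simp: form_add_left form_scale_left scale_left_distrib sum.distrib scale_sum_right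
          vector_space_axioms)
  have zero: "x = 0" if "g x = 0" for x
  proof -
    have "form x b = 0" if "b \<in> Basis" for b
      using independentD[OF independent_Basis finite_Basis order_refl \<open>g x = 0\<close>[unfolded g_def] that] .
    moreover have "Vector_Spaces.linear scale (*) (form x)"
      by (rule form_linear)
    ultimately have "form x y = 0" for y
    proof -
      have "y \<in> span Basis" using span_Basis by simp
      then show ?thesis
        by (induction rule: span_induct_alt)
           (auto simp: form_add_right form_scale_right \<open>\<And>b. b \<in> Basis \<Longrightarrow> form x b = 0\<close>)
    qed
    then show ?thesis using form_nondegenerate by blast
  qed
  have "inj g"
    using linear_inj_iff_eq_0[OF lin] zero by blast
  then have "surj g"
    using linear_inj_imp_surj[OF lin] by blast
  define d where "d b = inv g b" for b
  have gd: "g (d b) = b" for b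
    unfolding d_def using \<open>surj g\<close> by (rule surj_f_inv_f)
  have delta: "form (d b) b' = (if b' = b then 1 else 0)" if "b \<in> Basis" "b' \<in> Basis" for b b'
  proof -
    have "(\<Sum>c\<in>Basis. scale (form (d b) c - (if c = b then 1 else 0)) c) = g (d b) - b"
      using that finite_Basis
      by (simp add: g_def scale_left_diff_distrib sum_subtractf if_distrib[of "\<lambda>r. scale r _"]
            sum.delta cong: if_cong)
    also have "\<dots> = 0" by (simp add: gd)
    finally show ?thesis
      using independentD[OF independent_Basis finite_Basis order_refl _ \<open>b' \<in> Basis\<close>] by fastforce
  qed
  have "a = (\<Sum>b\<in>Basis. scale (form a (d b)) b)" for a
  proof -
    have "a \<in> span Basis" using span_Basis by simp
    then obtain u where u: "a = (\<Sum>b\<in>Basis. scale (u b) b)"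
      using span_finite[OF finite_Basis] by auto
    have "form a (d b) = u b" if "b \<in> Basis" for b
    proof -
      have "form a (d b) = (\<Sum>c\<in>Basis. u c * form (d b) c)"
        unfolding u form_sum_left form_scale_left by (simp add: form_sym)
      also have "\<dots> = (\<Sum>c\<in>Basis. if c = b then u c else 0)"
        by (rule sum.cong) (use that delta in auto)
      also have "\<dots> = u b" using that finite_Basis by simp
      finally show ?thesis .
    qed
    then show ?thesis using u by simp
  qed
  then show ?thesis using that by blast
qed

lemma tensor_universal:
  fixes scale' :: "complex \<Rightarrow> 'w::ab_group_add \<Rightarrow> 'w" and \<beta> :: "'v \<Rightarrow> 'v \<Rightarrow> 'v \<Rightarrow> 'w"
  assumes lin1: "\<And>b c. Vector_Spaces.linear scale scale' (\<lambda>a. \<beta> a b c)"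
    and lin2: "\<And>a c. Vector_Spaces.linear scale scale' (\<lambda>b. \<beta> a b c)"
    and lin3: "\<And>a b. Vector_Spaces.linear scale scale' (\<lambda>c. \<beta> a b c)"
    and eq: "tensor_sum form ts = tensor_sum form us"
  shows "(\<Sum>(a, b, c)\<leftarrow>ts. \<beta> a b c) = (\<Sum>(a, b, c)\<leftarrow>us. \<beta> a b c)"
proof -
  interpret W: vector_space scale'
    using lin1 by (auto simp: Vector_Spaces.linear_iff)
  interpret vector_space_pair scale scale' ..
  obtain d where d: "\<And>a. a = (\<Sum>b\<in>Basis. scale (form a (d b)) b)"
    using dual_basis by blast
  have expand: "f a = (\<Sum>i\<in>Basis. scale' (form a (d i)) (f i))"
    if "Vector_Spaces.linear scale scale' f" for f a
    by (subst d[of a]) (simp add: linear_sum[OF that] linear_scale[OF that])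
  have beta: "\<beta> a b c = (\<Sum>i\<in>Basis. \<Sum>j\<in>Basis. \<Sum>k\<in>Basis.
      scale' (form a (d i) * form b (d j) * form c (d k)) (\<beta> i j k))" for a b c
    by (subst expand[OF lin1], rule sum.cong[OF refl], subst expand[OF lin2],
        subst W.scale_sum_right, rule sum.cong[OF refl], subst expand[OF lin3])
       (simp add: W.scale_sum_right mult.assoc)
  have "(\<Sum>(a, b, c)\<leftarrow>ts. \<beta> a b c) = (\<Sum>i\<in>Basis. \<Sum>j\<in>Basis. \<Sum>k\<in>Basis.
      scale' (tensor_sum form ts (d i) (d j) (d k)) (\<beta> i j k))" for ts
  proof (induction ts)
    case Nil
    show ?case by (simp add: tensor_sum_apply)
  next
    case (Cons t ts)
    obtain a b c where t: "t = (a, b, c)" by (cases t)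
    have "(\<Sum>(a, b, c)\<leftarrow>t # ts. \<beta> a b c) = \<beta> a b c + (\<Sum>(a, b, c)\<leftarrow>ts. \<beta> a b c)"
      by (simp add: t)
    then show ?case
      unfolding Cons.IH beta[of a b c]
      by (simp add: t tensor_sum_apply W.scale_left_distrib sum.distrib)
  qed
  then show ?thesis by (simp add: eq)
qed

end

end

(*
A tensor with associative multiplication is strongly odeco as soon as it is diagonal in an
orthogonal basis of anisotropic vectors, for instance when some multiplication operator has simple
spectrum.

For n <= 3, take a common eigenvector k of all multiplication operators. If no such k is isotropic,
the algebra is diagonal. Otherwise a hyperbolic partner of k puts the tensor into a family with five
parameters and one relation, in which algebras generated by one element are dense. If b generates
the algebra, a rank-one perturbation of multiplication by b that fixes the powers b, ..., b^n changes
its characteristic polynomial within a pencil p - s q without base points; for generic s the spectrum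
is simple, so the tensor is a limit of strongly odeco ones.

For n >= 12, the tangent space to the associative tensors at a strongly odeco tensor has dimension
at least n (n + 1) / 2, and this persists on the Zariski closure. At the orthogonal sum of n - 12
idempotents and a suitable cubic in six variables, placed on a maximal isotropic subspace of a
12-dimensional space (where every cubic is associative), it has dimension at most n (n + 1) / 2 - 1.
The cubic is the dual generator of a local Gorenstein algebra with Hilbert function (1, 6, 6, 1)
that is not smoothable.
*)
theory Submission
  imports Defs "HOL-Computational_Algebra.Fundamental_Theorem_Algebra"
    "HOL-Computational_Algebra.Polynomial_Factorial" "Jordan_Normal_Form.Determinant"
begin

text \<open>A self-adjoint operator X with cyclic vector b determines a tensor through the moments
  (X^m b|b). The approximation in low dimension therefore perturbs the operator and lets the tensor
  follow. The perturbation uses the vector u orthogonal to b, ..., b^(n-1) with (u|b^n) = 1.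

  In high dimension no dimension theory of varieties enters. A space of dimension d contains, for
  any d - 1 linear conditions, a nonzero element satisfying them. Nontrivial solvability of a linear
  system with coefficients polynomial in T is a determinantal condition on T, so it survives in the
  closure.

  For n = 12 the odeco bound is 78, and the counterexample is rigid after fixing 77 = 56 + 21
  coordinates: 56 for the cubics in six variables, 21 for the mixed components. An idempotent with
  index e costs e + 1 further coordinates, exactly the growth of n (n + 1) / 2, so the margin of one
  persists. The 12-dimensional algebra is W + U with W W inside U and U dual to W: the maximal ideal
  of the Gorenstein algebra modulo its socle.\<close>

context nondegenerate_symmetric_form
begin

section \<open>Symmetric tensors as symmetric trilinear functions\<close>

abbreviation mult where "mult \<equiv> tensor_mult scale form"

lemma form_zero_left [simp]: "form 0 x = 0"
  using form_scale_left[of 0 0 x] by simp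

lemma form_sum_right: "form z (sum f S) = (\<Sum>i\<in>S. form z (f i))"
  using form_sum_left[of f S z] by (simp add: form_sym)

lemma form_diff_left: "form (x - y) z = form x z - form y z"
  using form_add_left[of "x - y" y z] by simp

lemma form_diff_right: "form z (x - y) = form z x - form z y"
  using form_add_right[of z "x - y" y] by simp

lemmas form_bilinear = form_add_left form_add_right form_diff_left form_diff_right
  form_scale_left form_scale_right

lemma symmetric_tensorsD:
  assumes "T \<in> symmetric_tensors form"
  shows symmetric_tensor_swap12: "T x y z = T y x z"
    and symmetric_tensor_swap23: "T x y z = T x z y"
    and symmetric_tensor_add1: "T (x + x') y z = T x y z + T x' y z"
    and symmetric_tensor_scale1: "T (scale r x) y z = r * T x y z"
proof -
  obtain ts where T: "T = tensor_sum form ts"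
    using assms by (auto simp: symmetric_tensors_def tensor_space_def)
  show "T x y z = T y x z" "T x y z = T x z y"
    using assms by (simp_all add: symmetric_tensors_def)
  show "T (x + x') y z = T x y z + T x' y z" "T (scale r x) y z = r * T x y z"
    unfolding T by (induction ts) (auto simp: tensor_sum_apply form_bilinear algebra_simps)
qed

lemma symmetric_tensor_add:
  assumes "T \<in> symmetric_tensors form"
  shows "T (x + x') y z = T x y z + T x' y z" "T y (x + x') z = T y x z + T y x' z"
    "T y z (x + x') = T y z x + T y z x'"
  using symmetric_tensorsD[OF assms] by metis+

lemma symmetric_tensor_scale:
  assumes "T \<in> symmetric_tensors form"
  shows "T (scale r x) y z = r * T x y z" "T y (scale r x) z = r * T y x z"
    "T y z (scale r x) = r * T y z x"
  using symmetric_tensorsD[OF assms] by metis+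

lemma symmetric_tensor_zero:
  assumes "T \<in> symmetric_tensors form"
  shows "T 0 y z = 0" "T y 0 z = 0" "T y z 0 = 0"
  using symmetric_tensor_scale[OF assms, where r = 0 and x = 0] by simp_all

lemma symmetric_tensor_sum:
  assumes "T \<in> symmetric_tensors form"
  shows "T (sum f S) y z = (\<Sum>i\<in>S. T (f i) y z)" "T y (sum f S) z = (\<Sum>i\<in>S. T y (f i) z)"
    "T y z (sum f S) = (\<Sum>i\<in>S. T y z (f i))"
  by (induction S rule: infinite_finite_induct;
      simp add: symmetric_tensor_zero[OF assms] symmetric_tensor_add[OF assms])+

text \<open>Expanding every argument in \<open>Basis\<close> through the functionals
  \<open>d\<close> exhibits the function as a finite sum of elementary tensors. Later membership
  proofs thus need no explicit decomposition.\<close>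

lemma symmetric_tensorsI:
  assumes sym: "\<And>x y z. T x y z = T y x z" "\<And>x y z. T x y z = T x z y"
    and add: "\<And>x x' y z. T (x + x') y z = T x y z + T x' y z"
    and scale: "\<And>r x y z. T (scale r x) y z = r * T x y z"
  shows "T \<in> symmetric_tensors form"
proof -
  obtain d where d: "\<And>a. a = (\<Sum>b\<in>Basis. scale (form a (d b)) b)"
    using dual_basis by blast
  have zero: "T 0 y z = 0" for y z
    using scale[of 0 0 y z] by simp
  have sum: "T (sum f S) y z = (\<Sum>i\<in>S. T (f i) y z)" for f :: "'v \<Rightarrow> 'v" and S y z
    by (induction S rule: infinite_finite_induct) (auto simp: zero add)
  have exp1: "T x y z = (\<Sum>b\<in>Basis. form x (d b) * T b y z)" for x y z
    by (subst d[of x]) (simp add: sum scale)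
  have exp: "T x y z = (\<Sum>b\<in>Basis. \<Sum>b'\<in>Basis. \<Sum>b''\<in>Basis.
      form x (d b) * form y (d b') * form z (d b'') * T b b' b'')" for x y z
  proof -
    have e2: "T b y z = (\<Sum>b'\<in>Basis. form y (d b') * T b b' z)" for b
      unfolding sym(1)[of b y] sym(1)[of b _ z] by (rule exp1)
    have "T b b' z = (\<Sum>b''\<in>Basis. form z (d b'') * T b'' b b')" for b b'
      using exp1[of z b b'] sym(1)[of z b b'] sym(2)[of b z b'] by metis
    then have e3: "T b b' z = (\<Sum>b''\<in>Basis. form z (d b'') * T b b' b'')" for b b'
      using sym(1)[of _ b b'] sym(2)[of b _ b'] by (metis (no_types, lifting) sum.cong)
    show ?thesis
      by (subst exp1[of x], subst e2, subst e3) (simp add: sum_distrib_left mult.assoc)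
  qed
  obtain xs where xs: "set xs = Basis" "distinct xs"
    using finite_distinct_list[OF finite_Basis] by blast
  define ts where "ts = concat (map (\<lambda>b. concat (map (\<lambda>b'. map (\<lambda>b''.
      (scale (T b b' b'') (d b), d b', d b'')) xs) xs)) xs)"
  have sl: "(\<Sum>b\<leftarrow>xs. g b) = (\<Sum>b\<in>Basis. g b)" for g :: "'v \<Rightarrow> complex"
    using xs by (metis sum_list_distinct_conv_sum_set)
  have aux: "(\<Sum>(a, b, c)\<leftarrow>concat (map h ys). form a x * form b y * form c z)
      = (\<Sum>v\<leftarrow>ys. \<Sum>(a, b, c)\<leftarrow>h v. form a x * form b y * form c z)"
    for h :: "'v \<Rightarrow> ('v \<times> 'v \<times> 'v) list" and ys x y z
    by (induction ys) auto
  have "tensor_sum form ts x y z = T x y z" for x y z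
    unfolding tensor_sum_apply ts_def aux
    by (simp add: sl o_def case_prod_unfold form_bilinear exp[of x y z] form_sym algebra_simps)
  then have "T = tensor_sum form ts"
    by (intro ext) simp
  then have "T \<in> tensor_space form"
    by (auto simp: tensor_space_def)
  then show ?thesis
    using sym by (simp add: symmetric_tensors_def)
qed

lemma form_mult:
  assumes "T \<in> symmetric_tensors form"
  shows "form (mult T x y) z = T x y z"
proof -
  obtain ts where T: "T = tensor_sum form ts"
    using assms by (auto simp: symmetric_tensors_def tensor_space_def)
  show ?thesis unfolding T tensor_mult_tensor_sum form_mult_sum ..
qed

lemma mult_eqI:
  assumes "T \<in> symmetric_tensors form" "\<And>z. form w z = T x y z"
  shows "mult T x y = w"
  by (rule form_eqI) (simp add: form_mult assms)

lemma mult_linear: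
  assumes "T \<in> symmetric_tensors form"
  shows mult_commute: "mult T x y = mult T y x"
    and mult_add_right: "mult T x (y + z) = mult T x y + mult T x z"
    and mult_scale_right: "mult T x (scale r y) = scale r (mult T x y)"
    and mult_add_left: "mult T (y + z) x = mult T y x + mult T z x"
    and mult_scale_left: "mult T (scale r y) x = scale r (mult T y x)"
  by (rule form_eqI, simp add: form_mult[OF assms] form_bilinear symmetric_tensor_add[OF assms]
        symmetric_tensor_scale[OF assms] symmetric_tensor_swap12[OF assms, of x y])+

lemma form_mult_adjoint:
  assumes "T \<in> symmetric_tensors form"
  shows "form (mult T x y) z = form y (mult T x z)"
  using form_mult[OF assms] symmetric_tensorsD[OF assms] form_sym by metis

lemma associative_tensorsD:
  assumes "T \<in> associative_tensors scale form"
  shows "T \<in> symmetric_tensors form" "mult T (mult T x y) z = mult T x (mult T y z)"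
  using assms by (simp_all add: associative_tensors_def)

text \<open>Pairing both sides of associativity with \<open>w\<close> turns an identity of vectors
  into scalar equations, quadratic in \<open>T\<close>.\<close>

lemma associative_tensors_iff:
  assumes "T \<in> symmetric_tensors form"
  shows "T \<in> associative_tensors scale form \<longleftrightarrow>
    (\<forall>x y z w. T (mult T x y) z w = T (mult T y z) x w)"
proof -
  have "mult T (mult T x y) z = mult T x (mult T y z) \<longleftrightarrow> (\<forall>w. T (mult T x y) z w = T (mult T y z) x w)"
    for x y z
    using form_mult[OF assms] symmetric_tensor_swap12[OF assms] form_eqI by metis
  then show ?thesis
    using assms by (simp add: associative_tensors_def)
qed

lemma tensor3_cube_symmetric: "tensor3 form v v v \<in> symmetric_tensors form"
  by (rule symmetric_tensorsI) (auto simp: tensor3_def form_bilinear algebra_simps)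

lemma symmetric_tensors_zero: "0 \<in> symmetric_tensors form"
  by (rule symmetric_tensorsI) auto

lemma symmetric_tensors_add:
  assumes S: "S \<in> symmetric_tensors form" and T: "T \<in> symmetric_tensors form"
  shows "S + T \<in> symmetric_tensors form"
  by (rule symmetric_tensorsI)
     (auto simp: symmetric_tensor_add[OF S] symmetric_tensor_add[OF T]
        symmetric_tensor_scale[OF S] symmetric_tensor_scale[OF T] algebra_simps
        intro: symmetric_tensorsD[OF S] symmetric_tensorsD[OF T] arg_cong2[where f = "(+)"])

lemma symmetric_tensors_scale:
  assumes S: "S \<in> symmetric_tensors form"
  shows "tensor_scale r S \<in> symmetric_tensors form"
  by (rule symmetric_tensorsI)
     (auto simp: tensor_scale_def symmetric_tensor_add[OF S] symmetric_tensor_scale[OF S] algebra_simps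
        intro: symmetric_tensorsD[OF S])

lemma symmetric_tensors_sum:
  "(\<And>i. i \<in> I \<Longrightarrow> S i \<in> symmetric_tensors form) \<Longrightarrow> (\<Sum>i\<in>I. S i) \<in> symmetric_tensors form"
  by (induction I rule: infinite_finite_induct) (auto intro: symmetric_tensors_zero symmetric_tensors_add)

lemma sum_fun3_apply: "(\<Sum>i\<in>I. S i) x y z = (\<Sum>i\<in>I. S i x y z :: complex)"
  by (induction I rule: infinite_finite_induct) auto

lemma symmetric_tensor_eqI:
  assumes S: "S \<in> symmetric_tensors form" and T: "T \<in> symmetric_tensors form"
    and span: "span B = UNIV"
    and eq: "\<And>x y z. x \<in> B \<Longrightarrow> y \<in> B \<Longrightarrow> z \<in> B \<Longrightarrow> S x y z = T x y z"
  shows "S = T"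
proof -
  note lin = symmetric_tensor_add[OF S] symmetric_tensor_add[OF T] symmetric_tensor_scale[OF S]
    symmetric_tensor_scale[OF T] symmetric_tensor_zero[OF S] symmetric_tensor_zero[OF T]
  have sp: "x \<in> span B" for x using span by simp
  have 1: "S x y z = T x y z" if "y \<in> B" "z \<in> B" for x y z
    using sp[of x] by (induction rule: span_induct_alt) (use that eq in \<open>auto simp: lin\<close>)
  have 2: "S x y z = T x y z" if "z \<in> B" for x y z
    using sp[of y] by (induction rule: span_induct_alt) (use that 1 in \<open>auto simp: lin\<close>)
  have 3: "S x y z = T x y z" for x y z
    using sp[of z] by (induction rule: span_induct_alt) (use 2 in \<open>auto simp: lin\<close>)
  show ?thesis by (intro ext) (rule 3)
qed

end

section \<open>Polynomial functions, limits and the Zariski closure\<close>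

lemma polynomial_functions_cmult:
  "p \<in> polynomial_functions sc W \<Longrightarrow> (\<lambda>u. r * p u) \<in> polynomial_functions sc W"
  using polynomial_functions.mult[OF polynomial_functions.const] .

lemma polynomial_functions_diff:
  assumes "p \<in> polynomial_functions sc W" "q \<in> polynomial_functions sc W"
  shows "(\<lambda>u. p u - q u) \<in> polynomial_functions sc W"
  using polynomial_functions.add[OF assms(1) polynomial_functions_cmult[OF assms(2), of "-1"]] by simp

lemma polynomial_functions_sum:
  "(\<And>i. i \<in> I \<Longrightarrow> p i \<in> polynomial_functions sc W) \<Longrightarrow> (\<lambda>u. \<Sum>i\<in>I. p i u) \<in> polynomial_functions sc W"
  by (induction I rule: infinite_finite_induct)
     (auto intro: polynomial_functions.const polynomial_functions.add)

lemma polynomial_functions_prod: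
  "(\<And>i. i \<in> I \<Longrightarrow> p i \<in> polynomial_functions sc W) \<Longrightarrow> (\<lambda>u. \<Prod>i\<in>I. p i u) \<in> polynomial_functions sc W"
  by (induction I rule: infinite_finite_induct)
     (auto intro: polynomial_functions.const polynomial_functions.mult)

context nondegenerate_symmetric_form
begin

lemma linear_on_sum:
  assumes add: "\<And>u v. u \<in> symmetric_tensors form \<Longrightarrow> v \<in> symmetric_tensors form \<Longrightarrow> f (u + v) = f u + f v"
    and scale: "\<And>r u. u \<in> symmetric_tensors form \<Longrightarrow> f (tensor_scale r u) = r * f u"
    and S: "\<And>i. i \<in> I \<Longrightarrow> S i \<in> symmetric_tensors form"
  shows "f (\<Sum>i\<in>I. S i) = (\<Sum>i\<in>I. f (S i) :: complex)"
proof -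
  have "tensor_scale 0 0 = 0"
    by (simp add: tensor_scale_def zero_fun_def)
  then have "f 0 = 0"
    using scale[OF symmetric_tensors_zero, of 0] by (metis mult_zero_left)
  then show ?thesis
    using S by (induction I rule: infinite_finite_induct) (auto simp: add symmetric_tensors_sum)
qed

text \<open>Every linear functional on symmetric tensors becomes a finite combination of evaluations
  \<open>T x y z\<close>. This is what makes polynomial functions continuous for pointwise
  convergence.\<close>

lemma symmetric_tensors_finite_dimensional:
  obtains I :: "('v \<times> 'v \<times> 'v) set" and B where "finite I"
    "\<And>i. i \<in> I \<Longrightarrow> B i \<in> symmetric_tensors form"
    "\<And>T. T \<in> symmetric_tensors form \<Longrightarrow> T = (\<Sum>i\<in>I. tensor_scale (case i of (x, y, z) \<Rightarrow> T x y z) (B i))"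
proof -
  obtain d where d: "\<And>a. a = (\<Sum>b\<in>Basis. scale (form a (d b)) b)"
    using dual_basis by blast
  define t where "t = (\<lambda>(a, b, c) x y z. form x (d a) * form y (d b) * form z (d c))"
  \<comment> \<open>Averaging over the six permutations puts each \<open>B i\<close> inside the
    symmetric tensors; a symmetric \<open>T\<close> is unchanged by the average.\<close>
  define B where "B = (\<lambda>i x y z. (t i x y z + t i x z y + t i y x z + t i y z x + t i z x y + t i z y x) / 6)"
  show thesis
  proof
    show "finite (Basis \<times> Basis \<times> Basis)"
      using finite_Basis by simp
    show "B i \<in> symmetric_tensors form" for i
      by (rule symmetric_tensorsI)
         (auto simp: B_def t_def form_bilinear algebra_simps add_divide_distrib split: prod.splits)
    fix T assume T: "T \<in> symmetric_tensors form"
    have exp: "T x y z = (\<Sum>i\<in>Basis \<times> Basis \<times> Basis. (case i of (x, y, z) \<Rightarrow> T x y z) * t i x y z)" for x y z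
    proof -
      have "T x y z = T (\<Sum>b\<in>Basis. scale (form x (d b)) b) (\<Sum>b\<in>Basis. scale (form y (d b)) b)
          (\<Sum>b\<in>Basis. scale (form z (d b)) b)"
        by (simp flip: d)
      also have "\<dots> = (\<Sum>a\<in>Basis. \<Sum>b\<in>Basis. \<Sum>c\<in>Basis. T a b c * t (a, b, c) x y z)"
        unfolding symmetric_tensor_sum(1)[OF T] unfolding symmetric_tensor_sum(2)[OF T]
        unfolding symmetric_tensor_sum(3)[OF T]
        by (simp add: symmetric_tensor_scale[OF T] t_def mult_ac)
      finally show ?thesis
        by (simp add: sum.cartesian_product case_prod_unfold)
    qed
    have final: "T x y z = (\<Sum>i\<in>Basis \<times> Basis \<times> Basis. (case i of (x, y, z) \<Rightarrow> T x y z) * B i x y z)" for x y z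
    proof -
      define c where "c = (\<lambda>(x, y, z). T x y z)"
      have "T x y z = (T x y z + T x z y + T y x z + T y z x + T z x y + T z y x) / 6"
        using symmetric_tensorsD[OF T] by simp
      also have "\<dots> = ((\<Sum>i\<in>Basis \<times> Basis \<times> Basis. c i * t i x y z)
          + (\<Sum>i\<in>Basis \<times> Basis \<times> Basis. c i * t i x z y)
          + (\<Sum>i\<in>Basis \<times> Basis \<times> Basis. c i * t i y x z)
          + (\<Sum>i\<in>Basis \<times> Basis \<times> Basis. c i * t i y z x)
          + (\<Sum>i\<in>Basis \<times> Basis \<times> Basis. c i * t i z x y)
          + (\<Sum>i\<in>Basis \<times> Basis \<times> Basis. c i * t i z y x)) / 6"
        unfolding c_def by (simp only: exp[symmetric])
      also have "\<dots> = (\<Sum>i\<in>Basis \<times> Basis \<times> Basis. c i * B i x y z)"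
        unfolding B_def sum.distrib[symmetric] sum_divide_distrib
        by (rule sum.cong) (simp_all add: distrib_left)
      finally show ?thesis
        unfolding c_def .
    qed
    show "T = (\<Sum>i\<in>Basis \<times> Basis \<times> Basis. tensor_scale (case i of (x, y, z) \<Rightarrow> T x y z) (B i))"
      by (intro ext, unfold sum_fun3_apply tensor_scale_def) (rule final)
  qed
qed

lemma polynomial_functions_tendsto:
  fixes F :: "'b filter"
  assumes p: "p \<in> polynomial_functions tensor_scale (symmetric_tensors form)"
    and T: "eventually (\<lambda>s. T s \<in> symmetric_tensors form) F" and T0: "T0 \<in> symmetric_tensors form"
    and lim: "\<And>x y z. ((\<lambda>s. T s x y z) \<longlongrightarrow> T0 x y z) F"
  shows "((\<lambda>s. p (T s)) \<longlongrightarrow> p T0) F"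
  using p
proof induction
  case (linear f)
  obtain I :: "('v \<times> 'v \<times> 'v) set" and B where "finite I"
    and B: "\<And>i. i \<in> I \<Longrightarrow> B i \<in> symmetric_tensors form"
    and exp: "\<And>T. T \<in> symmetric_tensors form \<Longrightarrow> T = (\<Sum>i\<in>I. tensor_scale (case i of (x, y, z) \<Rightarrow> T x y z) (B i))"
    by (rule symmetric_tensors_finite_dimensional) blast
  have f: "f U = (\<Sum>i\<in>I. (case i of (x, y, z) \<Rightarrow> U x y z) * f (B i))" if "U \<in> symmetric_tensors form" for U
  proof -
    have "f U = f (\<Sum>i\<in>I. tensor_scale (case i of (x, y, z) \<Rightarrow> U x y z) (B i))"
      using exp[OF that] by simp
    also have "\<dots> = (\<Sum>i\<in>I. f (tensor_scale (case i of (x, y, z) \<Rightarrow> U x y z) (B i)))"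
      by (rule linear_on_sum) (use linear B symmetric_tensors_scale in blast)+
    also have "\<dots> = (\<Sum>i\<in>I. (case i of (x, y, z) \<Rightarrow> U x y z) * f (B i))"
      using linear B by (intro sum.cong) auto
    finally show ?thesis .
  qed
  have "((\<lambda>s. \<Sum>i\<in>I. (case i of (x, y, z) \<Rightarrow> T s x y z) * f (B i)) \<longlongrightarrow>
      (\<Sum>i\<in>I. (case i of (x, y, z) \<Rightarrow> T0 x y z) * f (B i))) F"
    by (intro tendsto_sum tendsto_mult tendsto_const) (auto simp: lim split: prod.splits)
  moreover have "eventually (\<lambda>s. (\<Sum>i\<in>I. (case i of (x, y, z) \<Rightarrow> T s x y z) * f (B i)) = f (T s)) F"
    using T by eventually_elim (simp add: f)
  ultimately show ?case
    unfolding f[OF T0] by (rule Lim_transform_eventually)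
qed (simp_all add: tendsto_add tendsto_mult)

text \<open>A Zariski closed set is closed under ordinary limits, since polynomial functions are
  continuous. All approximation arguments below end here.\<close>

lemma odeco_variety_limit:
  fixes F :: "'b filter"
  assumes F: "F \<noteq> bot" and T: "eventually (\<lambda>s. T s \<in> odeco_variety form) F"
    and lim: "\<And>x y z. ((\<lambda>s. T s x y z) \<longlongrightarrow> T0 x y z) F"
    and T0: "T0 \<in> symmetric_tensors form"
  shows "T0 \<in> odeco_variety form"
  unfolding odeco_variety_def zariski_closure_def
proof (intro CollectI conjI ballI impI T0)
  fix p assume p: "p \<in> polynomial_functions tensor_scale (symmetric_tensors form)"
    and zero: "\<forall>a\<in>{T \<in> symmetric_tensors form. strongly_odeco form T}. p a = 0"
  have sym: "eventually (\<lambda>s. T s \<in> symmetric_tensors form) F"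
    and ev: "eventually (\<lambda>s. p (T s) = 0) F"
    using T p zero by (auto simp: odeco_variety_def zariski_closure_def elim: eventually_mono)
  have "((\<lambda>s. 0) \<longlongrightarrow> p T0) F"
    by (rule Lim_transform_eventually[OF polynomial_functions_tendsto[OF p sym T0 lim] ev])
  then show "p T0 = 0"
    by (rule tendsto_unique[OF F _ tendsto_const])
qed

lemma strongly_odeco_in_variety:
  assumes "T \<in> symmetric_tensors form" "strongly_odeco form T"
  shows "T \<in> odeco_variety form"
  using assms by (auto simp: odeco_variety_def zariski_closure_def)

section \<open>Diagonal tensors, and associativity on the closure\<close>

lemma strongly_odeco_diagonal:
  fixes f :: "'i \<Rightarrow> 'v"
  assumes I: "finite I" and T: "T \<in> symmetric_tensors form" and span: "span (f ` I) = UNIV"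
    and orth: "\<And>i j. i \<in> I \<Longrightarrow> j \<in> I \<Longrightarrow> i \<noteq> j \<Longrightarrow> form (f i) (f j) = 0"
    and anis: "\<And>i. i \<in> I \<Longrightarrow> form (f i) (f i) \<noteq> 0"
    and diag: "\<And>i j k. i \<in> I \<Longrightarrow> j \<in> I \<Longrightarrow> k \<in> I \<Longrightarrow> \<not> (i = j \<and> j = k) \<Longrightarrow> T (f i) (f j) (f k) = 0"
  shows "strongly_odeco form T"
proof -
  define J where "J = {i \<in> I. T (f i) (f i) (f i) \<noteq> 0}"
  have J: "finite J" "J \<subseteq> I"
    using I by (auto simp: J_def)
  \<comment> \<open>The cube root is chosen so that \<open>v i = c i f i\<close> satisfies (v i|f
    i)^3 = T (f i) (f i) (f i). Indices outside \<open>J\<close> would give the zero vector, which a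
    strongly odeco decomposition excludes.\<close>
  have "\<exists>c. c ^ 3 = T (f i) (f i) (f i) / form (f i) (f i) ^ 3" for i
    by (rule nth_root_exists) simp
  then obtain c where c: "\<And>i. c i ^ 3 = T (f i) (f i) (f i) / form (f i) (f i) ^ 3"
    by metis
  define v where "v i = scale (c i) (f i)" for i
  have c0: "c i \<noteq> 0" if "i \<in> J" for i
  proof
    assume "c i = 0"
    then show False
      using c[of i] that anis by (auto simp: J_def)
  qed
  have T_eq: "T = (\<Sum>i\<in>J. tensor3 form (v i) (v i) (v i))"
  proof (rule symmetric_tensor_eqI[OF T _ span])
    fix x y z assume "x \<in> f ` I" "y \<in> f ` I" "z \<in> f ` I"
    then obtain i j k where ijk: "i \<in> I" "j \<in> I" "k \<in> I" and xyz: "x = f i" "y = f j" "z = f k"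
      by blast
    have "(\<Sum>l\<in>J. tensor3 form (v l) (v l) (v l)) x y z =
        (\<Sum>l\<in>J. if l = i then (if i = j \<and> j = k then T (f i) (f i) (f i) else 0) else 0)"
      unfolding sum_fun3_apply xyz
    proof (rule sum.cong[OF refl])
      fix l assume "l \<in> J"
      then have "l \<in> I" using J by blast
      have "tensor3 form (v l) (v l) (v l) (f i) (f j) (f k) =
          c l ^ 3 * (form (f l) (f i) * form (f l) (f j) * form (f l) (f k))"
        by (simp add: tensor3_def v_def form_scale_left power3_eq_cube)
      also have "\<dots> = (if l = i then (if i = j \<and> j = k then T (f i) (f i) (f i) else 0) else 0)"
      proof (cases "l = i \<and> i = j \<and> j = k")
        case True
        then have "c l ^ 3 * form (f l) (f l) ^ 3 = T (f l) (f l) (f l)"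
          using anis[OF \<open>l \<in> I\<close>] by (simp add: c)
        then show ?thesis
          using True by (simp add: power3_eq_cube mult.assoc)
      next
        case False
        then show ?thesis
          using orth[OF \<open>l \<in> I\<close> ijk(1)] orth[OF \<open>l \<in> I\<close> ijk(2)] orth[OF \<open>l \<in> I\<close> ijk(3)] by auto
      qed
      finally show "tensor3 form (v l) (v l) (v l) (f i) (f j) (f k) = \<dots>" .
    qed
    also have "\<dots> = (if i \<in> J then (if i = j \<and> j = k then T (f i) (f i) (f i) else 0) else 0)"
      using J(1) by simp
    also have "\<dots> = T x y z"
    proof (cases "i = j \<and> j = k")
      case True
      then show ?thesis using ijk by (auto simp: xyz J_def)
    next
      case False
      then show ?thesis using diag[OF ijk] by (auto simp: xyz)
    qed
    finally show "T x y z = (\<Sum>l\<in>J. tensor3 form (v l) (v l) (v l)) x y z" ..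
  qed (intro symmetric_tensors_sum tensor3_cube_symmetric)
  obtain h where h: "bij_betw h {..<card J} J"
    using ex_bij_betw_nat_finite[OF \<open>finite J\<close>] by (auto simp: atLeast0LessThan)
  have hJ: "h i \<in> J" if "i < card J" for i
    using h that by (auto simp: bij_betw_def)
  show ?thesis
    unfolding strongly_odeco_def
  proof (intro exI[of _ "card J"] exI[of _ "v \<circ> h"] conjI allI impI)
    show "T = (\<Sum>i<card J. tensor3 form ((v \<circ> h) i) ((v \<circ> h) i) ((v \<circ> h) i))"
      unfolding T_eq using sum.reindex_bij_betw[OF h, of "\<lambda>i. tensor3 form (v i) (v i) (v i)"] by simp
    fix i assume i: "i < card J"
    then show N: "form ((v \<circ> h) i) ((v \<circ> h) i) \<noteq> 0"
      using hJ[OF i] J anis c0 by (auto simp: v_def form_bilinear)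
    then show "(v \<circ> h) i \<noteq> 0"
      by auto
    fix j assume j: "j < card J" and "i \<noteq> j"
    then have "h i \<noteq> h j"
      using h i by (auto simp: bij_betw_def inj_on_def)
    then show "form ((v \<circ> h) i) ((v \<circ> h) j) = 0"
      using hJ[OF i] hJ[OF j] J orth by (auto simp: v_def form_bilinear)
  qed
qed

text \<open>Up to a factor, pairing with \<open>v j\<close> is a character of the algebra. Both the
  associativity of odeco tensors and their deformations are computed from this alone.\<close>

lemma form_mult_sum_cubes:
  fixes v :: "'i \<Rightarrow> 'v"
  assumes I: "finite I" and orth: "\<And>i j. i \<in> I \<Longrightarrow> j \<in> I \<Longrightarrow> i \<noteq> j \<Longrightarrow> form (v i) (v j) = 0"
    and T: "T = (\<Sum>i\<in>I. tensor_scale (c i) (tensor3 form (v i) (v i) (v i)))"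
    and j: "j \<in> I"
  shows "form (v j) (mult T x y) = c j * form (v j) (v j) * form (v j) x * form (v j) y"
proof -
  have "T \<in> symmetric_tensors form"
    unfolding T by (intro symmetric_tensors_sum symmetric_tensors_scale tensor3_cube_symmetric)
  then have "form (v j) (mult T x y) = T x y (v j)"
    by (simp add: form_sym[of "v j"] form_mult)
  also have "\<dots> = (\<Sum>i\<in>I. if i = j then c j * form (v j) x * form (v j) y * form (v j) (v j) else 0)"
    unfolding T sum_fun3_apply
    by (rule sum.cong) (auto simp: tensor_scale_def tensor3_def orth j)
  finally show ?thesis
    using I j by (simp add: mult_ac)
qed

lemma polynomial_functions_evaluation:
  "(\<lambda>T. T x y z) \<in> polynomial_functions tensor_scale (symmetric_tensors form)"
  by (rule polynomial_functions.linear) (auto simp: tensor_scale_def)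

theorem odeco_variety_subset_associative: "odeco_variety form \<subseteq> associative_tensors scale form"
proof
  fix T assume "T \<in> odeco_variety form"
  then have T: "T \<in> symmetric_tensors form"
    and van: "\<And>p. p \<in> polynomial_functions tensor_scale (symmetric_tensors form) \<Longrightarrow>
      (\<And>S. S \<in> symmetric_tensors form \<Longrightarrow> strongly_odeco form S \<Longrightarrow> p S = 0) \<Longrightarrow> p T = 0"
    by (auto simp: odeco_variety_def zariski_closure_def)
  obtain d where d: "\<And>a. a = (\<Sum>b\<in>Basis. scale (form a (d b)) b)"
    using dual_basis by blast
  have exp: "S (mult S x y) z w = (\<Sum>b\<in>Basis. S x y (d b) * S b z w)" if S: "S \<in> symmetric_tensors form" for S x y z w
    by (subst d[of "mult S x y"])
       (simp add: form_mult[OF S] symmetric_tensor_sum[OF S] symmetric_tensor_scale[OF S])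
  show "T \<in> associative_tensors scale form"
    unfolding associative_tensors_iff[OF T]
  proof (intro allI)
    fix x y z w
    \<comment> \<open>The associator in coordinates: a polynomial in \<open>S\<close> of degree two,
      so its vanishing passes to the closure.\<close>
    define p where "p S = (\<Sum>b\<in>Basis. S x y (d b) * S b z w) - (\<Sum>b\<in>Basis. S y z (d b) * S b x w)"
      for S :: "'v \<Rightarrow> 'v \<Rightarrow> 'v \<Rightarrow> complex"
    have "p T = 0"
    proof (rule van)
      show "p \<in> polynomial_functions tensor_scale (symmetric_tensors form)"
        unfolding p_def
        by (intro polynomial_functions_diff polynomial_functions_sum polynomial_functions.mult
            polynomial_functions_evaluation)
      fix S assume S: "S \<in> symmetric_tensors form" and "strongly_odeco form S"
      then obtain k and v :: "nat \<Rightarrow> 'v" where Sv: "S = (\<Sum>i<k. tensor3 form (v i) (v i) (v i))"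
        and orth: "\<forall>i<k. \<forall>j<k. i \<noteq> j \<longrightarrow> form (v i) (v j) = 0"
        by (auto simp: strongly_odeco_def)
      have Sv': "S = (\<Sum>i<k. tensor_scale 1 (tensor3 form (v i) (v i) (v i)))"
        using Sv by (simp add: tensor_scale_def)
      \<comment> \<open>The right-hand side is symmetric in all four arguments, which contains
        associativity.\<close>
      have "S (mult S x y) z w = (\<Sum>i<k. form (v i) (v i) * form (v i) x * form (v i) y * form (v i) z * form (v i) w)"
        for x y z w
      proof -
        have "S (mult S x y) z w = (\<Sum>i<k. form (v i) (mult S x y) * form (v i) z * form (v i) w)"
          by (subst Sv) (simp add: sum_fun3_apply tensor3_def)
        then show ?thesis
          using form_mult_sum_cubes[of "{..<k}" v S "\<lambda>_. 1", OF _ _ Sv'] orth by simp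
      qed
      moreover have "p S = S (mult S x y) z w - S (mult S y z) x w"
        by (simp add: p_def exp[OF S])
      ultimately show "p S = 0"
        by (simp add: mult_ac)
    qed
    then show "T (mult T x y) z w = T (mult T y z) x w"
      by (simp add: p_def exp[OF T])
  qed
qed

end
subsection \<open>Linear systems depending polynomially on a parameter\<close>

text \<open>Induction on the equations: one equation is solved for an unknown \<open>r\<close> with
  nonzero coefficient, and \<open>r\<close> is eliminated from the others.\<close>

lemma underdetermined_system:
  fixes A :: "'q \<Rightarrow> 'p \<Rightarrow> 'a::field"
  assumes "finite Q" "finite P" "card Q < card P"
  shows "\<exists>x. (\<exists>p\<in>P. x p \<noteq> 0) \<and> (\<forall>q\<in>Q. (\<Sum>p\<in>P. A q p * x p) = 0)"
  using assms
proof (induction Q arbitrary: P A rule: finite_induct)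
  case empty
  then obtain p where "p \<in> P"
    by (metis card.empty card_gt_0_iff ex_in_conv)
  then show ?case
    by (intro exI[of _ "\<lambda>_. 1"]) auto
next
  case (insert q Q)
  show ?case
  proof (cases "\<forall>p\<in>P. A q p = 0")
    case True
    have "card Q < card P"
      using insert by simp
    from insert.IH[OF \<open>finite P\<close> this, of A] show ?thesis
      using True by auto
  next
    case False
    then obtain r where r: "r \<in> P" "A q r \<noteq> 0"
      by blast
    define A' where "A' q' p = A q' p - A q' r * A q p / A q r" for q' p
    have "card Q < card (P - {r})"
      using insert r by simp
    then obtain x where x: "\<exists>p\<in>P - {r}. x p \<noteq> 0"
      and sol: "\<forall>q'\<in>Q. (\<Sum>p\<in>P - {r}. A' q' p * x p) = 0"
      using insert.IH[of "P - {r}" A'] insert.prems by auto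
    define t where "t = - (\<Sum>p\<in>P - {r}. A q p * x p) / A q r"
    define y where "y = x(r := t)"
    have split: "(\<Sum>p\<in>P. A q' p * y p) = A q' r * t + (\<Sum>p\<in>P - {r}. A q' p * x p)" for q'
    proof -
      have "(\<Sum>p\<in>P. A q' p * y p) = A q' r * y r + (\<Sum>p\<in>P - {r}. A q' p * y p)"
        using r insert.prems by (simp add: sum.remove)
      also have "(\<Sum>p\<in>P - {r}. A q' p * y p) = (\<Sum>p\<in>P - {r}. A q' p * x p)"
        by (rule sum.cong) (auto simp: y_def)
      finally show ?thesis
        by (simp add: y_def)
    qed
    have "(\<Sum>p\<in>P. A q' p * y p) = 0" if "q' \<in> Q" for q'
    proof -
      have "0 = (\<Sum>p\<in>P - {r}. A' q' p * x p)"
        using sol that by simp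
      also have "\<dots> = (\<Sum>p\<in>P - {r}. A q' p * x p) - (\<Sum>p\<in>P - {r}. A q' r / A q r * (A q p * x p))"
        unfolding A'_def sum_subtractf[symmetric] by (rule sum.cong) (auto simp: algebra_simps)
      also have "\<dots> = (\<Sum>p\<in>P. A q' p * y p)"
        unfolding split t_def sum_distrib_left[symmetric] by simp
      finally show ?thesis ..
    qed
    moreover have "(\<Sum>p\<in>P. A q p * y p) = 0"
      unfolding split t_def using r by simp
    moreover have "\<exists>p\<in>P. y p \<noteq> 0"
      using x by (auto simp: y_def)
    ultimately show ?thesis
      by blast
  qed
qed

text \<open>
  Writing \<open>M w\<close> for the matrix at a fixed point \<open>w\<close>, the determinant of \<open>(M w)\<^sup>* M a\<close> is a polynomial
  in \<open>a\<close> that vanishes wherever \<open>M a\<close> has a kernel; at \<open>a = w\<close> its vanishing forces a kernel of \<open>M w\<close>.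
\<close>
lemma kernel_on_zariski_closure:
  fixes M :: "'j \<Rightarrow> 'i \<Rightarrow> 'w::ab_group_add \<Rightarrow> complex"
  assumes I: "finite I" and J: "finite J"
    and poly: "\<And>i j. i \<in> I \<Longrightarrow> j \<in> J \<Longrightarrow> M j i \<in> polynomial_functions sc W"
    and ker: "\<And>a. a \<in> A \<Longrightarrow> \<exists>s. (\<exists>i\<in>I. s i \<noteq> 0) \<and> (\<forall>j\<in>J. (\<Sum>i\<in>I. M j i a * s i) = 0)"
    and w: "w \<in> zariski_closure sc W A"
  shows "\<exists>s. (\<exists>i\<in>I. s i \<noteq> 0) \<and> (\<forall>j\<in>J. (\<Sum>i\<in>I. M j i w * s i) = 0)"
proof -
  define N where "N = card I"
  obtain h where h: "bij_betw h {0..<N} I"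
    using ex_bij_betw_nat_finite[OF I] by (auto simp: N_def)
  have hI: "h k \<in> I" if "k < N" for k
    using h that by (auto simp: bij_betw_def)
  have reindex: "(\<Sum>i\<in>I. g i) = (\<Sum>k\<in>{0..<N}. g (h k))" for g :: "'i \<Rightarrow> complex"
    using sum.reindex_bij_betw[OF h] by metis
  \<comment> \<open>\<open>G a\<close> is square even when equations outnumber unknowns, so a single
    determinant replaces all maximal minors.\<close>
  define G where "G a = mat N N (\<lambda>(i, k). \<Sum>j\<in>J. cnj (M j (h i) w) * M j (h k) a)" for a
  have G: "G a \<in> carrier_mat N N" for a
    by (simp add: G_def)
  have G_mult: "(G a *\<^sub>v v) $ i = (\<Sum>j\<in>J. cnj (M j (h i) w) * (\<Sum>k\<in>{0..<N}. M j (h k) a * v $ k))"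
    if "i < N" "v \<in> carrier_vec N" for a v i
  proof -
    have "(G a *\<^sub>v v) $ i = (\<Sum>k\<in>{0..<N}. (\<Sum>j\<in>J. cnj (M j (h i) w) * M j (h k) a) * v $ k)"
      using that by (simp add: G_def scalar_prod_def)
    also have "\<dots> = (\<Sum>k\<in>{0..<N}. \<Sum>j\<in>J. cnj (M j (h i) w) * (M j (h k) a * v $ k))"
      by (simp add: sum_distrib_right mult.assoc)
    also have "\<dots> = (\<Sum>j\<in>J. \<Sum>k\<in>{0..<N}. cnj (M j (h i) w) * (M j (h k) a * v $ k))"
      by (rule sum.swap)
    finally show ?thesis
      by (simp add: sum_distrib_left)
  qed
  have "(\<lambda>a. det (G a)) \<in> polynomial_functions sc W"
  proof -
    have "(\<lambda>a. \<Sum>p | p permutes {0..<N}. signof p * (\<Prod>i\<in>{0..<N}. \<Sum>j\<in>J. cnj (M j (h i) w) * M j (h (p i)) a))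
        \<in> polynomial_functions sc W"
      by (intro polynomial_functions_sum polynomial_functions_cmult polynomial_functions_prod poly hI)
         (auto simp: permutes_in_image)
    also have "(\<lambda>a. \<Sum>p | p permutes {0..<N}. signof p * (\<Prod>i\<in>{0..<N}. \<Sum>j\<in>J. cnj (M j (h i) w) * M j (h (p i)) a))
        = (\<lambda>a. det (G a))"
    proof
      fix a
      show "(\<Sum>p | p permutes {0..<N}. signof p * (\<Prod>i\<in>{0..<N}. \<Sum>j\<in>J. cnj (M j (h i) w) * M j (h (p i)) a))
          = det (G a)"
        unfolding det_def'[OF G]
        by (intro sum.cong arg_cong2[where f = "(*)"] prod.cong) (auto simp: G_def permutes_in_image)
    qed
    finally show ?thesis .
  qed
  moreover have "det (G a) = 0" if a: "a \<in> A" for a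
  proof -
    obtain s where s: "\<exists>i\<in>I. s i \<noteq> 0" and sol: "\<forall>j\<in>J. (\<Sum>i\<in>I. M j i a * s i) = 0"
      using ker[OF a] by blast
    define v where "v = vec N (\<lambda>k. s (h k))"
    have v: "v \<in> carrier_vec N"
      by (simp add: v_def)
    obtain k where k: "k < N" "s (h k) \<noteq> 0"
      using s h by (auto simp: bij_betw_def)
    then have "v \<noteq> 0\<^sub>v N"
      by (metis index_vec index_zero_vec(1) v_def)
    moreover have "G a *\<^sub>v v = 0\<^sub>v N"
    proof (rule eq_vecI)
      fix i assume i: "i < dim_vec (0\<^sub>v N)"
      then show "(G a *\<^sub>v v) $ i = 0\<^sub>v N $ i"
        using sol by (simp add: G_mult[OF _ v]) (simp add: v_def reindex)
    qed (simp add: G_def)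
    ultimately show ?thesis
      using det_0_iff_vec_prod_zero_field[OF G] v by blast
  qed
  ultimately have "det (G w) = 0"
    using w by (auto simp: zariski_closure_def)
  then obtain v where v: "v \<in> carrier_vec N" "v \<noteq> 0\<^sub>v N" and Gv: "G w *\<^sub>v v = 0\<^sub>v N"
    using det_0_iff_vec_prod_zero_field[OF G] by blast
  \<comment> \<open>\<open>r\<close> is M(w) v. Pairing G(w) v with the conjugate of
    \<open>v\<close> gives the sum of the squares |r j|^2, so a kernel vector of \<open>G w\<close>
    is a kernel vector of M(w) itself.\<close>
  define r where "r j = (\<Sum>k\<in>{0..<N}. M j (h k) w * v $ k)" for j
  have "cnj (r j) = (\<Sum>i\<in>{0..<N}. cnj (v $ i) * cnj (M j (h i) w))" for j
    by (simp add: r_def cnj_sum mult.commute)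
  then have "(\<Sum>j\<in>J. cnj (r j) * r j) = (\<Sum>j\<in>J. \<Sum>i\<in>{0..<N}. cnj (v $ i) * (cnj (M j (h i) w) * r j))"
    by (simp add: sum_distrib_right mult.assoc)
  also have "\<dots> = (\<Sum>i\<in>{0..<N}. cnj (v $ i) * (\<Sum>j\<in>J. cnj (M j (h i) w) * r j))"
    by (subst sum.swap) (simp add: sum_distrib_left)
  also have "\<dots> = (\<Sum>i\<in>{0..<N}. cnj (v $ i) * (G w *\<^sub>v v) $ i)"
    by (rule sum.cong) (auto simp: G_mult[OF _ v(1)] r_def)
  also have "\<dots> = 0"
    by (simp add: Gv)
  finally have "(\<Sum>j\<in>J. complex_of_real ((cmod (r j))\<^sup>2)) = 0"
    unfolding complex_norm_square by (simp add: mult.commute)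
  then have "(\<Sum>j\<in>J. (cmod (r j))\<^sup>2) = 0"
    by (metis of_real_eq_0_iff of_real_sum)
  then have r0: "r j = 0" if "j \<in> J" for j
    using J that by (simp add: sum_nonneg_eq_0_iff)
  have inv: "the_inv_into {0..<N} h (h k) = k" if "k < N" for k
    using h that by (auto simp: bij_betw_def the_inv_into_f_f)
  define s where "s i = v $ the_inv_into {0..<N} h i" for i
  obtain k where k: "k < N" "v $ k \<noteq> 0"
    using v by (metis carrier_vecD eq_vecI index_zero_vec)
  have "\<exists>i\<in>I. s i \<noteq> 0"
    using k hI[of k] inv[of k] by (intro bexI[of _ "h k"]) (simp_all add: s_def)
  moreover have "(\<Sum>i\<in>I. M j i w * s i) = 0" if "j \<in> J" for j
    using r0[OF that] by (simp add: reindex s_def r_def inv)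
  ultimately show ?thesis
    by blast
qed

context nondegenerate_symmetric_form
begin

subsection \<open>Orthogonal families\<close>

lemma dual_family_independent:
  assumes I: "finite I" and dual: "\<And>i j. i \<in> I \<Longrightarrow> j \<in> I \<Longrightarrow> form (f i) (g j) = (if i = j then c j else 0)"
    and c: "\<And>j. j \<in> I \<Longrightarrow> c j \<noteq> 0"
  shows "inj_on f I" "independent (f ` I)"
proof -
  show inj: "inj_on f I"
  proof
    fix i j assume "i \<in> I" "j \<in> I" "f i = f j"
    then show "i = j"
      using dual[of i j] dual[of j j] c[of j] by (auto split: if_splits)
  qed
  show "independent (f ` I)"
  proof
    assume "dependent (f ` I)"
    then obtain u where u: "\<exists>v\<in>f ` I. u v \<noteq> 0" and sum: "(\<Sum>v\<in>f ` I. scale (u v) v) = 0"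
      using dependent_finite I by auto
    obtain j where j: "j \<in> I" "u (f j) \<noteq> 0"
      using u by blast
    have "0 = form (\<Sum>v\<in>f ` I. scale (u v) v) (g j)"
      by (simp add: sum)
    also have "\<dots> = (\<Sum>i\<in>I. u (f i) * form (f i) (g j))"
      by (simp add: sum.reindex[OF inj] form_sum_left form_scale_left)
    also have "\<dots> = (\<Sum>i\<in>I. if i = j then u (f j) * c j else 0)"
      by (rule sum.cong) (auto simp: dual j)
    also have "\<dots> = u (f j) * c j"
      using I j by simp
    finally show False
      using j c by simp
  qed
qed

lemma dual_family_card:
  assumes "finite I" "\<And>i j. i \<in> I \<Longrightarrow> j \<in> I \<Longrightarrow> form (f i) (g j) = (if i = j then c j else 0)"
    "\<And>j. j \<in> I \<Longrightarrow> c j \<noteq> 0"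
  shows "card I \<le> dim (UNIV :: 'v set)"
    and "card I = dim (UNIV :: 'v set) \<longleftrightarrow> span (f ` I) = UNIV"
proof -
  note ind = dual_family_independent[OF assms]
  have card: "card (f ` I) = card I"
    by (rule card_image[OF ind(1)])
  show "card I \<le> dim (UNIV :: 'v set)"
    using independent_card_le_dim[OF subset_UNIV ind(2)] card by simp
  show "card I = dim (UNIV :: 'v set) \<longleftrightarrow> span (f ` I) = UNIV"
  proof
    assume "card I = dim (UNIV :: 'v set)"
    then have "UNIV \<subseteq> span (f ` I)"
      using card_ge_dim_independent[OF subset_UNIV ind(2)] card by simp
    then show "span (f ` I) = UNIV" by blast
  next
    assume "span (f ` I) = UNIV"
    then show "card I = dim (UNIV :: 'v set)"
      using dim_eq_card[OF _ ind(2), of UNIV] card by (simp add: span_UNIV)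
  qed
qed

definition orthogonal_family :: "'i set \<Rightarrow> ('i \<Rightarrow> 'v) \<Rightarrow> bool" where
  "orthogonal_family I f \<longleftrightarrow> finite I \<and>
    (\<forall>i\<in>I. \<forall>j\<in>I. i \<noteq> j \<longrightarrow> form (f i) (f j) = 0) \<and> (\<forall>i\<in>I. form (f i) (f i) \<noteq> 0)"

lemma orthogonal_family_card:
  assumes "orthogonal_family I f"
  shows "card I \<le> dim (UNIV :: 'v set)"
    and "card I = dim (UNIV :: 'v set) \<longleftrightarrow> span (f ` I) = UNIV"
proof -
  have "form (f i) (f j) = (if i = j then form (f j) (f j) else 0)"
    and "form (f j) (f j) \<noteq> 0" if "i \<in> I" "j \<in> I" for i j
    using assms that by (auto simp: orthogonal_family_def)
  moreover have "finite I"
    using assms by (simp add: orthogonal_family_def)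
  ultimately show "card I \<le> dim (UNIV :: 'v set)"
    and "card I = dim (UNIV :: 'v set) \<longleftrightarrow> span (f ` I) = UNIV"
    using dual_family_card[of I f f "\<lambda>j. form (f j) (f j)"] by blast+
qed

lemma orthogonal_projection:
  assumes "orthogonal_family I f"
  shows "\<exists>y'. y - y' \<in> span (f ` I) \<and> (\<forall>i\<in>I. form y' (f i) = 0)"
proof (intro exI conjI ballI)
  define p where "p = (\<Sum>i\<in>I. scale (form y (f i) / form (f i) (f i)) (f i))"
  show "y - (y - p) \<in> span (f ` I)"
    by (simp add: p_def span_sum span_scale span_base)
  show "form (y - p) (f j) = 0" if j: "j \<in> I" for j
  proof -
    have "form p (f j) = (\<Sum>i\<in>I. if i = j then form y (f j) else 0)"
      unfolding p_def form_sum_left form_scale_left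
      by (rule sum.cong) (use assms j in \<open>auto simp: orthogonal_family_def\<close>)
    then show ?thesis
      using assms j by (simp add: form_diff_left orthogonal_family_def)
  qed
qed

lemma form_span_zero:
  assumes "x \<in> span B" "\<And>b. b \<in> B \<Longrightarrow> form y b = 0"
  shows "form y x = 0"
  using assms(1) by (induction rule: span_induct_alt) (auto simp: form_bilinear assms(2))

lemma orthogonal_complement_nondegenerate:
  assumes f: "orthogonal_family I f" and z: "z \<noteq> 0" "\<forall>i\<in>I. form z (f i) = 0"
  shows "\<exists>y. form z y \<noteq> 0 \<and> (\<forall>i\<in>I. form y (f i) = 0)"
proof -
  obtain y0 where y0: "form z y0 \<noteq> 0"
    using form_nondegenerate z by blast
  obtain y where y: "y0 - y \<in> span (f ` I)" "\<forall>i\<in>I. form y (f i) = 0"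
    using orthogonal_projection[OF f] by blast
  have "form z (y0 - y) = 0"
    by (rule form_span_zero[OF y(1)]) (use z in auto)
  then have "form z y \<noteq> 0"
    using y0 by (simp add: form_bilinear)
  then show ?thesis
    using y by blast
qed

lemma orthogonal_complement_nonzero:
  assumes f: "orthogonal_family I f" and card: "card I < dim (UNIV :: 'v set)"
  shows "\<exists>z. z \<noteq> 0 \<and> (\<forall>i\<in>I. form z (f i) = 0)"
proof -
  obtain y where y: "y \<notin> span (f ` I)"
    using orthogonal_family_card(2)[OF f] card by auto
  obtain z where z: "y - z \<in> span (f ` I)" "\<forall>i\<in>I. form z (f i) = 0"
    using orthogonal_projection[OF f] by blast
  then have "z \<noteq> 0"
    using y by auto
  then show ?thesis
    using z by blast
qed

text \<open>Polarisation: if (z|y) is nonzero, then z, y and z + y cannot all be isotropic.\<close>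

lemma orthogonal_complement_anisotropic:
  assumes f: "orthogonal_family I f" and card: "card I < dim (UNIV :: 'v set)"
  shows "\<exists>z. form z z \<noteq> 0 \<and> (\<forall>i\<in>I. form z (f i) = 0)"
proof -
  obtain z where z: "z \<noteq> 0" "\<forall>i\<in>I. form z (f i) = 0"
    using orthogonal_complement_nonzero[OF f card] by blast
  obtain y where y: "form z y \<noteq> 0" "\<forall>i\<in>I. form y (f i) = 0"
    using orthogonal_complement_nondegenerate[OF f z] by blast
  have "form (z + y) (z + y) = form z z + form y y + 2 * form z y"
    by (simp add: form_bilinear form_sym[of y z])
  then have "form z z \<noteq> 0 \<or> form y y \<noteq> 0 \<or> form (z + y) (z + y) \<noteq> 0"
    using y by auto
  moreover have "\<forall>i\<in>I. form (z + y) (f i) = 0"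
    using z y by (simp add: form_add_left)
  ultimately show ?thesis
    using z y by blast
qed

lemma orthogonal_family_extend:
  assumes f: "orthogonal_family {..<k} f" and z: "form z z \<noteq> 0" "\<forall>i\<in>{..<k}. form z (f i) = 0"
  shows "orthogonal_family {..<Suc k} (f(k := z))"
  using assms unfolding orthogonal_family_def
  by (auto simp: less_Suc_eq form_sym[of "f _" z])

lemma orthogonal_family_extend_basis:
  assumes "orthogonal_family {..<k} f"
  shows "\<exists>g. orthogonal_family {..<dim (UNIV :: 'v set)} g \<and> (\<forall>i<k. g i = f i)"
proof -
  have le: "k \<le> dim (UNIV :: 'v set)"
    using orthogonal_family_card(1)[OF assms] by simp
  have "\<exists>g. orthogonal_family {..<m} g \<and> (\<forall>i<k. g i = f i)" if "k \<le> m" "m \<le> dim (UNIV :: 'v set)" for m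
    using that
  proof (induction m rule: dec_induct)
    case base
    then show ?case using assms by blast
  next
    case (step m)
    then obtain g where g: "orthogonal_family {..<m} g" "\<forall>i<k. g i = f i"
      by auto
    obtain z where z: "form z z \<noteq> 0" "\<forall>i\<in>{..<m}. form z (g i) = 0"
      using orthogonal_complement_anisotropic[OF g(1)] step.prems by auto
    have "orthogonal_family {..<Suc m} (g(m := z))"
      by (rule orthogonal_family_extend[OF g(1) z])
    moreover have "\<forall>i<k. (g(m := z)) i = f i"
      using g step.hyps by auto
    ultimately show ?case by blast
  qed
  then show ?thesis
    using le by blast
qed

lemma orthonormal_basis:
  obtains e where "\<And>i j. i < dim (UNIV :: 'v set) \<Longrightarrow> j < dim (UNIV :: 'v set) \<Longrightarrow>
    form (e i) (e j) = (if i = j then 1 else 0)"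
proof -
  have "orthogonal_family {..<0::nat} (\<lambda>_. 0)"
    by (simp add: orthogonal_family_def)
  then obtain g where g: "orthogonal_family {..<dim (UNIV :: 'v set)} g"
    using orthogonal_family_extend_basis by blast
  have "\<exists>c. c ^ 2 = 1 / form (g i) (g i)" for i
    by (rule nth_root_exists) simp
  then obtain c where c: "\<And>i. c i ^ 2 = 1 / form (g i) (g i)"
    by metis
  show thesis
  proof
    fix i j assume ij: "i < dim (UNIV :: 'v set)" "j < dim (UNIV :: 'v set)"
    show "form (scale (c i) (g i)) (scale (c j) (g j)) = (if i = j then 1 else 0)"
    proof (cases "i = j")
      case True
      have "form (scale (c i) (g i)) (scale (c j) (g j)) = c i ^ 2 * form (g i) (g i)"
        by (simp add: True form_bilinear power2_eq_square)
      then show ?thesis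
        using True g ij by (simp add: c orthogonal_family_def)
    next
      case False
      then show ?thesis
        using g ij by (simp add: form_bilinear orthogonal_family_def)
    qed
  qed
qed


text \<open>The coordinate functionals of the basis \<open>f\<close> are represented by vectors
  through the form; \<open>dual_basis\<close> supplies the representing vectors.\<close>

lemma dual_family_exists:
  assumes I: "finite I" "card I = dim (UNIV :: 'v set)" and span: "span (f ` I) = UNIV"
  shows "\<exists>g. \<forall>i\<in>I. \<forall>j\<in>I. form (f i) (g j) = (if i = j then 1 else 0)"
proof -
  obtain d where d: "\<And>a. a = (\<Sum>b\<in>Basis. scale (form a (d b)) b)"
    using dual_basis by blast
  have card: "card (f ` I) = card I"
    using span_card_ge_dim[of "f ` I" UNIV] card_image_le[OF I(1), of f] span I by auto
  then have inj: "inj_on f I"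
    by (rule eq_card_imp_inj_on[OF I(1)])
  have ind: "independent (f ` I)"
    using card_le_dim_spanning[of "f ` I" UNIV] span I card by auto
  note in_span = UNIV_I[of x for x :: 'v, folded span]
  define g where "g j = (\<Sum>b\<in>Basis. scale (representation (f ` I) b (f j)) (d b))" for j
  have g: "form y (g j) = representation (f ` I) y (f j)" for y j
  proof -
    have "representation (f ` I) y (f j) =
        representation (f ` I) (\<Sum>b\<in>Basis. scale (form y (d b)) b) (f j)"
      by (simp flip: d)
    also have "\<dots> = (\<Sum>b\<in>Basis. form y (d b) * representation (f ` I) b (f j))"
      by (simp add: representation_sum[OF ind in_span] representation_scale[OF ind in_span])
    finally show ?thesis
      by (simp add: g_def form_sum_right form_scale_right mult.commute)
  qed
  have "form (f i) (g j) = (if i = j then 1 else 0)" if "i \<in> I" "j \<in> I" for i j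
    unfolding g using representation_basis[OF ind, of "f i"] inj that by (auto simp: inj_on_def)
  then show ?thesis by blast
qed

lemma dual_family_expansion:
  assumes I: "finite I" and span: "span (f ` I) = UNIV"
    and dual: "\<And>i j. i \<in> I \<Longrightarrow> j \<in> I \<Longrightarrow> form (f i) (g j) = (if i = j then 1 else 0)"
  shows "y = (\<Sum>i\<in>I. scale (form y (g i)) (f i))"
proof -
  have "y \<in> span (f ` I)" using span by simp
  then show ?thesis
  proof (induction rule: span_induct_alt)
    case base
    then show ?case by simp
  next
    case (step c x y)
    then obtain j where j: "j \<in> I" "x = f j" by blast
    have "x = (\<Sum>i\<in>I. if i = j then f j else 0)"
      using I j by simp
    also have "\<dots> = (\<Sum>i\<in>I. scale (form x (g i)) (f i))"
      using j dual by (intro sum.cong) auto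
    finally have x: "x = (\<Sum>i\<in>I. scale (form x (g i)) (f i))" .
    have "scale c x + y = scale c (\<Sum>i\<in>I. scale (form x (g i)) (f i)) + (\<Sum>i\<in>I. scale (form y (g i)) (f i))"
      using x step.IH by simp
    also have "\<dots> = (\<Sum>i\<in>I. scale (form (scale c x + y) (g i)) (f i))"
      by (simp add: form_bilinear scale_left_distrib sum.distrib scale_sum_right)
    finally show ?case .
  qed
qed

subsection \<open>Polynomials in a linear operator\<close>

definition linear_operator :: "('v \<Rightarrow> 'v) \<Rightarrow> bool" where
  "linear_operator X \<longleftrightarrow> (\<forall>x y. X (x + y) = X x + X y) \<and> (\<forall>r x. X (scale r x) = scale r (X x))"

definition poly_operator :: "('v \<Rightarrow> 'v) \<Rightarrow> complex poly \<Rightarrow> 'v \<Rightarrow> 'v" where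
  "poly_operator X p v = (\<Sum>i\<le>degree p. scale (coeff p i) ((X ^^ i) v))"

lemma linear_operatorD:
  assumes "linear_operator X"
  shows "X (x + y) = X x + X y" "X (scale r x) = scale r (X x)" "X 0 = 0"
    "X (x - y) = X x - X y" "X (sum f S) = (\<Sum>i\<in>S. X (f i))"
proof -
  show add: "X (x + y) = X x + X y" and sc: "X (scale r x) = scale r (X x)" for x y r
    using assms by (auto simp: linear_operator_def)
  show zero: "X 0 = 0"
    using sc[of 0 0] by simp
  show "X (x - y) = X x - X y"
    using add[of "x - y" y] by simp
  show "X (sum f S) = (\<Sum>i\<in>S. X (f i))"
    by (induction S rule: infinite_finite_induct) (simp_all add: zero add)
qed

lemma linear_operator_mult: "T \<in> symmetric_tensors form \<Longrightarrow> linear_operator (mult T x)"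
  by (simp add: linear_operator_def mult_add_right mult_scale_right)

lemma poly_operator_bound:
  assumes "degree p \<le> N"
  shows "poly_operator X p v = (\<Sum>i\<le>N. scale (coeff p i) ((X ^^ i) v))"
  unfolding poly_operator_def
  by (rule sum.mono_neutral_left) (use assms in \<open>auto simp: coeff_eq_0\<close>)

lemma poly_operator_add: "poly_operator X (p + q) v = poly_operator X p v + poly_operator X q v"
proof -
  define N where "N = max (degree p) (degree q)"
  have "degree (p + q) \<le> N" "degree p \<le> N" "degree q \<le> N"
    by (auto simp: N_def degree_add_le)
  then show ?thesis
    by (simp add: poly_operator_bound[of _ N] scale_left_distrib sum.distrib)
qed

lemma poly_operator_zero [simp]: "poly_operator X 0 v = 0"
  by (simp add: poly_operator_def)

lemma poly_operator_smult: "poly_operator X (Polynomial.smult c p) v = scale c (poly_operator X p v)"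
  by (simp add: poly_operator_bound[of _ "degree p"] degree_smult_le scale_sum_right)

lemma poly_operator_pCons:
  assumes "linear_operator X"
  shows "poly_operator X (pCons a p) v = scale a v + X (poly_operator X p v)"
proof -
  have "poly_operator X (pCons a p) v = (\<Sum>i\<le>Suc (degree p). scale (coeff (pCons a p) i) ((X ^^ i) v))"
    by (rule poly_operator_bound) (simp add: degree_pCons_le)
  also have "\<dots> = scale a v + (\<Sum>i\<le>degree p. scale (coeff p i) (X ((X ^^ i) v)))"
    by (simp add: sum.atMost_Suc_shift del: sum.atMost_Suc)
  finally show ?thesis
    by (simp add: poly_operator_def linear_operatorD[OF assms])
qed

lemma poly_operator_mult:
  assumes "linear_operator X"
  shows "poly_operator X (p * q) v = poly_operator X p (poly_operator X q v)"
  by (induction p)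
     (simp_all add: poly_operator_add poly_operator_smult poly_operator_pCons[OF assms])

lemma linear_operator_poly:
  assumes "linear_operator X"
  shows "linear_operator (poly_operator X p)"
proof (induction p)
  case (pCons a p)
  then show ?case
    by (auto simp: linear_operator_def poly_operator_pCons[OF assms] linear_operatorD[OF assms]
        algebra_simps)
qed (simp add: linear_operator_def)

lemma poly_operator_commute:
  assumes "linear_operator X"
  shows "poly_operator X p (X v) = X (poly_operator X p v)"
  by (induction p) (simp_all add: poly_operator_pCons[OF assms] linear_operatorD[OF assms])

lemma poly_operator_adjoint:
  assumes "linear_operator X" "\<And>x y. form (X x) y = form x (X y)"
  shows "form (poly_operator X p x) y = form x (poly_operator X p y)"
  by (induction p arbitrary: y) (simp_all add: poly_operator_pCons[OF assms(1)]
    form_bilinear assms(2) poly_operator_commute[OF assms(1)])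

lemma poly_operator_invariant:
  assumes "linear_operator X" "subspace E" "\<And>x. x \<in> E \<Longrightarrow> X x \<in> E" "v \<in> E"
  shows "poly_operator X p v \<in> E"
  by (induction p)
     (simp_all add: poly_operator_pCons[OF assms(1)] assms subspace_0 subspace_add subspace_scale)

text \<open>Split a linear factor off the annihilator, p = (x - r) q. Either q(X) v is an
  eigenvector for r, or q annihilates v and has smaller degree.\<close>

lemma eigenvector_of_annihilator:
  assumes X: "linear_operator X" and E: "subspace E" "\<And>x. x \<in> E \<Longrightarrow> X x \<in> E"
    and v: "v \<in> E" "v \<noteq> 0" and p: "p \<noteq> 0" "poly_operator X p v = 0"
  shows "\<exists>w\<in>E. w \<noteq> 0 \<and> (\<exists>r. X w = scale r w)"
  using p
proof (induction "degree p" arbitrary: p)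
  case 0
  then obtain c where "p = [:c:]"
    by (metis degree_eq_zeroE)
  then show ?case
    using 0 v by (simp add: poly_operator_pCons[OF X] linear_operatorD[OF X])
next
  case (Suc m)
  then have "degree p > 0"
    by simp
  then obtain r where "poly p r = 0"
    using alg_closed_imp_poly_has_root by blast
  then obtain q where q: "p = [:- r, 1:] * q"
    by (metis dvdE poly_eq_0_iff_dvd)
  define w where "w = poly_operator X q v"
  have w: "w \<in> E"
    unfolding w_def by (rule poly_operator_invariant[OF X E v(1)])
  have "0 = poly_operator X [:- r, 1:] w"
    using Suc.prems unfolding q w_def by (simp only: poly_operator_mult[OF X])
  then have eig: "X w = scale r w"
    by (simp add: poly_operator_pCons[OF X] linear_operatorD[OF X] scale_minus_left)
  show ?case
  proof (cases "w = 0")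
    case True
    have "q \<noteq> 0"
      using Suc.prems q by auto
    moreover have "degree p = 1 + degree q"
      unfolding q using \<open>q \<noteq> 0\<close> by (subst degree_mult_eq) auto
    ultimately have "q \<noteq> 0" "degree q = m"
      using Suc.hyps(2) by auto
    then show ?thesis
      using Suc.hyps(1)[of q] True by (simp add: w_def)
  next
    case False
    then show ?thesis using w eig by blast
  qed
qed

lemma eigenvector_exists:
  assumes X: "linear_operator X" and E: "subspace E" "\<And>x. x \<in> E \<Longrightarrow> X x \<in> E"
    and v: "v \<in> E" "v \<noteq> 0"
  shows "\<exists>w\<in>E. w \<noteq> 0 \<and> (\<exists>r. X w = scale r w)"
proof -
  \<comment> \<open>One power of \<open>X\<close> more than the dimension: the vectors v, X v, ...,
    X^N v with N = \<open>card Basis\<close> satisfy a linear relation.\<close>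
  have "card Basis < card {..card Basis}"
    by simp
  from underdetermined_system[OF finite_Basis _ this, of "\<lambda>b i. form ((X ^^ i) v) b"]
  obtain x where x: "\<exists>i\<in>{..card Basis}. x i \<noteq> 0"
    and sol: "\<forall>b\<in>Basis. (\<Sum>i\<le>card Basis. form ((X ^^ i) v) b * x i) = 0"
    by auto
  define p where "p = (\<Sum>i\<le>card Basis. monom (x i) i)"
  have coeff: "coeff p i = (if i \<le> card Basis then x i else 0)" for i
    by (simp add: p_def coeff_sum)
  then have "degree p \<le> card Basis"
    by (intro degree_le) auto
  then have pX: "poly_operator X p v = (\<Sum>i\<le>card Basis. scale (x i) ((X ^^ i) v))"
    by (simp add: poly_operator_bound coeff)
  have "form (poly_operator X p v) b = 0" if "b \<in> Basis" for b
    using sol that by (simp add: pX form_sum_left form_scale_left mult.commute)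
  then have "form (poly_operator X p v) y = 0" for y
    using form_span_zero[of y Basis "poly_operator X p v"] span_Basis by auto
  then have "poly_operator X p v = 0"
    using form_nondegenerate by blast
  moreover have "p \<noteq> 0"
    using x coeff by (metis atMost_iff coeff_0)
  ultimately show ?thesis
    using eigenvector_of_annihilator[OF X E v] by blast
qed

text \<open>The multiplications commute, so each one preserves the joint eigenspace of those already
  treated. Finitely many suffice because \<open>mult T y\<close> is linear in
  \<open>y\<close>.\<close>

lemma common_eigenvector:
  assumes T: "T \<in> associative_tensors scale form"
    and E: "subspace E" "\<And>x y. x \<in> E \<Longrightarrow> mult T y x \<in> E" and v: "v \<in> E" "v \<noteq> 0"
  shows "\<exists>k\<in>E. k \<noteq> 0 \<and> (\<forall>y. \<exists>r. mult T y k = scale r k)"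
proof -
  note sym = associative_tensorsD(1)[OF T]
  have comm: "mult T a (mult T b x) = mult T b (mult T a x)" for a b x
    using associative_tensorsD(2)[OF T] mult_commute[OF sym] by metis
  have "\<exists>l. \<exists>k\<in>E. k \<noteq> 0 \<and> (\<forall>b\<in>B. mult T b k = scale (l b) k)" if "finite B" for B
    using that
  proof (induction B rule: finite_induct)
    case empty
    then show ?case using v by auto
  next
    case (insert c B)
    then obtain l k where k: "k \<in> E" "k \<noteq> 0" "\<forall>b\<in>B. mult T b k = scale (l b) k"
      by blast
    define F where "F = {x \<in> E. \<forall>b\<in>B. mult T b x = scale (l b) x}"
    have "subspace F"
      unfolding subspace_def F_def using E(1)
      by (auto simp: subspace_0 subspace_add subspace_scale mult_add_right[OF sym] mult_scale_right[OF sym]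
          scale_right_distrib mult.commute linear_operatorD(3)[OF linear_operator_mult[OF sym]])
    moreover have "mult T c x \<in> F" if "x \<in> F" for x
      using that E(2) comm[of _ c x] by (auto simp: F_def mult_scale_right[OF sym])
    moreover have "k \<in> F"
      using k by (simp add: F_def)
    ultimately obtain w r where w: "w \<in> F" "w \<noteq> 0" "mult T c w = scale r w"
      using eigenvector_exists[OF linear_operator_mult[OF sym], of F c k] k(2) by blast
    have "\<forall>b\<in>insert c B. mult T b w = scale ((l(c := r)) b) w"
      using w insert.hyps by (auto simp: F_def)
    moreover have "w \<in> E"
      using w by (simp add: F_def)
    ultimately show ?case
      using w(2) by blast
  qed
  then obtain l k where k: "k \<in> E" "k \<noteq> 0" "\<forall>b\<in>Basis. mult T b k = scale (l b) k"
    using finite_Basis by blast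
  have "\<exists>r. mult T y k = scale r k" for y
  proof -
    have "y \<in> span Basis" using span_Basis by simp
    then show ?thesis
    proof (induction rule: span_induct_alt)
      case base
      have "mult T 0 k = scale 0 k"
        using mult_scale_left[OF sym, of 0 0 k] by simp
      then show ?case by blast
    next
      case (step c x y)
      then obtain r where "mult T y k = scale r k" by blast
      then have "mult T (scale c x + y) k = scale (c * l x + r) k"
        using k step by (simp add: mult_add_left[OF sym] mult_scale_left[OF sym] scale_left_distrib)
      then show ?case by blast
    qed
  qed
  then show ?thesis using k by blast
qed


section \<open>Simple spectrum and diagonalisation\<close>

text \<open>
  A multiple root of \<open>p - s q\<close> is a zero of the Wronskian of \<open>p\<close> and \<open>q\<close>, and determines \<open>s\<close>.
\<close>
lemma rsquarefree_pencil:
  fixes p q :: "complex poly"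
  assumes deg: "degree p > 0" and common: "\<And>z. poly p z = 0 \<Longrightarrow> poly q z = 0 \<Longrightarrow> False"
  shows "\<exists>S. finite S \<and> (\<forall>s. s \<notin> S \<longrightarrow> rsquarefree (p - Polynomial.smult s q))"
proof -
  define W where "W = pderiv p * q - p * pderiv q"
  have "W \<noteq> 0"
  proof
    assume "W = 0"
    then have W: "pderiv p * q = p * pderiv q"
      by (simp add: W_def)
    obtain r where r: "poly p r = 0"
      using alg_closed_imp_poly_has_root deg by blast
    have nz: "p \<noteq> 0" "pderiv p \<noteq> 0" "poly q r \<noteq> 0"
      using deg common[of r] r by (auto simp: pderiv_eq_0_iff)
    then have q: "q \<noteq> 0" "order r q = 0"
      using order_root[of q r] by auto
    \<comment> \<open>At the root \<open>r\<close> of \<open>p\<close>, where \<open>q\<close> does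
      not vanish, p' q has order one below that of \<open>p\<close>, while p q' has at least the
      order of \<open>p\<close>.\<close>
    have ord: "order r p = Suc (order r (pderiv p))"
      using order_pderiv[OF nz(1) r] .
    have "order r (pderiv p * q) = order r (pderiv p)"
      using order_mult[of "pderiv p" q r] nz q by simp
    moreover have "order r (p * pderiv q) = order r p + order r (pderiv q)"
      by (rule order_mult) (metis W nz(2) q(1) no_zero_divisors)
    ultimately show False
      using W ord by simp
  qed
  define S where "S = (\<lambda>z. poly p z / poly q z) ` {z. poly W z = 0}"
  have "rsquarefree (p - Polynomial.smult s q)" if s: "s \<notin> S" for s
    unfolding rsquarefree_roots
  proof (intro allI notI)
    fix z assume z: "poly (p - Polynomial.smult s q) z = 0 \<and> poly (pderiv (p - Polynomial.smult s q)) z = 0"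
    then have 1: "poly p z = s * poly q z" and 2: "poly (pderiv p) z = s * poly (pderiv q) z"
      by (simp_all add: pderiv_diff pderiv_smult)
    then have "poly q z \<noteq> 0"
      using common[of z] by auto
    then have "s = poly p z / poly q z"
      using 1 by simp
    moreover have "poly W z = 0"
      by (simp add: W_def 1 2)
    ultimately show False
      using s by (auto simp: S_def)
  qed
  moreover have "finite S"
    using poly_roots_finite[OF \<open>W \<noteq> 0\<close>] by (simp add: S_def)
  ultimately show ?thesis by blast
qed

text \<open>
  If the self-adjoint operator \<open>X\<close> is annihilated on its cyclic vector \<open>b\<close> by a polynomial with
  simple roots, then the algebra \<open>p(X) b \<cdot> q(X) b = X p(X) q(X) b\<close> is diagonal in an eigenbasis of \<open>X\<close>.
\<close>
lemma strongly_odeco_of_simple_spectrum: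
  assumes X: "linear_operator X" and adj: "\<And>x y. form (X x) y = form x (X y)"
    and n: "n = dim (UNIV :: 'v set)" "n > 0"
    and g: "\<And>i j. i < n \<Longrightarrow> j < n \<Longrightarrow> form ((X ^^ i) b) (g j) = (if i = j then 1 else 0)"
    and p: "degree p = n" "rsquarefree p" "poly_operator X p b = 0"
  shows "\<exists>S\<in>symmetric_tensors form. strongly_odeco form S \<and>
    (\<forall>i j k. S ((X ^^ i) b) ((X ^^ j) b) ((X ^^ k) b) = form ((X ^^ (i + j + k + 1)) b) b)"
proof -
  have p0: "p \<noteq> 0"
    using p n by auto
  define R where "R = {z. poly p z = 0}"
  have R: "finite R"
    using poly_roots_finite[OF p0] by (simp add: R_def)
  have cardR: "card R = n"
  proof -
    have "p = Polynomial.smult (lead_coeff p) (\<Prod>z\<in>R. [:- z, 1:])"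
      using complex_poly_decompose_rsquarefree[OF p(2)] by (simp add: R_def)
    then have "degree p = degree (\<Prod>z\<in>R. [:- z, 1:])"
      using p0 by (metis degree_smult_eq leading_coeff_0_iff)
    also have "\<dots> = card R"
      by (subst degree_prod_eq_sum_degree) auto
    finally show ?thesis using p by simp
  qed
  \<comment> \<open>The Lagrange polynomials of the roots, up to normalisation; P r (X) b is an
    eigenvector for the root \<open>r\<close>.\<close>
  define P where "P r = p div [:- r, 1:]" for r
  have P: "p = [:- r, 1:] * P r" if "r \<in> R" for r
    using that dvd_mult_div_cancel[of "[:- r, 1:]" p] unfolding P_def R_def
    by (metis mem_Collect_eq poly_eq_0_iff_dvd)
  have degP: "degree (P r) = n - 1" "P r \<noteq> 0" if "r \<in> R" for r
  proof -
    show nz: "P r \<noteq> 0"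
      using P[OF that] p0 by auto
    have "degree p = 1 + degree (P r)"
      by (subst P[OF that], subst degree_mult_eq) (use nz in auto)
    then show "degree (P r) = n - 1"
      using p by simp
  qed
  have P_diff: "poly (P r) r' = 0" if "r \<in> R" "r' \<in> R" "r \<noteq> r'" for r r'
  proof -
    have "poly p r' = (r' - r) * poly (P r) r'"
      by (subst P[OF that(1)]) (simp add: algebra_simps)
    then show ?thesis
      using that by (simp add: R_def)
  qed
  have P_same: "poly (P r) r \<noteq> 0" if "r \<in> R" for r
  proof -
    have "pderiv p = [:- r, 1:] * pderiv (P r) + P r"
      by (subst P[OF that], subst pderiv_mult) (simp add: pderiv_pCons)
    then have "poly (pderiv p) r = poly (P r) r"
      by simp
    then show ?thesis
      using p(2) that by (auto simp: rsquarefree_roots R_def)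
  qed
  \<comment> \<open>The interpolation weights of the constant 1: the \<open>P r\<close> weighted by
    \<open>\<beta> r\<close> sum to 1, which decomposes \<open>b\<close> into eigenvectors.\<close>
  define \<beta> where "\<beta> r = 1 / poly (P r) r" for r
  define f where "f r = poly_operator X (P r) b" for r
  have f_ne: "f r \<noteq> 0" if "r \<in> R" for r
  proof
    assume "f r = 0"
    have "0 = form (f r) (g (n - 1))"
      by (simp add: \<open>f r = 0\<close>)
    also have "\<dots> = (\<Sum>i\<le>n - 1. coeff (P r) i * form ((X ^^ i) b) (g (n - 1)))"
      by (simp add: f_def poly_operator_def degP[OF that] form_sum_left form_scale_left)
    also have "\<dots> = (\<Sum>i\<le>n - 1. if i = n - 1 then lead_coeff (P r) else 0)"
      by (rule sum.cong) (use n in \<open>auto simp: g degP[OF that]\<close>)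
    also have "\<dots> = lead_coeff (P r)"
      by simp
    finally have "lead_coeff (P r) = 0" ..
    then show False
      using degP(2)[OF that] by (simp only: leading_coeff_0_iff)
  qed
  have eig: "X (f r) = scale r (f r)" if "r \<in> R" for r
  proof -
    have "0 = poly_operator X ([:- r, 1:] * P r) b"
      using p(3) P[OF that] by simp
    also have "\<dots> = X (f r) - scale r (f r)"
      by (simp only: poly_operator_mult[OF X] f_def)
         (simp add: poly_operator_pCons[OF X] linear_operatorD[OF X] scale_minus_left)
    finally show ?thesis by simp
  qed
  have orth: "form (f r) (f r') = 0" if "r \<in> R" "r' \<in> R" "r \<noteq> r'" for r r'
    using adj[of "f r" "f r'"] that by (simp add: eig form_bilinear)
  have b: "b = (\<Sum>r\<in>R. scale (\<beta> r) (f r))"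
  proof -
    have "(1 :: complex poly) = (\<Sum>r\<in>R. Polynomial.smult (\<beta> r) (P r))"
    proof (rule poly_eqI_degree[of R])
      fix z assume z: "z \<in> R"
      have "poly (\<Sum>r\<in>R. Polynomial.smult (\<beta> r) (P r)) z = (\<Sum>r\<in>R. \<beta> r * poly (P r) z)"
        by (simp add: poly_sum)
      also have "\<dots> = (\<Sum>r\<in>R. if r = z then 1 else 0)"
        by (rule sum.cong) (auto simp: P_diff z \<beta>_def P_same)
      also have "\<dots> = poly 1 z"
        using R z by simp
      finally show "poly 1 z = poly (\<Sum>r\<in>R. Polynomial.smult (\<beta> r) (P r)) z" ..
    next
      have "degree (\<Sum>r\<in>R. Polynomial.smult (\<beta> r) (P r)) \<le> n - 1"
        by (rule degree_sum_le[OF R]) (metis degP(1) degree_smult_le)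
      then show "degree (\<Sum>r\<in>R. Polynomial.smult (\<beta> r) (P r)) < card R"
        using n cardR by simp
    qed (use n cardR in simp)
    then have "poly_operator X 1 b = poly_operator X (\<Sum>r\<in>R. Polynomial.smult (\<beta> r) (P r)) b"
      by simp
    also have "\<dots> = (\<Sum>r\<in>R. scale (\<beta> r) (f r))"
      using R by (induction R rule: finite_induct) (simp_all add: poly_operator_add poly_operator_smult f_def)
    finally show ?thesis
      by (simp add: poly_operator_def)
  qed
  have Xf: "(X ^^ m) (f r) = scale (r ^ m) (f r)" if "r \<in> R" for m r
    by (induction m) (simp_all add: linear_operatorD[OF X] eig that mult.commute)
  have lin: "linear_operator (X ^^ m)" for m
    by (induction m) (auto simp: linear_operator_def linear_operatorD[OF X])
  have Xb: "(X ^^ m) b = (\<Sum>r\<in>R. scale (\<beta> r * r ^ m) (f r))" for m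
    by (subst b) (simp add: linear_operatorD[OF lin] Xf)
  have span: "span (f ` R) = UNIV"
  proof -
    have "card {..<n} = dim (UNIV :: 'v set)"
      using n by simp
    then have "span ((\<lambda>i. (X ^^ i) b) ` {..<n}) = UNIV"
      using dual_family_card(2)[of "{..<n}" "\<lambda>i. (X ^^ i) b" g "\<lambda>_. 1"] g by auto
    moreover have "(X ^^ i) b \<in> span (f ` R)" for i
      unfolding Xb by (intro span_sum span_scale span_base) auto
    ultimately show ?thesis
      by (metis (no_types, lifting) UNIV_I UNIV_eq_I image_subsetI span_minimal subspace_span subsetD)
  qed
  \<comment> \<open>An isotropic \<open>f r\<close> would be orthogonal to the whole eigenbasis,
    hence to all of V.\<close>
  have anis: "form (f r) (f r) \<noteq> 0" if "r \<in> R" for r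
  proof
    assume "form (f r) (f r) = 0"
    then have "form (f r) y = 0" for y
      using form_span_zero[of y "f ` R" "f r"] orth that span by auto
    then show False
      using form_nondegenerate f_ne that by blast
  qed
  define N where "N r = form (f r) (f r)" for r
  have fb: "form (f r) ((X ^^ m) b) = \<beta> r * r ^ m * N r" if r: "r \<in> R" for r m
  proof -
    have "form (f r) ((X ^^ m) b) = (\<Sum>r'\<in>R. if r' = r then \<beta> r * r ^ m * N r else 0)"
      unfolding Xb form_sum_right form_scale_right
      by (rule sum.cong) (auto simp: orth r N_def)
    then show ?thesis using R r by simp
  qed
  \<comment> \<open>By \<open>fb\<close> the cube of \<open>f r\<close> takes the value \<beta>^3
    r^(i+j+k) N^3 at the powers i, j, k. The factor r / (\<beta> N^2) turns this into \<beta>^2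
    r^(i+j+k+1) N, the contribution of \<open>r\<close> to the moment (X^(i+j+k+1) b|b).\<close>
  define S where "S = (\<Sum>r\<in>R. tensor_scale (r / (\<beta> r * N r ^ 2)) (tensor3 form (f r) (f r) (f r)))"
  have S: "S \<in> symmetric_tensors form"
    unfolding S_def by (intro symmetric_tensors_sum symmetric_tensors_scale tensor3_cube_symmetric)
  have "strongly_odeco form S"
  proof (rule strongly_odeco_diagonal[OF R S span orth anis])
    fix i j k assume ijk: "i \<in> R" "j \<in> R" "k \<in> R" "\<not> (i = j \<and> j = k)"
    have "tensor3 form (f r) (f r) (f r) (f i) (f j) (f k) = 0" if "r \<in> R" for r
      using orth[OF that ijk(1)] orth[OF that ijk(2)] orth[OF that ijk(3)] ijk(4)
      by (auto simp: tensor3_def)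
    then show "S (f i) (f j) (f k) = 0"
      by (simp add: S_def sum_fun3_apply tensor_scale_def)
  qed
  moreover have "S ((X ^^ i) b) ((X ^^ j) b) ((X ^^ k) b) = form ((X ^^ (i + j + k + 1)) b) b" for i j k
  proof -
    have "S ((X ^^ i) b) ((X ^^ j) b) ((X ^^ k) b) = (\<Sum>r\<in>R. \<beta> r * r ^ (i + j + k + 1) * (\<beta> r * N r))"
      unfolding S_def sum_fun3_apply
    proof (rule sum.cong[OF refl])
      fix r assume r: "r \<in> R"
      then have "\<beta> r \<noteq> 0" "N r \<noteq> 0"
        using P_same anis by (auto simp: \<beta>_def N_def)
      then show "tensor_scale (r / (\<beta> r * N r ^ 2)) (tensor3 form (f r) (f r) (f r))
          ((X ^^ i) b) ((X ^^ j) b) ((X ^^ k) b) = \<beta> r * r ^ (i + j + k + 1) * (\<beta> r * N r)"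
        by (simp add: tensor_scale_def tensor3_def fb[OF r] power_add power2_eq_square field_simps)
    qed
    also have "\<dots> = form ((X ^^ (i + j + k + 1)) b) b"
      unfolding Xb[of "i + j + k + 1"] form_sum_left form_scale_left
      by (rule sum.cong) (use fb[of _ 0] in auto)
    finally show ?thesis .
  qed
  ultimately show ?thesis using S by blast
qed

end
subsection \<open>Algebras generated by one element\<close>

lemma eventually_notin_finite:
  assumes "finite (S :: complex set)"
  shows "eventually (\<lambda>s. s \<notin> S) (at 0)"
  unfolding eventually_at_topological
proof (intro exI conjI ballI impI)
  show "open (- (S - {0}))"
    using assms by (intro open_Compl finite_imp_closed) auto
qed auto

context nondegenerate_symmetric_form
begin

lemma symmetric_tensor_expansion:
  assumes T: "T \<in> symmetric_tensors form" and exp: "\<And>y. y = (\<Sum>i\<in>I. scale (form y (g i)) (f i))"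
  shows "T x y z = (\<Sum>i\<in>I. \<Sum>j\<in>I. \<Sum>k\<in>I.
    form x (g i) * form y (g j) * form z (g k) * T (f i) (f j) (f k))"
proof -
  have "T x y z = T (\<Sum>i\<in>I. scale (form x (g i)) (f i)) (\<Sum>i\<in>I. scale (form y (g i)) (f i))
      (\<Sum>i\<in>I. scale (form z (g i)) (f i))"
    by (simp flip: exp)
  also have "\<dots> = (\<Sum>k\<in>I. \<Sum>j\<in>I. \<Sum>i\<in>I.
      form x (g i) * form y (g j) * form z (g k) * T (f i) (f j) (f k))"
    unfolding symmetric_tensor_sum(3)[OF T] unfolding symmetric_tensor_sum(2)[OF T]
    unfolding symmetric_tensor_sum(1)[OF T]
    by (simp add: symmetric_tensor_scale[OF T] mult_ac)
  also have "\<dots> = (\<Sum>j\<in>I. \<Sum>i\<in>I. \<Sum>k\<in>I.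
      form x (g i) * form y (g j) * form z (g k) * T (f i) (f j) (f k))"
    by (subst sum.swap, rule sum.cong[OF refl], rule sum.swap)
  also have "\<dots> = (\<Sum>i\<in>I. \<Sum>j\<in>I. \<Sum>k\<in>I.
      form x (g i) * form y (g j) * form z (g k) * T (f i) (f j) (f k))"
    by (rule sum.swap)
  finally show ?thesis .
qed

text \<open>
  The rank-one perturbations of multiplication by the generator \<open>b\<close>, in the direction that leaves
  \<open>b, b\<^sup>2, \<dots>, b\<^sup>n\<close> and hence the form unchanged, generically have simple spectrum.
\<close>
lemma monogenic_in_odeco_variety:
  assumes T: "T \<in> associative_tensors scale form" and n: "n = dim (UNIV :: 'v set)" "n > 0"
    and span: "span ((\<lambda>i. (mult T b ^^ i) b) ` {..<n}) = UNIV"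
  shows "T \<in> odeco_variety form"
proof -
  note sym = associative_tensorsD(1)[OF T]
  define X where "X = mult T b"
  have X: "linear_operator X" and adj: "form (X x) y = form x (X y)" for x y
    unfolding X_def by (simp_all add: linear_operator_mult[OF sym] form_mult_adjoint[OF sym])
  define B where "B i = (X ^^ i) b" for i
  have B_Suc: "B (Suc i) = X (B i)" for i
    by (simp add: B_def)
  have spanB: "span (B ` {..<n}) = UNIV"
    using span by (simp add: B_def X_def)
  obtain D where D': "\<forall>i\<in>{..<n}. \<forall>j\<in>{..<n}. form (B i) (D j) = (if i = j then 1 else 0)"
    using dual_family_exists[of "{..<n}" B] spanB n by auto
  have D: "form (B i) (D j) = (if i = j then 1 else 0)" if "i < n" "j < n" for i j
    using D' that by simp
  have exp: "y = (\<Sum>i<n. scale (form y (D i)) (B i))" for y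
    by (rule dual_family_expansion[OF _ spanB]) (use D in auto)
  \<comment> \<open>\<open>u\<close> reads off the coefficient of the last basis vector
    \<open>B (n - 1)\<close>, which is the n-th power of \<open>b\<close>, since \<open>B\<close>
    starts at \<open>b\<close> itself.\<close>
  define u where "u = D (n - 1)"
  have uB: "form u (B i) = (if i = n - 1 then 1 else 0)" if "i < n" for i
    unfolding u_def form_sym[of "D (n - 1)"] using D[of i "n - 1"] that n(2) by simp
  \<comment> \<open>\<open>p\<close> annihilates the cyclic vector \<open>b\<close> under
    \<open>X\<close>, and \<open>q\<close> expresses \<open>u\<close> as q(X) b.\<close>
  define p where "p = monom 1 n - (\<Sum>i<n. monom (form (B n) (D i)) i)"
  define q where "q = (\<Sum>i<n. monom (form u (D i)) i)"
  have coeff_p: "coeff p i = (if i = n then 1 else if i < n then - form (B n) (D i) else 0)" for i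
    by (auto simp: p_def coeff_sum)
  have coeff_q: "coeff q i = (if i < n then form u (D i) else 0)" for i
    by (auto simp: q_def coeff_sum)
  have apply_bound: "poly_operator Y h b = (\<Sum>i<n. scale (coeff h i) ((Y ^^ i) b)) + scale (coeff h n) ((Y ^^ n) b)"
    if "degree h \<le> n" for Y h
    using poly_operator_bound[OF that, of Y b] by (simp add: lessThan_Suc_atMost[symmetric])
  have deg_p: "degree p = n"
    by (intro antisym degree_le le_degree) (auto simp: coeff_p)
  have deg_q: "degree q \<le> n"
    by (intro degree_le) (auto simp: coeff_q)
  have pb: "poly_operator X p b = 0"
  proof -
    have "poly_operator X p b = B n - (\<Sum>i<n. scale (form (B n) (D i)) (B i))"
      using deg_p by (simp add: apply_bound coeff_p B_def scale_minus_left sum_negf)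
    then show ?thesis
      using exp[of "B n"] by simp
  qed
  have qb: "poly_operator X q b = u"
    using deg_q exp[of u] by (simp add: apply_bound coeff_q B_def)
  \<comment> \<open>A common root gives p = (x - z) p1 and q = (x - z) q1, so p1(X) u = p1(X) q(X) b
    = q1(X) p(X) b = 0. But (p1(X) u|b) = (u|p1(X) b) is the leading coefficient 1 of
    \<open>p1\<close>.\<close>
  have common: False if z: "poly p z = 0" "poly q z = 0" for z
  proof -
    obtain p1 where p1: "p = [:- z, 1:] * p1"
      using z by (metis dvdE poly_eq_0_iff_dvd)
    obtain q1 where q1: "q = [:- z, 1:] * q1"
      using z by (metis dvdE poly_eq_0_iff_dvd)
    have "p1 \<noteq> 0"
      using p1 deg_p n(2) by auto
    then have "degree p = 1 + degree p1"
      unfolding p1 by (subst degree_mult_eq) auto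
    then have deg_p1: "degree p1 = n - 1"
      using deg_p by simp
    have "lead_coeff p = lead_coeff p1"
      unfolding p1 lead_coeff_mult by simp
    then have lead: "coeff p1 (n - 1) = 1"
      using deg_p deg_p1 by (simp add: coeff_p)
    have "poly_operator X p1 u = poly_operator X (p1 * q) b"
      by (simp add: poly_operator_mult[OF X] qb)
    also have "p1 * q = q1 * p"
      unfolding p1 q1 by (simp only: mult_ac)
    also have "poly_operator X (q1 * p) b = 0"
      by (simp add: poly_operator_mult[OF X] pb linear_operatorD[OF linear_operator_poly[OF X]])
    finally have "0 = form u (poly_operator X p1 b)"
      using poly_operator_adjoint[OF X adj, of p1 u b] by simp
    also have "\<dots> = (\<Sum>i\<le>n - 1. coeff p1 i * form u (B i))"
      by (simp add: poly_operator_def deg_p1 form_sum_right form_scale_right B_def)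
    also have "\<dots> = (\<Sum>i\<le>n - 1. if i = n - 1 then 1 else 0)"
      by (rule sum.cong) (use n(2) in \<open>auto simp: uB lead[simplified]\<close>)
    also have "\<dots> = 1"
      by simp
    finally show False
      by simp
  qed
  moreover have "degree p > 0"
    using deg_p n(2) by simp
  ultimately have "\<exists>S. finite S \<and> (\<forall>s. s \<notin> S \<longrightarrow> rsquarefree (p - Polynomial.smult s q))"
    by (intro rsquarefree_pencil)
  then obtain S0 where S0: "finite S0" "\<And>s. s \<notin> S0 \<Longrightarrow> rsquarefree (p - Polynomial.smult s q)"
    by blast
  \<comment> \<open>A self-adjoint rank-one perturbation. It agrees with \<open>X\<close> along
    \<open>b\<close> until the n-th step, where \<open>s u\<close> is added; hence p - s q
    annihilates \<open>b\<close> under \<open>Y s\<close>.\<close>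
  define Y where "Y s y = X y + scale (s * form u y) u" for s y
  have Y: "linear_operator (Y s)" for s
    by (simp add: linear_operator_def Y_def linear_operatorD[OF X] form_bilinear scale_left_distrib
        scale_right_distrib distrib_left mult_ac)
  have adjY: "form (Y s x) y = form x (Y s y)" for s x y
    by (simp add: Y_def form_bilinear adj form_sym[of u])
  have YB: "(Y s ^^ i) b = B i" if "i < n" for s i
    using that
  proof (induction i)
    case (Suc i)
    moreover have "i \<noteq> n - 1"
      using Suc.prems by simp
    ultimately show ?case
      by (simp add: Y_def uB B_Suc)
  qed (simp add: B_def)
  have Yn: "(Y s ^^ n) b = B n + scale s u" for s
  proof -
    obtain m where m: "n = Suc m"
      using n(2) by (cases n) auto
    then show ?thesis
      using YB[of m s] by (simp add: Y_def uB B_Suc)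
  qed
  have ex: "\<exists>S\<in>symmetric_tensors form. strongly_odeco form S \<and>
      (\<forall>i<n. \<forall>j<n. \<forall>k<n. S (B i) (B j) (B k) = form ((Y s ^^ (i + j + k + 1)) b) b)" if s: "s \<notin> S0" for s
  proof -
    define h where "h = p - Polynomial.smult s q"
    have "coeff h n = 1"
      by (simp add: h_def coeff_p coeff_q)
    moreover have "degree h \<le> n"
      unfolding h_def using deg_p deg_q by (intro degree_diff_le) (auto intro: order_trans[OF degree_smult_le])
    ultimately have deg: "degree h = n"
      by (intro antisym le_degree) auto
    have "poly_operator (Y s) h b = 0"
    proof -
      have "poly_operator (Y s) h b = (\<Sum>i<n. scale (coeff h i) (B i)) + (B n + scale s u)"
        using deg \<open>coeff h n = 1\<close> by (simp add: apply_bound Yn YB)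
      also have "(\<Sum>i<n. scale (coeff h i) (B i)) =
          - (\<Sum>i<n. scale (form (B n) (D i)) (B i)) - scale s (\<Sum>i<n. scale (form u (D i)) (B i))"
        by (simp add: h_def coeff_p coeff_q scale_left_diff_distrib scale_minus_left sum_subtractf
            sum_negf scale_sum_right)
      finally show ?thesis
        using exp[of "B n"] exp[of u] by simp
    qed
    moreover have "form ((Y s ^^ i) b) (D j) = (if i = j then 1 else 0)" if "i < n" "j < n" for i j
      using that by (simp add: YB D)
    ultimately obtain S where "S \<in> symmetric_tensors form" "strongly_odeco form S"
      "\<forall>i j k. S ((Y s ^^ i) b) ((Y s ^^ j) b) ((Y s ^^ k) b) = form ((Y s ^^ (i + j + k + 1)) b) b"
      using strongly_odeco_of_simple_spectrum[OF Y adjY n, of s b D h] deg S0(2)[OF s] by (auto simp: h_def)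
    then show ?thesis
      by (metis YB)
  qed
  \<comment> \<open>A choice for each \<open>s\<close>; its value on the finite exceptional set
    \<open>S0\<close> is arbitrary and is avoided by the filter \<open>at 0\<close>.\<close>
  define S where "S s = (SOME U. U \<in> symmetric_tensors form \<and> strongly_odeco form U \<and>
      (\<forall>i<n. \<forall>j<n. \<forall>k<n. U (B i) (B j) (B k) = form ((Y s ^^ (i + j + k + 1)) b) b))" for s
  have S: "S s \<in> symmetric_tensors form" "strongly_odeco form (S s)"
    "\<And>i j k. i < n \<Longrightarrow> j < n \<Longrightarrow> k < n \<Longrightarrow> S s (B i) (B j) (B k) = form ((Y s ^^ (i + j + k + 1)) b) b"
    if s: "s \<notin> S0" for s
  proof -
    have "\<exists>U. U \<in> symmetric_tensors form \<and> strongly_odeco form U \<and>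
      (\<forall>i<n. \<forall>j<n. \<forall>k<n. U (B i) (B j) (B k) = form ((Y s ^^ (i + j + k + 1)) b) b)"
      using ex[OF s] by blast
    from someI_ex[OF this] show "S s \<in> symmetric_tensors form" "strongly_odeco form (S s)"
      "\<And>i j k. i < n \<Longrightarrow> j < n \<Longrightarrow> k < n \<Longrightarrow> S s (B i) (B j) (B k) = form ((Y s ^^ (i + j + k + 1)) b) b"
      unfolding S_def by blast+
  qed
  have ev: "eventually (\<lambda>s. s \<notin> S0) (at 0)"
    by (rule eventually_notin_finite[OF S0(1)])
  have limY: "((\<lambda>s. form ((Y s ^^ m) b) y) \<longlongrightarrow> form (B m) y) (at 0)" for m y
  proof (induction m arbitrary: y)
    case 0
    then show ?case by (simp add: B_def)
  next
    case (Suc m)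
    have "((\<lambda>s. form ((Y s ^^ m) b) (X y) + s * form ((Y s ^^ m) b) u * form u y) \<longlongrightarrow>
        form (B m) (X y) + 0 * form (B m) u * form u y) (at 0)"
      by (intro tendsto_intros Suc.IH)
    moreover have "form (Y s w) y = form w (X y) + s * form w u * form u y" for s w
      by (simp add: Y_def form_bilinear adj form_sym[of u w])
    ultimately show ?case
      by (simp add: B_Suc adj)
  qed
  have BB: "mult T (B i) y = (X ^^ Suc i) y" for i y
  proof (induction i arbitrary: y)
    case 0
    then show ?case by (simp add: B_def X_def)
  next
    case (Suc i)
    have "mult T (B (Suc i)) y = X (mult T (B i) y)"
      by (simp add: B_Suc X_def associative_tensorsD(2)[OF T])
    then show ?case
      by (simp add: Suc.IH)
  qed
  have adj_pow: "form ((X ^^ m) x) y = form x ((X ^^ m) y)" for m x y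
    by (induction m arbitrary: x y) (simp_all add: adj funpow_swap1)
  \<comment> \<open>\<open>T\<close> has the moment form of the approximating tensors, so
    convergence of tensors reduces to convergence of moments. The extra 1 in the exponent arises
    because \<open>B i\<close> is the (i+1)-st power of \<open>b\<close>.\<close>
  have TB: "T (B i) (B j) (B k) = form (B (i + j + k + 1)) b" for i j k
  proof -
    have "T (B i) (B j) (B k) = form ((X ^^ Suc i) ((X ^^ j) b)) ((X ^^ k) b)"
      by (simp only: form_mult[OF sym, symmetric] BB) (simp add: B_def)
    also have "\<dots> = form ((X ^^ k) ((X ^^ Suc i) ((X ^^ j) b))) b"
      by (simp only: adj_pow)
    also have "\<dots> = form (B (k + (Suc i + j))) b"
      by (simp only: B_def funpow_add comp_apply)
    finally show ?thesis
      by (simp add: add_ac)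
  qed
  show ?thesis
  proof (rule odeco_variety_limit[OF _ _ _ sym])
    show "eventually (\<lambda>s. S s \<in> odeco_variety form) (at 0)"
      using ev by eventually_elim (auto intro: strongly_odeco_in_variety S)
    fix x y z
    have "((\<lambda>s. \<Sum>i<n. \<Sum>j<n. \<Sum>k<n. form x (D i) * form y (D j) * form z (D k) *
        form ((Y s ^^ (i + j + k + 1)) b) b) \<longlongrightarrow>
        (\<Sum>i<n. \<Sum>j<n. \<Sum>k<n. form x (D i) * form y (D j) * form z (D k) * form (B (i + j + k + 1)) b)) (at 0)"
      by (intro tendsto_intros limY)
    moreover have "T x y z = (\<Sum>i<n. \<Sum>j<n. \<Sum>k<n. form x (D i) * form y (D j) * form z (D k) * form (B (i + j + k + 1)) b)"
      unfolding symmetric_tensor_expansion[OF sym exp, of x y z] by (simp only: TB)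
    moreover have "eventually (\<lambda>s. (\<Sum>i<n. \<Sum>j<n. \<Sum>k<n. form x (D i) * form y (D j) * form z (D k) *
        form ((Y s ^^ (i + j + k + 1)) b) b) = S s x y z) (at 0)"
      using ev
    proof eventually_elim
      case (elim s)
      show ?case
        unfolding symmetric_tensor_expansion[OF S(1)[OF elim] exp, of x y z]
        by (intro sum.cong refl) (simp only: lessThan_iff S(3)[OF elim])
    qed
    ultimately show "((\<lambda>s. S s x y z) \<longlongrightarrow> T x y z) (at 0)"
      using Lim_transform_eventually by (simp only:)
  qed simp
qed


subsection \<open>Dimension at most three\<close>

text \<open>
  The algebras on the span of a hyperbolic pair \<open>k\<close>, \<open>w\<close> and a further vector \<open>m\<close> in which \<open>k\<close> spans an
  ideal. The product of \<open>w\<close> with \<open>k\<close> is \<open>l k\<close>, and \<open>a\<close>, \<open>b\<close>, \<open>c\<close>, \<open>d\<close> are the coefficients of the cubic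
  form in \<open>w\<close> and \<open>m\<close>. In dimension two \<open>m\<close> is taken to be zero.
\<close>
definition hyperbolic_tensor ::
    "'v \<Rightarrow> 'v \<Rightarrow> 'v \<Rightarrow> complex \<Rightarrow> complex \<Rightarrow> complex \<Rightarrow> complex \<Rightarrow> complex \<Rightarrow> 'v \<Rightarrow> 'v \<Rightarrow> 'v \<Rightarrow> complex" where
  "hyperbolic_tensor k m w a b c d l x y z =
    a * (form k x * form k y * form k z)
    + b * (form k x * form k y * form m z + form k x * form m y * form k z + form m x * form k y * form k z)
    + c * (form k x * form m y * form m z + form m x * form k y * form m z + form m x * form m y * form k z)
    + d * (form m x * form m y * form m z)
    + l * (form w x * form k y * form k z + form k x * form w y * form k z + form k x * form k y * form w z)"

lemma hyperbolic_tensor_symmetric: "hyperbolic_tensor k m w a b c d l \<in> symmetric_tensors form"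
  by (rule symmetric_tensorsI) (simp_all add: hyperbolic_tensor_def form_bilinear algebra_simps)

lemma mult_hyperbolic_tensor:
  "mult (hyperbolic_tensor k m w a b c d l) x y =
    scale (a * form k x * form k y + b * (form k x * form m y + form m x * form k y)
      + c * form m x * form m y + l * (form w x * form k y + form k x * form w y)) k
    + scale (b * form k x * form k y + c * (form k x * form m y + form m x * form k y)
      + d * form m x * form m y) m
    + scale (l * form k x * form k y) w"
  by (rule mult_eqI[OF hyperbolic_tensor_symmetric])
     (simp add: hyperbolic_tensor_def form_bilinear algebra_simps)

definition hyperbolic_frame :: "'v \<Rightarrow> 'v \<Rightarrow> 'v \<Rightarrow> bool" where
  "hyperbolic_frame k m w \<longleftrightarrow> form k k = 0 \<and> form w w = 0 \<and> form k w = 1 \<and> form k m = 0 \<and>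
    form w m = 0 \<and> (form m m = 1 \<or> m = 0)"

lemma hyperbolic_frameD:
  assumes "hyperbolic_frame k m w"
  shows "form k k = 0" "form w w = 0" "form k w = 1" "form w k = 1" "form k m = 0" "form m k = 0"
    "form w m = 0" "form m w = 0"
  using assms by (auto simp: hyperbolic_frame_def form_sym)

lemma hyperbolic_tensor_associative:
  assumes f: "hyperbolic_frame k m w" and rel: "m \<noteq> 0 \<Longrightarrow> c * (c - l) = b * d"
  shows "hyperbolic_tensor k m w a b c d l \<in> associative_tensors scale form"
  unfolding associative_tensors_iff[OF hyperbolic_tensor_symmetric]
proof (intro allI)
  fix x y z u
  let ?T = "hyperbolic_tensor k m w a b c d l"
  note fr = hyperbolic_frameD[OF f]
  show "?T (mult ?T x y) z u = ?T (mult ?T y z) x u"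
  proof (cases "m = 0")
    case True
    then show ?thesis
      unfolding mult_hyperbolic_tensor
      by (simp add: hyperbolic_tensor_def form_bilinear fr algebra_simps)
  next
    case False
    then have mm: "form m m = 1" and "c * c = c * l + b * d"
      using f rel by (auto simp: hyperbolic_frame_def algebra_simps)
    \<comment> \<open>The associator is the defect of the relation times a product of two minors in
      the coordinates (k|.) and (m|.).\<close>
    moreover have "?T (mult ?T x y) z u - ?T (mult ?T y z) x u = (c * c - c * l - b * d) *
      ((form k x * form m z - form m x * form k z) * (form m y * form k u - form k y * form m u))"
      unfolding mult_hyperbolic_tensor
      by (simp add: hyperbolic_tensor_def form_bilinear fr mm algebra_simps)
    ultimately show ?thesis
      by simp
  qed
qed

text \<open>The two differences lie in the span of \<open>k\<close> and \<open>m\<close>, and their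
  coefficient determinant is b (a c - e). It will be applied to the first three powers of
  \<open>w\<close>.\<close>

lemma span_triple_of_quadratic:
  assumes "y1 - scale l y0 = scale a k + scale b m" "y2 - scale l y1 = scale e k + scale (b * c) m"
    and "b \<noteq> 0" "a * c \<noteq> e"
  shows "k \<in> span {y0, y1, y2}" "m \<in> span {y0, y1, y2}"
proof -
  have y: "y0 \<in> span {y0, y1, y2}" "y1 \<in> span {y0, y1, y2}" "y2 \<in> span {y0, y1, y2}"
    by (auto intro: span_base)
  have "scale c (y1 - scale l y0) - (y2 - scale l y1) = scale (a * c - e) k"
    unfolding assms(1,2) by (simp add: scale_right_distrib scale_left_diff_distrib mult_ac)
  then have "scale (a * c - e) k \<in> span {y0, y1, y2}"
    by (metis span_diff span_scale y)
  then show k: "k \<in> span {y0, y1, y2}"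
    using assms(4) span_scale[of "scale (a * c - e) k" _ "1 / (a * c - e)"] by simp
  have "y1 - scale l y0 - scale a k = scale b m"
    unfolding assms(1) by simp
  then have "scale b m \<in> span {y0, y1, y2}"
    by (metis span_diff span_scale y(1,2) k)
  then show "m \<in> span {y0, y1, y2}"
    using assms(3) span_scale[of "scale b m" _ "1 / b"] by simp
qed

text \<open>The two inequalities say that \<open>w\<close> generates the algebra: w, w^2, w^3 have
  determinant b (a (c - l) - b^2) relative to the frame, up to sign.\<close>

lemma hyperbolic_tensor_in_variety_generic:
  assumes f: "hyperbolic_frame k m w" and m: "m \<noteq> 0" and span: "span {k, m, w} = UNIV"
    and n: "dim (UNIV :: 'v set) = 3" and rel: "c * (c - l) = b * d"
    and gen: "b \<noteq> 0" "a * (c - l) \<noteq> b\<^sup>2"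
  shows "hyperbolic_tensor k m w a b c d l \<in> odeco_variety form"
proof -
  let ?T = "hyperbolic_tensor k m w a b c d l"
  note fr = hyperbolic_frameD[OF f]
  have mm: "form m m = 1"
    using f m by (simp add: hyperbolic_frame_def)
  define y1 where "y1 = mult ?T w w"
  define y2 where "y2 = mult ?T w y1"
  have y1: "y1 = scale a k + scale b m + scale l w"
    by (simp add: y1_def mult_hyperbolic_tensor fr)
  have y2: "y2 = scale (a * l + b\<^sup>2) k + scale (b * c) m + scale l y1"
  proof -
    have "scale (a * (l * 2)) k = scale (a * l) k + scale (a * l) k"
      by (simp flip: scale_left_distrib)
    then show ?thesis
      unfolding y2_def y1 mult_hyperbolic_tensor
      by (simp add: fr form_bilinear mm scale_right_distrib scale_left_distrib power2_eq_square
        distrib_left distrib_right add_ac mult_ac)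
  qed
  have "a * c \<noteq> a * l + b\<^sup>2"
    using gen(2) by (auto simp: algebra_simps)
  moreover have "y1 - scale l w = scale a k + scale b m"
    by (simp add: y1)
  moreover have "y2 - scale l y1 = scale (a * l + b\<^sup>2) k + scale (b * c) m"
    by (simp add: y2)
  ultimately have "k \<in> span {w, y1, y2}" "m \<in> span {w, y1, y2}"
    using span_triple_of_quadratic gen(1) by blast+
  then have "span {k, m, w} \<subseteq> span {w, y1, y2}"
    by (intro span_minimal subspace_span) (auto intro: span_base)
  then have "span {w, y1, y2} = UNIV"
    using span by auto
  moreover have "(\<lambda>i. (mult ?T w ^^ i) w) ` {..<3} = {w, y1, y2}"
    by (auto simp: y1_def y2_def numeral_3_eq_3 lessThan_Suc)
  ultimately show ?thesis
    using monogenic_in_odeco_variety[OF hyperbolic_tensor_associative[OF f rel], of 3 a w] n by simp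
qed

lemma hyperbolic_tensor_tendsto:
  assumes "(a \<longlongrightarrow> a0) F" "(b \<longlongrightarrow> b0) F" "(c \<longlongrightarrow> c0) F" "(d \<longlongrightarrow> d0) F" "(l \<longlongrightarrow> l0) F"
  shows "((\<lambda>s. hyperbolic_tensor k m w (a s) (b s) (c s) (d s) (l s) x y z) \<longlongrightarrow>
    hyperbolic_tensor k m w a0 b0 c0 d0 l0 x y z) F"
  unfolding hyperbolic_tensor_def by (intro tendsto_intros assms)

text \<open>The coefficients follow a curve inside the relation. The roots of \<open>h\<close>
  contain all its nongeneric parameters, so the point at 0 is a limit of generic ones.\<close>

lemma hyperbolic_tensor_in_variety_limit:
  fixes a b c d l :: "complex \<Rightarrow> complex"
  assumes f: "hyperbolic_frame k m w" and m: "m \<noteq> 0" and span: "span {k, m, w} = UNIV"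
    and n: "dim (UNIV :: 'v set) = 3" and rel: "\<And>s. c s * (c s - l s) = b s * d s"
    and cont: "isCont a 0" "isCont b 0" "isCont c 0" "isCont d 0" "isCont l 0"
    and h: "h \<noteq> 0" "\<And>s. poly h s \<noteq> 0 \<Longrightarrow> b s \<noteq> 0 \<and> a s * (c s - l s) \<noteq> (b s)\<^sup>2"
  shows "hyperbolic_tensor k m w (a 0) (b 0) (c 0) (d 0) (l 0) \<in> odeco_variety form"
proof (rule odeco_variety_limit[OF _ _ _ hyperbolic_tensor_symmetric])
  have "eventually (\<lambda>s. s \<notin> {z. poly h z = 0}) (at 0)"
    by (rule eventually_notin_finite[OF poly_roots_finite[OF h(1)]])
  then show "eventually (\<lambda>s. hyperbolic_tensor k m w (a s) (b s) (c s) (d s) (l s) \<in> odeco_variety form) (at 0)"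
  proof eventually_elim
    case (elim s)
    then show ?case
      using hyperbolic_tensor_in_variety_generic[OF f m span n rel] h(2)[of s] by simp
  qed
  show "((\<lambda>s. hyperbolic_tensor k m w (a s) (b s) (c s) (d s) (l s) x y z) \<longlongrightarrow>
      hyperbolic_tensor k m w (a 0) (b 0) (c 0) (d 0) (l 0) x y z) (at 0)" for x y z
    using cont by (intro hyperbolic_tensor_tendsto) (simp_all add: isCont_def)
qed simp

text \<open>If \<open>b\<close> vanishes, the relation forces c = 0 or c = l. Each of the resulting
  strata needs its own curve along which the relation persists and \<open>b\<close> becomes
  nonzero.\<close>

lemma hyperbolic_tensor_in_variety:
  assumes f: "hyperbolic_frame k m w" and m: "m \<noteq> 0" and span: "span {k, m, w} = UNIV"
    and n: "dim (UNIV :: 'v set) = 3" and rel: "c * (c - l) = b * d"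
  shows "hyperbolic_tensor k m w a b c d l \<in> odeco_variety form"
proof -
  note lim = hyperbolic_tensor_in_variety_limit[OF f m span n]
  consider "b \<noteq> 0" | "b = 0" "c = 0" "l \<noteq> 0" | "b = 0" "c = 0" "l = 0" | "b = 0" "c = l" "l \<noteq> 0"
    using rel by fastforce
  then show ?thesis
  proof cases
    case 1
    \<comment> \<open>Only \<open>a\<close> moves, to a + s. If c = l, then \<open>h\<close> is the
      nonzero constant -b^2.\<close>
    define h where "h = [:a * (c - l) - b\<^sup>2, c - l:]"
    have "h \<noteq> 0"
      using 1 by (auto simp: h_def)
    moreover have "b \<noteq> 0 \<and> (a + s) * (c - l) \<noteq> b\<^sup>2" if "poly h s \<noteq> 0" for s
      using that 1 by (auto simp: h_def algebra_simps)
    ultimately show ?thesis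
      using lim[of "\<lambda>_. c" "\<lambda>_. l" "\<lambda>_. b" "\<lambda>_. d" "\<lambda>s. a + s" h] rel by simp
  next
    case 2
    \<comment> \<open>Along b = s, c = s e the relation gives d = e (s e - l), and the choice of
      \<open>e\<close> returns the given \<open>d\<close> at s = 0.\<close>
    define e where "e = - d / l"
    define h where "h = [:0, - (a * l), a * e, -1:]"
    have "h \<noteq> 0"
      by (simp add: h_def)
    moreover have "s \<noteq> 0 \<and> a * (s * e - l) \<noteq> s\<^sup>2" if "poly h s \<noteq> 0" for s
    proof -
      have "poly h s = s * (a * (s * e - l) - s\<^sup>2)"
        by (simp add: h_def algebra_simps power2_eq_square)
      then show ?thesis
        using that by auto
    qed
    ultimately show ?thesis
      using lim[of "\<lambda>s. s * e" "\<lambda>_. l" "\<lambda>s. s" "\<lambda>s. e * (s * e - l)" "\<lambda>_. a" h] 2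
      by (simp add: e_def)
  next
    case 3
    \<comment> \<open>With l = 0 the relation is c^2 = b d. Taking b = s^2 and c = s e with e a
      square root of \<open>d\<close> keeps \<open>d\<close> fixed.\<close>
    obtain e where e: "e ^ 2 = d"
      using nth_root_exists[of 2 d] by auto
    define h where "h = [:0, a * e, 0, 0, -1:]"
    have "h \<noteq> 0"
      by (simp add: h_def)
    moreover have "s\<^sup>2 \<noteq> 0 \<and> a * (s * e - 0) \<noteq> (s\<^sup>2)\<^sup>2" if "poly h s \<noteq> 0" for s
    proof -
      have "poly h s = a * (s * e - 0) - (s\<^sup>2)\<^sup>2"
        by (simp add: h_def algebra_simps power2_eq_square)
      then show ?thesis
        using that by auto
    qed
    ultimately show ?thesis
      using lim[of "\<lambda>s. s * e" "\<lambda>_. 0" "\<lambda>s. s\<^sup>2" "\<lambda>_. d" "\<lambda>_. a" h] 3 e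
      by (simp add: power2_eq_square mult_ac)
  next
    case 4
    \<comment> \<open>Here c = l is kept and \<open>l\<close> moves to l - s d / l, so that c (c -
      l) becomes s d, as b = s requires.\<close>
    define h where "h = [:0, a * d / l, -1:]"
    have "h \<noteq> 0"
      by (simp add: h_def)
    moreover have "s \<noteq> 0 \<and> a * (c - (l - s * d / l)) \<noteq> s\<^sup>2" if "poly h s \<noteq> 0" for s
    proof -
      have "poly h s = a * (c - (l - s * d / l)) - s\<^sup>2"
        using 4 by (simp add: h_def algebra_simps power2_eq_square)
      then show ?thesis
        using that 4 by auto
    qed
    ultimately show ?thesis
      using lim[of "\<lambda>_. c" "\<lambda>s. l - s * d / l" "\<lambda>s. s" "\<lambda>_. d" "\<lambda>_. a" h] 4
      by simp
  qed
qed

text \<open>Here w^2 = a k + l w, so \<open>w\<close> generates the algebra as soon as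
  \<open>a\<close> is nonzero; a shift of \<open>a\<close> achieves this.\<close>

lemma hyperbolic_tensor_in_variety_plane:
  assumes f: "hyperbolic_frame k 0 w" and span: "span {k, w} = UNIV" and n: "dim (UNIV :: 'v set) = 2"
  shows "hyperbolic_tensor k 0 w a b c d l \<in> odeco_variety form"
proof (rule odeco_variety_limit[OF _ _ _ hyperbolic_tensor_symmetric])
  note fr = hyperbolic_frameD[OF f]
  have "eventually (\<lambda>s. s \<notin> {- a}) (at 0)"
    by (rule eventually_notin_finite) simp
  then show "eventually (\<lambda>s. hyperbolic_tensor k 0 w (a + s) b c d l \<in> odeco_variety form) (at 0)"
  proof eventually_elim
    case (elim s)
    then have a: "a + s \<noteq> 0"
      by (auto simp: add_eq_0_iff)
    let ?T = "hyperbolic_tensor k 0 w (a + s) b c d l"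
    define y where "y = mult ?T w w"
    have "y = scale (a + s) k + scale l w"
      by (simp add: y_def mult_hyperbolic_tensor fr)
    then have "scale (a + s) k \<in> span {w, y}"
      by (metis add_diff_cancel_right' insertI1 insertI2 span_base span_diff span_scale)
    then have "k \<in> span {w, y}"
      using a span_scale[of "scale (a + s) k" _ "1 / (a + s)"] by simp
    then have "span {k, w} \<subseteq> span {w, y}"
      by (intro span_minimal subspace_span) (auto intro: span_base)
    then have "span {w, y} = UNIV"
      using span by auto
    moreover have "(\<lambda>i. (mult ?T w ^^ i) w) ` {..<2} = {w, y}"
      by (auto simp: y_def numeral_2_eq_2 lessThan_Suc)
    ultimately show ?case
      using monogenic_in_odeco_variety[OF hyperbolic_tensor_associative[OF f], of c l b d 2 "a + s" w] n by simp
  qed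
  have "((\<lambda>s. a + s) \<longlongrightarrow> a + 0) (at 0)"
    by (intro tendsto_intros)
  then show "((\<lambda>s. hyperbolic_tensor k 0 w (a + s) b c d l x y z) \<longlongrightarrow>
      hyperbolic_tensor k 0 w a b c d l x y z) (at 0)" for x y z
    by (intro hyperbolic_tensor_tendsto) simp_all
qed simp


text \<open>The complement of anisotropic common eigenvectors is invariant because multiplications
  are self-adjoint, so it contains another one. This continues up to an orthogonal eigenbasis, in
  which \<open>T\<close> is diagonal.\<close>

lemma associative_in_variety_of_anisotropic_eigenvectors:
  assumes T: "T \<in> associative_tensors scale form"
    and anis: "\<And>k. k \<noteq> 0 \<Longrightarrow> \<forall>y. \<exists>r. mult T y k = scale r k \<Longrightarrow> form k k \<noteq> 0"
  shows "T \<in> odeco_variety form"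
proof -
  note sym = associative_tensorsD(1)[OF T]
  define eigen where "eigen k \<longleftrightarrow> (\<forall>y. \<exists>r. mult T y k = scale r k)" for k
  have "\<exists>f. orthogonal_family {..<j} f \<and> (\<forall>i<j. eigen (f i))" if "j \<le> dim (UNIV :: 'v set)" for j
    using that
  proof (induction j)
    case 0
    show ?case by (intro exI[of _ "\<lambda>_. 0"]) (simp add: orthogonal_family_def)
  next
    case (Suc j)
    then obtain f where f: "orthogonal_family {..<j} f" "\<forall>i<j. eigen (f i)"
      by auto
    define E where "E = {z. \<forall>i\<in>{..<j}. form z (f i) = 0}"
    have "subspace E"
      by (auto simp: subspace_def E_def form_bilinear)
    moreover have "mult T y z \<in> E" if "z \<in> E" for y z
      unfolding E_def
    proof (intro CollectI ballI)
      fix i assume i: "i \<in> {..<j}"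
      then obtain r where "mult T y (f i) = scale r (f i)"
        using f(2) by (auto simp: eigen_def)
      then show "form (mult T y z) (f i) = 0"
        using that i by (simp add: form_mult_adjoint[OF sym] form_scale_right E_def)
    qed
    moreover obtain z where "z \<in> E" "z \<noteq> 0"
      using orthogonal_complement_nonzero[OF f(1)] Suc.prems by (auto simp: E_def)
    ultimately obtain k where k: "k \<in> E" "k \<noteq> 0" "eigen k"
      unfolding eigen_def using common_eigenvector[OF T] by blast
    then have "form k k \<noteq> 0"
      using anis by (simp add: eigen_def)
    then have "orthogonal_family {..<Suc j} (f(j := k))"
      using orthogonal_family_extend[OF f(1)] k(1) by (simp add: E_def)
    moreover have "\<forall>i<Suc j. eigen ((f(j := k)) i)"
      using f(2) k(3) by (simp add: less_Suc_eq)
    ultimately show ?case by blast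
  qed
  then obtain f where f: "orthogonal_family {..<dim (UNIV :: 'v set)} f"
    and eig: "\<forall>i<dim (UNIV :: 'v set). eigen (f i)"
    by blast
  let ?I = "{..<dim (UNIV :: 'v set)}"
  have orth: "form (f i) (f j) = 0" if "i \<in> ?I" "j \<in> ?I" "i \<noteq> j" for i j
    using f that by (simp add: orthogonal_family_def)
  have ne: "form (f i) (f i) \<noteq> 0" if "i \<in> ?I" for i
    using f that by (simp add: orthogonal_family_def)
  have "strongly_odeco form T"
  proof (rule strongly_odeco_diagonal[OF _ sym _ orth ne])
    show "span (f ` ?I) = UNIV"
      using orthogonal_family_card(2)[OF f] by simp
    fix i j k assume ijk: "i \<in> ?I" "j \<in> ?I" "k \<in> ?I" and neq: "\<not> (i = j \<and> j = k)"
    have zero: "T y (f a) (f b) = 0" if ab: "a \<in> ?I" "b \<in> ?I" "a \<noteq> b" for y a b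
    proof -
      obtain r where "mult T y (f a) = scale r (f a)"
        using eig ab(1) by (auto simp: eigen_def)
      then show ?thesis
        using orth[OF ab] by (simp add: form_mult[OF sym, symmetric] form_scale_left)
    qed
    show "T (f i) (f j) (f k) = 0"
    proof (cases "j = k")
      case True
      then show ?thesis
        using zero[OF ijk(1,3), of "f j"] neq symmetric_tensor_swap12[OF sym] by auto
    next
      case False
      then show ?thesis
        using zero ijk by blast
    qed
  qed simp
  then show ?thesis
    by (rule strongly_odeco_in_variety[OF sym])
qed

lemma hyperbolic_partner:
  assumes "k \<noteq> 0" "form k k = 0"
  shows "\<exists>w. form w w = 0 \<and> form k w = 1"
proof -
  obtain y where y: "form k y \<noteq> 0"
    using form_nondegenerate assms(1) by blast
  define v where "v = scale (1 / form k y) y"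
  have v: "form k v = 1" "form v k = 1"
    using y by (simp_all add: v_def form_bilinear form_sym[of y k])
  \<comment> \<open>Half of (v|v) k is subtracted: this cancels (v|v) and, as \<open>k\<close> is
    isotropic, leaves the pairing with \<open>k\<close> at 1.\<close>
  then have "form (v - scale (form v v / 2) k) (v - scale (form v v / 2) k) = 0"
    "form k (v - scale (form v v / 2) k) = 1"
    using assms(2) by (simp_all add: form_bilinear)
  then show ?thesis by blast
qed

lemma hyperbolic_plane_span:
  assumes "form k k = 0" "form w w = 0" "form k w = 1"
  shows "dim (UNIV :: 'v set) \<ge> 2" "dim (UNIV :: 'v set) = 2 \<Longrightarrow> span {k, w} = UNIV"
proof -
  have ne: "k \<noteq> w"
    using assms by auto
  have dual: "form i (if j = k then w else k) = (if i = j then 1 else 0)" if "i \<in> {k, w}" "j \<in> {k, w}" for i j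
    using that assms ne form_sym[of w k] by auto
  show "dim (UNIV :: 'v set) \<ge> 2" "dim (UNIV :: 'v set) = 2 \<Longrightarrow> span {k, w} = UNIV"
    using dual_family_card[of "{k, w}" "\<lambda>i. i" "\<lambda>j. if j = k then w else k" "\<lambda>_. 1"] dual ne by auto
qed

lemma hyperbolic_frame_exists:
  assumes k: "form k k = 0" and w: "form w w = 0" "form k w = 1" and n: "dim (UNIV :: 'v set) = 3"
  shows "\<exists>m. m \<noteq> 0 \<and> hyperbolic_frame k m w \<and> span {k, m, w} = UNIV"
proof -
  have wk: "form w k = 1"
    using w form_sym[of w k] by simp
  \<comment> \<open>The plane of \<open>k\<close> and \<open>w\<close> in anisotropic orthogonal
    coordinates, k + w and k - w with squares 2 and -2, as the complement lemmas require.\<close>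
  define f where "f i = (if i = 0 then k + w else k - w)" for i :: nat
  have orth: "orthogonal_family {..<2} f"
    unfolding orthogonal_family_def
    by (auto simp: f_def form_bilinear k w wk less_2_cases_iff)
  obtain z where z: "form z z \<noteq> 0" "\<forall>i\<in>{..<2}. form z (f i) = 0"
    using orthogonal_complement_anisotropic[OF orth] n by auto
  have "form z k + form z w = 0" "form z k - form z w = 0"
    using z(2) by (auto simp: f_def form_bilinear lessThan_nat_numeral)
  then have zk: "form z k = 0" and zw: "form z w = 0"
    by (simp_all add: eq_neg_iff_add_eq_0)
  obtain e where e: "e ^ 2 = 1 / form z z"
    using nth_root_exists[of 2] by auto
  define m where "m = scale e z"
  have "form m m = e ^ 2 * form z z"
    by (simp add: m_def form_bilinear power2_eq_square)
  then have mm: "form m m = 1"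
    using e z by simp
  have mk: "form m k = 0" "form m w = 0" "form k m = 0" "form w m = 0"
    using zk zw by (simp_all add: m_def form_bilinear form_sym[of _ z])
  have m0: "m \<noteq> 0"
    using mm by auto
  have ne: "k \<noteq> w" "m \<noteq> k" "m \<noteq> w"
    using k w mm mk wk by auto
  define g where "g j = (if j = k then w else if j = w then k else m)" for j
  have dual: "form i (g j) = (if i = j then 1 else 0)" if "i \<in> {k, m, w}" "j \<in> {k, m, w}" for i j
    using that k w wk mm mk ne by (auto simp: g_def)
  have "card {k, m, w} = 3"
    using ne by auto
  then have "span {k, m, w} = UNIV"
    using dual_family_card(2)[of "{k, m, w}" "\<lambda>i. i" g "\<lambda>_. 1"] dual n by auto
  then show ?thesis
    using m0 k w mm mk by (auto simp: hyperbolic_frame_def)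
qed

text \<open>Since \<open>k\<close> is an eigenvector, T k y z = r y (k|z), and symmetry in y and z
  forces \<open>r\<close> to be a multiple of (k|.). Every value involving \<open>k\<close> is thus
  determined by \<open>T k w w\<close>; the others are the cubic in \<open>w\<close> and
  \<open>m\<close>.\<close>

lemma tensor_eq_hyperbolic_tensor:
  assumes T: "T \<in> symmetric_tensors form" and f: "hyperbolic_frame k m w"
    and span: "span {k, m, w} = UNIV" and eig: "\<forall>y. \<exists>r. mult T y k = scale r k"
  shows "T = hyperbolic_tensor k m w (T w w w) (T w w m) (T w m m) (T m m m) (T k w w)"
proof -
  note fr = hyperbolic_frameD[OF f]
  obtain r where r: "\<And>y. mult T y k = scale (r y) k"
    using eig by metis
  have "T y k z = r y * form k z" for y z
    using r by (simp add: form_mult[OF T, symmetric] form_scale_left)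
  then have Tk: "T k y z = r y * form k z" for y z
    using symmetric_tensor_swap12[OF T] by metis
  have ry: "r y = r w * form k y" for y
    using Tk[of y w] Tk[of w y] symmetric_tensor_swap23[OF T, of k y w] fr by simp
  have Tk1: "T k y z = T k w w * form k y * form k z" for y z
    unfolding Tk[of y z] Tk[of w w] ry[of y] by (simp add: fr)
  then have Tk2: "T y k z = T k w w * form k y * form k z" for y z
    using symmetric_tensor_swap12[OF T] by metis
  then have Tk3: "T y z k = T k w w * form k y * form k z" for y z
    using symmetric_tensor_swap23[OF T] by metis
  have perm: "T m w w = T w w m" "T w m w = T w w m" "T m w m = T w m m" "T m m w = T w m m"
    using symmetric_tensorsD[OF T] by metis+
  define l where "l = T k w w"
  show ?thesis
  proof (rule symmetric_tensor_eqI[OF T hyperbolic_tensor_symmetric span])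
    fix x y z assume "x \<in> {k, m, w}" "y \<in> {k, m, w}" "z \<in> {k, m, w}"
    moreover have "form m m = 1 \<or> m = 0"
      using f by (simp add: hyperbolic_frame_def)
    ultimately show "T x y z = hyperbolic_tensor k m w (T w w w) (T w w m) (T w m m) (T m m m) (T k w w) x y z"
      unfolding hyperbolic_tensor_def l_def[symmetric]
      by (elim insertE disjE emptyE)
         (simp_all add: Tk1[folded l_def] Tk2[folded l_def] Tk3[folded l_def] perm fr
            symmetric_tensor_zero[OF T] l_def[symmetric])
  qed
qed

theorem associative_in_variety_dim_le_3:
  assumes n: "dim (UNIV :: 'v set) \<le> 3" and T: "T \<in> associative_tensors scale form"
  shows "T \<in> odeco_variety form"
proof (cases "\<exists>k. k \<noteq> 0 \<and> (\<forall>y. \<exists>r. mult T y k = scale r k) \<and> form k k = 0")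
  case False
  then show ?thesis
    using associative_in_variety_of_anisotropic_eigenvectors[OF T] by blast
next
  case True
  note sym = associative_tensorsD(1)[OF T]
  obtain k where k: "k \<noteq> 0" "form k k = 0" and eig: "\<forall>y. \<exists>r. mult T y k = scale r k"
    using True by blast
  obtain w where w: "form w w = 0" "form k w = 1"
    using hyperbolic_partner[OF k] by blast
  \<comment> \<open>A nonzero isotropic vector needs a hyperbolic plane, so dimensions 0 and 1 have
    been settled by the anisotropic case.\<close>
  have "dim (UNIV :: 'v set) = 2 \<or> dim (UNIV :: 'v set) = 3"
    using hyperbolic_plane_span(1)[OF k(2) w] n by auto
  then show ?thesis
  proof
    assume n: "dim (UNIV :: 'v set) = 2"
    have f: "hyperbolic_frame k 0 w"
      using k w by (simp add: hyperbolic_frame_def)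
    have span: "span {k, w} = UNIV"
      by (rule hyperbolic_plane_span(2)[OF k(2) w n])
    then have "span {k, 0, w} = UNIV"
      by (metis insert_commute span_insert_0)
    then show ?thesis
      using tensor_eq_hyperbolic_tensor[OF sym f _ eig] hyperbolic_tensor_in_variety_plane[OF f span n]
      by metis
  next
    assume n: "dim (UNIV :: 'v set) = 3"
    obtain m where m: "m \<noteq> 0" and f: "hyperbolic_frame k m w" and span: "span {k, m, w} = UNIV"
      using hyperbolic_frame_exists[OF k(2) w n] by blast
    define a b c d l where abcd: "a = T w w w" "b = T w w m" "c = T w m m" "d = T m m m" "l = T k w w"
    have T_eq: "T = hyperbolic_tensor k m w a b c d l"
      unfolding abcd by (rule tensor_eq_hyperbolic_tensor[OF sym f span eig])
    have "T (mult T w w) m m = T (mult T w m) w m"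
      using T associative_tensors_iff[OF sym] by blast
    then have "c * (c - l) = b * d"
      unfolding T_eq mult_hyperbolic_tensor using f m
      by (simp add: hyperbolic_tensor_def form_bilinear hyperbolic_frameD[OF f] hyperbolic_frame_def
          algebra_simps)
    then show ?thesis
      unfolding T_eq by (rule hyperbolic_tensor_in_variety[OF f m span n])
  qed
qed

end
subsection \<open>A cubic in six variables\<close>

definition permuted :: "nat \<Rightarrow> nat \<Rightarrow> nat \<Rightarrow> nat \<Rightarrow> nat \<Rightarrow> nat \<Rightarrow> bool" where
  "permuted p q r i j k \<longleftrightarrow>
    (i, j, k) \<in> {(p, q, r), (p, r, q), (q, p, r), (q, r, p), (r, p, q), (r, q, p)}"

text \<open>
  The polarisation of the cubic \<open>x\<^sub>0 x\<^sub>1 x\<^sub>3 - x\<^sub>0 x\<^sub>4\<^sup>2 + x\<^sub>1 x\<^sub>2\<^sup>2 + x\<^sub>2 x\<^sub>4 x\<^sub>5 + x\<^sub>3 x\<^sub>5\<^sup>2\<close> in six variables, up to rescaling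
  the monomials.
\<close>
definition cubic :: "nat \<Rightarrow> nat \<Rightarrow> nat \<Rightarrow> real" where
  "cubic i j k = of_bool (permuted 0 1 3 i j k) - of_bool (permuted 0 4 4 i j k)
    + of_bool (permuted 1 2 2 i j k) + of_bool (permuted 2 4 5 i j k) + of_bool (permuted 3 5 5 i j k)"

lemma cubic_symmetric: "cubic i j k = cubic j i k" "cubic i j k = cubic i k j"
proof -
  have "permuted p q r i j k \<longleftrightarrow> permuted p q r j i k" "permuted p q r i j k \<longleftrightarrow> permuted p q r i k j" for p q r
    by (auto simp: permuted_def)
  then show "cubic i j k = cubic j i k" "cubic i j k = cubic i k j"
    by (simp_all add: cubic_def)
qed

lemma sum_lessThan_6: "(\<Sum>m<6. g m) = g 0 + g 1 + g 2 + g 3 + g 4 + g (5::nat)"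
  for g :: "nat \<Rightarrow> 'a::comm_monoid_add"
  by (simp add: eval_nat_numeral add.assoc)

lemma all_less_6: "(\<forall>i<6. P i) \<longleftrightarrow> P 0 \<and> P 1 \<and> P 2 \<and> P 3 \<and> P 4 \<and> P (5::nat)"
  by (auto simp: eval_nat_numeral All_less_Suc)

text \<open>The products of the generators: row i j lists the gradient component selected by the
  pair. No two of the five monomials share a pair of variables, so every contraction has at most one
  term.\<close>

lemma sum_cubic:
  "(\<Sum>m<6. cubic 0 0 m * g m) = 0"
  "(\<Sum>m<6. cubic 0 1 m * g m) = g 3"
  "(\<Sum>m<6. cubic 0 2 m * g m) = 0"
  "(\<Sum>m<6. cubic 0 3 m * g m) = g 1"
  "(\<Sum>m<6. cubic 0 4 m * g m) = - g 4"
  "(\<Sum>m<6. cubic 0 5 m * g m) = 0"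
  "(\<Sum>m<6. cubic 1 0 m * g m) = g 3"
  "(\<Sum>m<6. cubic 1 1 m * g m) = 0"
  "(\<Sum>m<6. cubic 1 2 m * g m) = g 2"
  "(\<Sum>m<6. cubic 1 3 m * g m) = g 0"
  "(\<Sum>m<6. cubic 1 4 m * g m) = 0"
  "(\<Sum>m<6. cubic 1 5 m * g m) = 0"
  "(\<Sum>m<6. cubic 2 0 m * g m) = 0"
  "(\<Sum>m<6. cubic 2 1 m * g m) = g 2"
  "(\<Sum>m<6. cubic 2 2 m * g m) = g 1"
  "(\<Sum>m<6. cubic 2 3 m * g m) = 0"
  "(\<Sum>m<6. cubic 2 4 m * g m) = g 5"
  "(\<Sum>m<6. cubic 2 5 m * g m) = g 4"
  "(\<Sum>m<6. cubic 3 0 m * g m) = g 1"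
  "(\<Sum>m<6. cubic 3 1 m * g m) = g 0"
  "(\<Sum>m<6. cubic 3 2 m * g m) = 0"
  "(\<Sum>m<6. cubic 3 3 m * g m) = 0"
  "(\<Sum>m<6. cubic 3 4 m * g m) = 0"
  "(\<Sum>m<6. cubic 3 5 m * g m) = g 5"
  "(\<Sum>m<6. cubic 4 0 m * g m) = - g 4"
  "(\<Sum>m<6. cubic 4 1 m * g m) = 0"
  "(\<Sum>m<6. cubic 4 2 m * g m) = g 5"
  "(\<Sum>m<6. cubic 4 3 m * g m) = 0"
  "(\<Sum>m<6. cubic 4 4 m * g m) = - g 0"
  "(\<Sum>m<6. cubic 4 5 m * g m) = g 2"
  "(\<Sum>m<6. cubic 5 0 m * g m) = 0"
  "(\<Sum>m<6. cubic 5 1 m * g m) = 0"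
  "(\<Sum>m<6. cubic 5 2 m * g m) = g 4"
  "(\<Sum>m<6. cubic 5 3 m * g m) = g 5"
  "(\<Sum>m<6. cubic 5 4 m * g m) = g 2"
  "(\<Sum>m<6. cubic 5 5 m * g m) = g 3"
  by (simp_all add: sum_lessThan_6 cubic_def permuted_def)

text \<open>The equations describe the centre of the cubic, the matrices \<open>B\<close> that can
  be moved between the arguments of its trilinear form; it consists of scalars. Thirty instances
  kill the off-diagonal entries, five more identify the diagonal ones.\<close>

lemma cubic_centralizer:
  fixes B :: "nat \<Rightarrow> nat \<Rightarrow> real"
  assumes E: "\<And>j k l. j < 6 \<Longrightarrow> k < 6 \<Longrightarrow> l < 6 \<Longrightarrow>
    (\<Sum>m<6. cubic k l m * B j m) = (\<Sum>m<6. cubic j l m * B k m)"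
    and "j < 6" "m < 6"
  shows "B j m = (if j = m then B 0 0 else 0)"
proof -
  note [simp] = sum_cubic
  note [simp del] = One_nat_def
  have e0: "B 0 3 = 0"
    using E[of 0 1 0] by simp
  have e1: "- B 1 3 = 0"
    using E[of 0 1 1] by simp
  have e2: "B 0 2 = 0"
    using E[of 0 1 2] by simp
  have e3: "B 1 4 = 0"
    using E[of 0 1 4] by simp
  have e4: "B 0 1 = 0"
    using E[of 0 2 2] by simp
  have e5: "- B 2 1 = 0"
    using E[of 0 2 3] by simp
  have e6: "B 0 4 = 0"
    using E[of 0 2 5] by simp
  have e7: "- B 3 1 = 0"
    using E[of 0 3 3] by simp
  have e8: "B 3 4 = 0"
    using E[of 0 3 4] by simp
  have e9: "B 0 5 = 0"
    using E[of 0 3 5] by simp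
  have e10: "- B 4 3 = 0"
    using E[of 0 4 1] by simp
  have e11: "- B 4 1 = 0"
    using E[of 0 4 3] by simp
  have e12: "- B 5 3 = 0"
    using E[of 0 5 1] by simp
  have e13: "- B 2 3 = 0"
    using E[of 1 2 0] by simp
  have e14: "B 1 2 = 0"
    using E[of 1 2 1] by simp
  have e15: "- B 2 0 = 0"
    using E[of 1 2 3] by simp
  have e16: "B 1 5 = 0"
    using E[of 1 2 4] by simp
  have e17: "B 1 0 = 0"
    using E[of 1 3 1] by simp
  have e18: "- B 3 2 = 0"
    using E[of 1 3 2] by simp
  have e19: "- B 3 0 = 0"
    using E[of 1 3 3] by simp
  have e20: "- B 4 0 = 0"
    using E[of 1 4 3] by simp
  have e21: "- B 3 5 = 0"
    using E[of 2 3 4] by simp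
  have e22: "- B 2 4 = 0"
    using E[of 2 4 0] by simp
  have e23: "- B 4 2 = 0"
    using E[of 2 4 1] by simp
  have e24: "- B 5 2 = 0"
    using E[of 2 5 1] by simp
  have e25: "B 2 5 = 0"
    using E[of 2 5 3] by simp
  have e26: "- B 5 1 = 0"
    using E[of 3 5 0] by simp
  have e27: "- B 5 0 = 0"
    using E[of 3 5 1] by simp
  have e28: "B 5 4 = 0"
    using E[of 4 5 0] by simp
  have e29: "B 4 5 = 0"
    using E[of 4 5 3] by simp
  have e30: "B 0 0 - B 1 1 = 0"
    using E[of 0 1 3] by simp
  have e31: "B 0 0 - B 3 3 = 0"
    using E[of 0 3 1] by simp
  have e32: "- B 0 0 + B 4 4 = 0"
    using E[of 0 4 4] by simp
  have e33: "B 1 1 - B 2 2 = 0"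
    using E[of 1 2 2] by simp
  have e34: "B 2 2 - B 5 5 = 0"
    using E[of 2 5 4] by simp
  have b01: "B 0 1 = 0"
    using e4 by linarith
  have b02: "B 0 2 = 0"
    using e2 by linarith
  have b03: "B 0 3 = 0"
    using e0 by linarith
  have b04: "B 0 4 = 0"
    using e6 by linarith
  have b05: "B 0 5 = 0"
    using e9 by linarith
  have b10: "B 1 0 = 0"
    using e17 by linarith
  have b11: "B 1 1 = B 0 0"
    using e30 e31 e32 e33 e34 by linarith
  have b12: "B 1 2 = 0"
    using e14 by linarith
  have b13: "B 1 3 = 0"
    using e1 by linarith
  have b14: "B 1 4 = 0"
    using e3 by linarith
  have b15: "B 1 5 = 0"
    using e16 by linarith
  have b20: "B 2 0 = 0"
    using e15 by linarith
  have b21: "B 2 1 = 0"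
    using e5 by linarith
  have b22: "B 2 2 = B 0 0"
    using e30 e31 e32 e33 e34 by linarith
  have b23: "B 2 3 = 0"
    using e13 by linarith
  have b24: "B 2 4 = 0"
    using e22 by linarith
  have b25: "B 2 5 = 0"
    using e25 by linarith
  have b30: "B 3 0 = 0"
    using e19 by linarith
  have b31: "B 3 1 = 0"
    using e7 by linarith
  have b32: "B 3 2 = 0"
    using e18 by linarith
  have b33: "B 3 3 = B 0 0"
    using e30 e31 e32 e33 e34 by linarith
  have b34: "B 3 4 = 0"
    using e8 by linarith
  have b35: "B 3 5 = 0"
    using e21 by linarith
  have b40: "B 4 0 = 0"
    using e20 by linarith
  have b41: "B 4 1 = 0"
    using e11 by linarith
  have b42: "B 4 2 = 0"
    using e23 by linarith
  have b43: "B 4 3 = 0"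
    using e10 by linarith
  have b44: "B 4 4 = B 0 0"
    using e30 e31 e32 e33 e34 by linarith
  have b45: "B 4 5 = 0"
    using e29 by linarith
  have b50: "B 5 0 = 0"
    using e27 by linarith
  have b51: "B 5 1 = 0"
    using e26 by linarith
  have b52: "B 5 2 = 0"
    using e24 by linarith
  have b53: "B 5 3 = 0"
    using e12 by linarith
  have b54: "B 5 4 = 0"
    using e28 by linarith
  have b55: "B 5 5 = B 0 0"
    using e30 e31 e32 e33 e34 by linarith
  have "\<forall>j<6. \<forall>m<6. B j m = (if j = m then B 0 0 else 0)"
    by (simp add: all_less_6 b01 b02 b03 b04 b05 b10 b11 b12 b13 b14 b15 b20 b21 b22 b23 b24 b25 b30 b31 b32 b33 b34 b35 b40 b41 b42 b43 b44 b45 b50 b51 b52 b53 b54 b55)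
  then show ?thesis
    using assms(2,3) by blast
qed

text \<open>A \<open>q\<close> symmetric in its first two indices has 21 * 6 = 126 coordinates. The
  105 equations below leave these 21 undetermined.\<close>

definition free_triples :: "(nat \<times> nat \<times> nat) list" where
  "free_triples = [(0, 0, 0), (0, 1, 0), (0, 1, 1), (0, 1, 2), (0, 1, 4), (0, 1, 5), (0, 2, 0), (0, 3, 0), (0, 3, 2), (0, 3, 4), (0, 3, 5), (0, 4, 0), (0, 4, 2), (0, 4, 5), (0, 5, 0), (1, 1, 1), (1, 2, 0), (1, 2, 5), (1, 3, 1), (1, 3, 4), (1, 3, 5)]"

text \<open>
  The 105 equations are independent. They split into small blocks because the cubic is homogeneous
  for a torus, and \<open>free_triples\<close> parametrises the 21-dimensional space of solutions.
\<close>
lemma cubic_deformations: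
  fixes q :: "nat \<Rightarrow> nat \<Rightarrow> nat \<Rightarrow> real"
  assumes sym: "\<And>i j m. i < 6 \<Longrightarrow> j < 6 \<Longrightarrow> m < 6 \<Longrightarrow> q i j m = q j i m"
    and E: "\<And>i j k l. i < 6 \<Longrightarrow> j < 6 \<Longrightarrow> k < 6 \<Longrightarrow> l < 6 \<Longrightarrow>
      (\<Sum>m<6. cubic k l m * q i j m) + (\<Sum>m<6. cubic i j m * q k l m) =
      (\<Sum>m<6. cubic j l m * q i k m) + (\<Sum>m<6. cubic i k m * q j l m)"
    and free: "\<And>i j m. (i, j, m) \<in> set free_triples \<Longrightarrow> q i j m = 0"
    and "i < 6" "j < 6" "m < 6"
  shows "q i j m = 0"
proof -
  note [simp] = sum_cubic
  note [simp del] = One_nat_def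
  have z: "q 0 0 0 = 0" "q 0 1 0 = 0" "q 0 1 1 = 0" "q 0 1 2 = 0" "q 0 1 4 = 0" "q 0 1 5 = 0" "q 0 2 0 = 0" "q 0 3 0 = 0" "q 0 3 2 = 0" "q 0 3 4 = 0" "q 0 3 5 = 0" "q 0 4 0 = 0" "q 0 4 2 = 0" "q 0 4 5 = 0" "q 0 5 0 = 0" "q 1 1 1 = 0" "q 1 2 0 = 0" "q 1 2 5 = 0" "q 1 3 1 = 0" "q 1 3 4 = 0" "q 1 3 5 = 0"
    by (simp_all add: free free_triples_def)
  have e1: "q 0 0 0 - q 0 1 1 - q 0 3 3 = 0"
    using E[of 0 0 1 3] by simp
  have e2: "- q 0 0 0 + 2 * q 0 4 4 = 0"
    using E[of 0 0 4 4] by simp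
  have e3: "q 0 1 1 + q 2 2 3 - q 0 2 2 = 0"
    using E[of 0 1 2 2] by simp
  have e4: "q 0 2 2 - q 0 4 4 + q 2 5 4 = 0"
    using E[of 0 2 4 5] by simp
  have e5: "q 0 2 2 - q 0 5 5 = 0"
    using E[of 0 2 5 4] sym[of 5 4] by simp
  have e6: "q 0 3 3 + q 5 5 1 - q 0 5 5 = 0"
    using E[of 0 3 5 5] by simp
  have e7: "q 2 2 3 + q 5 5 1 - 2 * q 2 5 4 = 0"
    using E[of 2 2 5 5] by simp
  have z1: "q 0 2 2 = 0" "q 0 3 3 = 0" "q 0 4 4 = 0" "q 0 5 5 = 0" "q 2 2 3 = 0" "q 2 5 4 = 0" "q 5 5 1 = 0"
    using e1 e2 e3 e4 e5 e6 e7 z by linarith+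
  have e8: "q 0 0 1 = 0"
    using E[of 0 0 2 2] by simp
  have z2: "q 0 0 1 = 0"
    using e8 by linarith+
  have e9: "q 0 0 2 - q 0 2 3 = 0"
    using E[of 0 0 1 2] by simp
  have e10: "q 0 0 2 + q 0 5 4 = 0"
    using E[of 0 0 4 5] by simp
  have e11: "q 0 2 3 - q 0 5 4 = 0"
    using E[of 0 2 5 5] by simp
  have z3: "q 0 0 2 = 0" "q 0 2 3 = 0" "q 0 5 4 = 0"
    using e9 e10 e11 by linarith+
  have e12: "q 0 0 3 = 0"
    using E[of 0 0 5 5] by simp
  have z4: "q 0 0 3 = 0"
    using e12 by linarith+
  have e13: "q 0 0 4 = 0"
    using E[of 0 0 2 5] by simp
  have z5: "q 0 0 4 = 0"
    using e13 by linarith+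
  have e14: "q 0 0 5 + q 0 2 4 = 0"
    using E[of 0 0 2 4] by simp
  have e15: "q 0 0 5 - q 0 5 1 = 0"
    using E[of 0 0 3 5] by simp
  have e16: "q 0 2 4 - q 0 5 1 = 0"
    using E[of 0 2 5 2] sym[of 5 2] by simp
  have z6: "q 0 0 5 = 0" "q 0 2 4 = 0" "q 0 5 1 = 0"
    using e14 e15 e16 by linarith+
  have e17: "q 0 1 0 + q 1 3 3 - q 1 1 1 = 0"
    using E[of 0 1 3 1] sym[of 3 1] by simp
  have e18: "- q 0 1 0 + q 4 4 3 + q 1 4 4 = 0"
    using E[of 0 1 4 4] by simp
  have e19: "q 1 1 1 - 2 * q 1 2 2 = 0"
    using E[of 1 1 2 2] by simp
  have e20: "q 1 2 2 + q 4 5 2 - q 1 4 4 = 0"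
    using E[of 1 2 4 5] by simp
  have e21: "q 1 2 2 + q 4 5 2 - q 1 5 5 = 0"
    using E[of 1 2 5 4] sym[of 5 4] by simp
  have e22: "q 1 3 3 + q 5 5 0 - q 1 5 5 = 0"
    using E[of 1 3 5 5] by simp
  have e23: "q 4 4 3 - q 5 5 0 - 2 * q 4 5 2 = 0"
    using E[of 4 4 5 5] by simp
  have z7: "q 1 2 2 = 0" "q 1 3 3 = 0" "q 1 4 4 = 0" "q 1 5 5 = 0" "q 4 4 3 = 0" "q 4 5 2 = 0" "q 5 5 0 = 0"
    using e17 e18 e19 e20 e21 e22 e23 z by linarith+
  have e24: "q 0 1 2 + q 1 2 3 = 0"
    using E[of 0 1 2 1] sym[of 2 1] by simp
  have e25: "q 0 1 2 + q 4 5 3 + q 1 5 4 = 0"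
    using E[of 0 1 4 5] by simp
  have e26: "q 0 1 2 + q 4 5 3 = 0"
    using E[of 0 1 5 4] sym[of 5 4] by simp
  have e27: "q 1 2 3 + q 5 5 2 - q 1 5 4 = 0"
    using E[of 1 2 5 5] by simp
  have z8: "q 1 2 3 = 0" "q 1 5 4 = 0" "q 4 5 3 = 0" "q 5 5 2 = 0"
    using e24 e25 e26 e27 z by linarith+
  have e28: "- 2 * q 0 1 3 = 0"
    using E[of 0 0 1 1] by simp
  have e29: "q 0 1 3 + q 5 5 3 = 0"
    using E[of 0 1 5 5] by simp
  have z9: "q 0 1 3 = 0" "q 5 5 3 = 0"
    using e28 e29 by linarith+
  have e30: "q 0 1 4 - q 0 4 3 = 0"
    using E[of 0 0 1 4] by simp
  have e31: "q 0 1 4 + q 2 5 3 = 0"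
    using E[of 0 1 2 5] by simp
  have e32: "q 0 1 4 + q 2 5 3 - q 0 5 2 = 0"
    using E[of 0 1 5 2] sym[of 5 2] by simp
  have e33: "q 0 4 3 - q 5 5 4 - q 0 5 2 = 0"
    using E[of 0 4 5 5] by simp
  have z10: "q 0 4 3 = 0" "q 0 5 2 = 0" "q 2 5 3 = 0" "q 5 5 4 = 0"
    using e30 e31 e32 e33 z by linarith+
  have e34: "q 0 1 5 + q 2 4 3 = 0"
    using E[of 0 1 2 4] by simp
  have e35: "q 0 1 5 + q 2 4 3 - q 0 4 2 + q 1 2 4 = 0"
    using E[of 0 1 4 2] sym[of 4 2] by simp
  have e36: "q 0 1 5 + q 3 5 3 - q 1 5 1 = 0"
    using E[of 0 1 3 5] by simp
  have e37: "q 0 1 5 + q 3 5 3 - q 0 5 0 = 0"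
    using E[of 0 1 5 3] sym[of 5 3] by simp
  have e38: "q 0 4 2 - q 4 5 4 + q 0 5 0 = 0"
    using E[of 0 4 5 4] sym[of 5 4] by simp
  have e39: "q 1 2 4 + q 2 5 2 - q 1 5 1 = 0"
    using E[of 1 2 5 2] sym[of 5 2] by simp
  have e40: "q 2 4 3 + q 5 5 5 - q 2 5 2 - q 4 5 4 = 0"
    using E[of 2 4 5 5] by simp
  have z11: "q 1 2 4 = 0" "q 1 5 1 = 0" "q 2 4 3 = 0" "q 2 5 2 = 0" "q 3 5 3 = 0" "q 4 5 4 = 0" "q 5 5 5 = 0"
    using e34 e35 e36 e37 e38 e39 e40 z by linarith+
  have e41: "q 2 3 3 - q 0 2 0 = 0"
    using E[of 0 1 2 3] by simp
  have e42: "q 2 3 3 - q 0 3 2 - q 1 2 1 = 0"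
    using E[of 0 1 3 2] sym[of 3 2] by simp
  have e43: "- q 0 2 0 - q 0 4 5 + q 2 4 4 = 0"
    using E[of 0 2 4 4] by simp
  have e44: "q 0 3 2 + q 4 5 1 - q 0 4 5 + q 3 5 4 = 0"
    using E[of 0 3 4 5] by simp
  have e45: "q 0 3 2 + q 4 5 1 = 0"
    using E[of 0 3 5 4] sym[of 5 4] by simp
  have e46: "q 2 2 2 + q 4 5 1 - q 2 4 4 - q 2 5 5 = 0"
    using E[of 2 2 4 5] by simp
  have e47: "q 2 3 3 - q 2 5 5 - q 3 5 4 = 0"
    using E[of 2 3 5 5] by simp
  have z12: "q 1 2 1 = 0" "q 2 2 2 = 0" "q 2 3 3 = 0" "q 2 4 4 = 0" "q 2 5 5 = 0" "q 3 5 4 = 0" "q 4 5 1 = 0"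
    using e41 e42 e43 e44 e45 e46 e47 z by linarith+
  have e48: "- q 0 2 1 = 0"
    using E[of 0 0 2 3] by simp
  have z13: "q 0 2 1 = 0"
    using e48 by linarith+
  have e49: "q 0 3 4 - q 0 4 1 = 0"
    using E[of 0 0 3 4] by simp
  have e50: "q 0 2 5 - q 0 4 1 + q 2 2 4 = 0"
    using E[of 0 2 4 2] sym[of 4 2] by simp
  have e51: "q 0 2 5 - q 0 3 4 - q 2 5 1 = 0"
    using E[of 0 2 3 5] by simp
  have e52: "q 0 2 5 = 0"
    using E[of 0 2 5 3] sym[of 5 3] by simp
  have z14: "q 0 2 5 = 0" "q 0 4 1 = 0" "q 2 2 4 = 0" "q 2 5 1 = 0"
    using e49 e50 e51 e52 z by linarith+
  have e53: "q 3 3 3 - q 0 3 0 - q 1 3 1 = 0"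
    using E[of 0 1 3 3] by simp
  have e54: "- q 0 3 0 + q 4 4 1 + q 3 4 4 = 0"
    using E[of 0 3 4 4] by simp
  have e55: "q 2 3 2 - q 1 3 1 - q 2 2 0 = 0"
    using E[of 1 2 3 2] sym[of 3 2] by simp
  have e56: "- q 2 2 0 + q 4 4 1 - 2 * q 2 4 5 = 0"
    using E[of 2 2 4 4] by simp
  have e57: "q 2 3 2 - q 2 4 5 - q 3 5 5 = 0"
    using E[of 2 3 4 5] by simp
  have e58: "q 2 3 2 - q 3 4 4 = 0"
    using E[of 2 3 5 4] sym[of 5 4] by simp
  have e59: "q 3 3 3 - 2 * q 3 5 5 = 0"
    using E[of 3 3 5 5] by simp
  have z15: "q 2 2 0 = 0" "q 2 3 2 = 0" "q 2 4 5 = 0" "q 3 3 3 = 0" "q 3 4 4 = 0" "q 3 5 5 = 0" "q 4 4 1 = 0"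
    using e53 e54 e55 e56 e57 e58 e59 z by linarith+
  have e60: "- 2 * q 0 3 1 = 0"
    using E[of 0 0 3 3] by simp
  have e61: "- q 0 3 1 - q 2 2 1 = 0"
    using E[of 0 2 3 2] sym[of 3 2] by simp
  have z16: "q 0 3 1 = 0" "q 2 2 1 = 0"
    using e60 e61 by linarith+
  have e62: "- q 0 3 5 - q 2 4 1 = 0"
    using E[of 0 2 3 4] by simp
  have e63: "q 2 3 4 = 0"
    using E[of 0 2 4 3] sym[of 4 3] by simp
  have e64: "q 0 3 5 + q 3 5 1 = 0"
    using E[of 0 3 5 3] sym[of 5 3] by simp
  have e65: "q 2 2 5 + q 3 5 1 - q 2 3 4 = 0"
    using E[of 2 2 3 5] by simp
  have z17: "q 2 2 5 = 0" "q 2 3 4 = 0" "q 2 4 1 = 0" "q 3 5 1 = 0"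
    using e62 e63 e64 e65 z by linarith+
  have e66: "q 3 4 3 - q 1 4 1 = 0"
    using E[of 0 1 3 4] by simp
  have e67: "q 3 4 3 - q 0 4 0 + q 1 3 4 = 0"
    using E[of 0 1 4 3] sym[of 4 3] by simp
  have e68: "q 1 2 5 + q 2 4 2 - q 1 4 1 = 0"
    using E[of 1 2 4 2] sym[of 4 2] by simp
  have e69: "q 1 2 5 + q 3 5 2 - q 1 3 4 - q 2 5 0 = 0"
    using E[of 1 2 3 5] by simp
  have e70: "q 1 2 5 + q 3 5 2 = 0"
    using E[of 1 2 5 3] sym[of 5 3] by simp
  have e71: "q 2 4 2 + q 4 5 5 + q 2 5 0 - q 4 4 4 = 0"
    using E[of 2 4 5 4] sym[of 5 4] by simp
  have e72: "q 3 4 3 - q 3 5 2 - q 4 5 5 = 0"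
    using E[of 3 4 5 5] by simp
  have z18: "q 1 4 1 = 0" "q 2 4 2 = 0" "q 2 5 0 = 0" "q 3 4 3 = 0" "q 3 5 2 = 0" "q 4 4 4 = 0" "q 4 5 5 = 0"
    using e66 e67 e68 e69 e70 e71 e72 z by linarith+
  have e73: "- q 0 5 3 = 0"
    using E[of 0 0 1 5] by simp
  have z19: "q 0 5 3 = 0"
    using e73 by linarith+
  have e74: "- q 1 1 0 = 0"
    using E[of 1 1 4 4] by simp
  have z20: "q 1 1 0 = 0"
    using e74 by linarith+
  have e75: "q 1 1 2 = 0"
    using E[of 1 1 4 5] by simp
  have z21: "q 1 1 2 = 0"
    using e75 by linarith+
  have e76: "q 1 1 3 = 0"
    using E[of 1 1 5 5] by simp
  have z22: "q 1 1 3 = 0"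
    using e76 by linarith+
  have e77: "q 1 4 3 + q 1 1 4 = 0"
    using E[of 0 1 4 1] sym[of 4 1] by simp
  have e78: "q 1 1 4 - q 1 5 2 = 0"
    using E[of 1 1 2 5] by simp
  have e79: "q 1 4 3 - q 1 5 2 = 0"
    using E[of 1 4 5 5] by simp
  have z23: "q 1 1 4 = 0" "q 1 4 3 = 0" "q 1 5 2 = 0"
    using e77 e78 e79 by linarith+
  have e80: "q 1 1 5 - q 1 4 2 = 0"
    using E[of 1 1 2 4] by simp
  have e81: "q 1 1 5 - q 1 5 0 = 0"
    using E[of 1 1 3 5] by simp
  have e82: "q 1 4 2 + q 1 5 0 = 0"
    using E[of 1 4 5 4] sym[of 5 4] by simp
  have z24: "q 1 1 5 = 0" "q 1 4 2 = 0" "q 1 5 0 = 0"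
    using e80 e81 e82 by linarith+
  have e83: "- q 1 2 0 - q 1 3 2 = 0"
    using E[of 1 1 2 3] by simp
  have e84: "- q 1 2 0 + q 4 4 2 - q 1 4 5 = 0"
    using E[of 1 2 4 4] by simp
  have e85: "q 1 3 2 + q 4 5 0 - q 1 4 5 = 0"
    using E[of 1 3 4 5] by simp
  have e86: "q 1 3 2 + q 4 5 0 = 0"
    using E[of 1 3 5 4] sym[of 5 4] by simp
  have z25: "q 1 3 2 = 0" "q 1 4 5 = 0" "q 4 4 2 = 0" "q 4 5 0 = 0"
    using e83 e84 e85 e86 z by linarith+
  have e87: "- 2 * q 1 3 0 = 0"
    using E[of 1 1 3 3] by simp
  have e88: "- q 1 3 0 + q 4 4 0 = 0"
    using E[of 1 3 4 4] by simp
  have z26: "q 1 3 0 = 0" "q 4 4 0 = 0"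
    using e87 e88 by linarith+
  have e89: "q 3 4 2 - q 1 3 5 - q 2 4 0 = 0"
    using E[of 1 2 3 4] by simp
  have e90: "q 3 4 2 = 0"
    using E[of 1 2 4 3] sym[of 4 3] by simp
  have e91: "q 1 3 5 + q 3 5 0 = 0"
    using E[of 1 3 5 3] sym[of 5 3] by simp
  have e92: "q 3 4 2 + q 3 5 0 - q 4 4 5 = 0"
    using E[of 3 4 5 4] sym[of 5 4] by simp
  have z27: "q 2 4 0 = 0" "q 3 4 2 = 0" "q 3 5 0 = 0" "q 4 4 5 = 0"
    using e89 e90 e91 e92 z by linarith+
  have e93: "- q 1 4 0 = 0"
    using E[of 1 1 3 4] by simp
  have z28: "q 1 4 0 = 0"
    using e93 by linarith+
  have e94: "q 1 5 3 = 0"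
    using E[of 0 1 5 1] sym[of 5 1] by simp
  have z29: "q 1 5 3 = 0"
    using e94 by linarith+
  have e95: "q 3 3 2 - q 2 3 0 = 0"
    using E[of 1 2 3 3] by simp
  have e96: "- q 2 3 0 - q 3 4 5 = 0"
    using E[of 2 3 4 4] by simp
  have e97: "q 3 3 2 - q 3 4 5 = 0"
    using E[of 3 3 4 5] by simp
  have z30: "q 2 3 0 = 0" "q 3 3 2 = 0" "q 3 4 5 = 0"
    using e95 e96 e97 by linarith+
  have e98: "- q 2 3 1 = 0"
    using E[of 0 2 3 3] by simp
  have z31: "q 2 3 1 = 0"
    using e98 by linarith+
  have e99: "q 3 4 1 + q 3 3 4 = 0"
    using E[of 0 3 4 3] sym[of 4 3] by simp
  have e100: "q 3 4 1 - q 2 3 5 = 0"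
    using E[of 2 2 3 4] by simp
  have e101: "q 2 3 5 - q 3 3 4 = 0"
    using E[of 2 3 5 3] sym[of 5 3] by simp
  have z32: "q 2 3 5 = 0" "q 3 3 4 = 0" "q 3 4 1 = 0"
    using e99 e100 e101 by linarith+
  have e102: "- q 3 3 0 = 0"
    using E[of 3 3 4 4] by simp
  have z33: "q 3 3 0 = 0"
    using e102 by linarith+
  have e103: "q 3 3 1 = 0"
    using E[of 2 2 3 3] by simp
  have z34: "q 3 3 1 = 0"
    using e103 by linarith+
  have e104: "- q 3 3 5 = 0"
    using E[of 2 3 4 3] sym[of 4 3] by simp
  have z35: "q 3 3 5 = 0"
    using e104 by linarith+
  have e105: "q 3 4 0 = 0"
    using E[of 1 3 4 3] sym[of 4 3] by simp
  have z36: "q 3 4 0 = 0"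
    using e105 by linarith+
  have zero: "\<forall>i<6. \<forall>j<6. \<forall>m<6. i \<le> j \<longrightarrow> q i j m = 0"
    by (simp add: all_less_6 z z1 z2 z3 z4 z5 z6 z7 z8 z9 z10 z11 z12 z13 z14 z15 z16 z17 z18 z19 z20 z21 z22 z23 z24 z25 z26 z27 z28 z29 z30 z31 z32 z33 z34 z35 z36)
  show ?thesis
  proof (cases "i \<le> j")
    case True
    then show ?thesis using zero assms(4-6) by blast
  next
    case False
    then have "j \<le> i" by simp
    then show ?thesis using zero assms(4-6) sym[of i j m] by simp
  qed
qed

section \<open>Rigidity of the counterexample in coordinates\<close>

text \<open>
  The index set of coordinates of a deformation that determine it; it has one element fewer than
  the dimension \<open>n (n + 1) / 2\<close> of the odeco variety.
\<close>
definition determining_triples :: "nat \<Rightarrow> (nat \<times> nat \<times> nat) set" where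
  "determining_triples n = (\<lambda>(i, j, m). (i, j, m + 6)) ` set free_triples
    \<union> (\<lambda>(k, j, i). (i, j, k)) ` (SIGMA k:{..<6::nat}. SIGMA j:{..k}. {..j})
    \<union> (\<lambda>(e, b). (b, e, e)) ` (SIGMA e:{12..<n}. {..e})"

lemma determining_triples_finite: "finite (determining_triples n)"
  by (auto simp: determining_triples_def)

lemma card_determining_triples:
  assumes "n \<ge> 12"
  shows "2 * card (determining_triples n) < n * (n + 1)"
proof -
  have 1: "card ((\<lambda>(i, j, m). (i, j, m + 6)) ` set free_triples) \<le> 21"
  proof -
    have "card ((\<lambda>(i, j, m). (i, j, m + 6)) ` set free_triples) \<le> card (set free_triples)"
      by (rule card_image_le) simp
    also have "\<dots> \<le> length free_triples"
      by (rule card_length)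
    finally show ?thesis
      by (simp add: free_triples_def)
  qed
  have 2: "card ((\<lambda>(k, j, i). (i, j, k)) ` (SIGMA k:{..<6::nat}. SIGMA j:{..k}. {..j}))
      \<le> 56"
    by (rule order_trans[OF card_image_le]) (auto simp: eval_nat_numeral)
  \<comment> \<open>156 is 12 * 13. The first two families contribute at most 2 * (21 + 56) = 154,
    which yields the strict inequality.\<close>
  have "2 * (\<Sum>e\<in>{12..<n}. Suc e) + 156 = n * (n + 1)"
    using assms by (induction n rule: dec_induct) (simp_all add: sum.atLeastLessThan_Suc)
  moreover have "card ((\<lambda>(e, b). (b, e, e)) ` (SIGMA e:{12..<n}. {..e})) \<le> (\<Sum>e\<in>{12..<n}. Suc e)"
    by (rule order_trans[OF card_image_le]) auto
  ultimately show ?thesis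
    unfolding determining_triples_def
    using 1 2 card_Un_le[of "(\<lambda>(i, j, m). (i, j, m + 6)) ` set free_triples"
        "(\<lambda>(k, j, i). (i, j, k)) ` (SIGMA k:{..<6::nat}. SIGMA j:{..k}. {..j})"]
      card_Un_le[of "(\<lambda>(i, j, m). (i, j, m + 6)) ` set free_triples
        \<union> (\<lambda>(k, j, i). (i, j, k)) ` (SIGMA k:{..<6::nat}. SIGMA j:{..k}. {..j})"
        "(\<lambda>(e, b). (b, e, e)) ` (SIGMA e:{12..<n}. {..e})"]
    by linarith
qed

text \<open>
  \<open>A k l i j\<close> stands for the value of a deformation \<open>s\<close> at the basis vectors \<open>i\<close>, \<open>j\<close> and the product of
  \<open>k\<close> and \<open>l\<close> in the algebra with basis \<open>w\<^sub>0, \<dots>, w\<^sub>5, u\<^sub>0, \<dots>, u\<^sub>5, e\<^sub>1\<^sub>2, \<dots>\<close> where \<open>w\<^sub>k w\<^sub>l\<close> is the gradient of the cubic,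
  the \<open>e\<close> are orthogonal idempotents, and all other products vanish.
\<close>
lemma deformation_coordinates_trivial:
  fixes s :: "nat \<Rightarrow> nat \<Rightarrow> nat \<Rightarrow> real"
  assumes n: "n \<ge> 12"
    and sym: "\<And>i j k. s i j k = s j i k" "\<And>i j k. s i j k = s i k j"
    and A: "\<And>i j k l. A k l i j = (if k < 6 \<and> l < 6 then \<Sum>m<6. cubic k l m * s i j (m + 6)
      else if k = l \<and> 12 \<le> k then s i j k else 0)"
    and E: "\<And>i j k l. i < n \<Longrightarrow> j < n \<Longrightarrow> k < n \<Longrightarrow> l < n \<Longrightarrow>
      A k l i j + A i j k l = A j l i k + A i k j l"
    and Q: "\<And>i j k. (i, j, k) \<in> determining_triples n \<Longrightarrow> s i j k = 0"
    and ijk: "i < n" "j < n" "k < n"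
  shows "s i j k = 0"
proof -
  have Q1: "s i j (m + 6) = 0" if "(i, j, m) \<in> set free_triples" for i j m
    using that by (intro Q) (force simp: determining_triples_def)
  have Q2: "s i j k = 0" if "i \<le> j" "j \<le> k" "k < 6" for i j k
    using that by (intro Q) (force simp: determining_triples_def)
  have Q3: "s b e e = 0" if "12 \<le> e" "e < n" "b \<le> e" for b e
    using that by (intro Q) (force simp: determining_triples_def)
  \<comment> \<open>The equation for e, e, x, y: the mixed products of \<open>e\<close> with
    \<open>x\<close> and \<open>y\<close> vanish, leaving \<open>s\<close> at x, y, e as minus
    \<open>s\<close> at e, e, x y.\<close>
  have ee: "s x y e = - A x y e e" if "12 \<le> e" "e < n" "x < n" "y < n" "x \<noteq> e" "y \<noteq> e" for x y e
    using E[of e e x y] that by (simp add: A)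
  have sq: "s b e e = 0" if "12 \<le> e" "e < n" "b < n" for b e
  proof (cases "b \<le> e")
    case True
    then show ?thesis using Q3 that by simp
  next
    case False
    \<comment> \<open>For two different idempotents \<open>ee\<close> exchanges their roles, which
      leads back to an entry fixed by the determining set.\<close>
    then have "s e e b = - s b b e"
      using ee[of b e e] that by (simp add: A)
    moreover have "s b b e = s e b b" "s b e e = s e e b"
      using sym by metis+
    ultimately show ?thesis
      using Q3[of b e] that False by simp
  qed
  have K: "s x y e = 0" if e: "12 \<le> e" "e < n" and xy: "x < n" "y < n" for x y e
  proof (cases "x = e \<or> y = e")
    case True
    then show ?thesis using sq[OF e] xy sym by metis
  next
    case False
    have "s e e x = 0" if "x < n" for x
      using sq[OF e that] sym by metis
    moreover have "m + 6 < n" if "m < 6" for m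
      using that n by simp
    ultimately show ?thesis
      using ee[OF e xy] False xy by (simp add: A)
  qed
  \<comment> \<open>Products with the \<open>u\<close>'s vanish, so \<open>s a b\<close> annihilates
    every w_k w_l. The six pairs used below produce all six \<open>u\<close>'s up to sign.\<close>
  have UUU: "s a b (m + 6) = 0" if "6 \<le> a" "a < 12" "6 \<le> b" "b < 12" "m < 6" for a b m
  proof -
    have *: "(\<Sum>m<6. cubic k l m * s a b (m + 6)) = 0" if "k < 6" "l < 6" for k l
      using E[of a b k l] that \<open>6 \<le> a\<close> \<open>a < 12\<close> \<open>6 \<le> b\<close> \<open>b < 12\<close> n by (simp add: A)
    have "\<forall>m<6. s a b (m + 6) = 0"
      unfolding all_less_6
      using *[of 1 3] *[of 0 3] *[of 1 2] *[of 0 1] *[of 0 4] *[of 2 4]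
      by (simp add: sum_cubic del: One_nat_def)
    then show ?thesis using that by blast
  qed
  have diag: "s a j (m + 6) = (if j = m then s a 0 6 else 0)"
    if a: "6 \<le> a" "a < 12" and jm: "j < 6" "m < 6" for a j m
  proof -
    have "(\<Sum>m<6. cubic k l m * s a j (m + 6)) = (\<Sum>m<6. cubic j l m * s a k (m + 6))"
      if "j < 6" "k < 6" "l < 6" for j k l
      using E[of a j k l] that a n by (simp add: A)
    from cubic_centralizer[of "\<lambda>j m. s a j (m + 6)", OF this jm] show ?thesis
      by simp
  qed
  have UWU: "s a j (m + 6) = 0" if a: "6 \<le> a" "a < 12" and jm: "j < 6" "m < 6" for a j m
  proof (cases "j = m")
    case False
    then show ?thesis using diag[OF a jm] by simp
  next
    case True
    \<comment> \<open>The common diagonal value of the scalar matrix for u_b may be read at any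
      index. Read at some \<open>i\<close> different from \<open>b\<close> and permuted, it is an
      off-diagonal entry of the scalar matrix for u_i, hence 0.\<close>
    define b where "b = a - 6"
    have b: "a = b + 6" "b < 6"
      using a by (auto simp: b_def)
    define i :: nat where "i = (if b = 0 then 1 else 0)"
    have i: "i < 6" "i \<noteq> b"
      by (auto simp: i_def)
    have "s a j (m + 6) = s a i (i + 6)"
      using diag[OF a jm] diag[OF a i(1) i(1)] True by simp
    also have "\<dots> = s (i + 6) i (b + 6)"
      unfolding b using sym by metis
    also have "\<dots> = 0"
      using diag[of "i + 6" i b] i b by simp
    finally show ?thesis .
  qed
  have UU: "s a b z = 0" if "6 \<le> a" "a < 12" "6 \<le> b" "b < 12" "z < n" for a b z
  proof -
    consider "z < 6" | "6 \<le> z" "z < 12" | "12 \<le> z"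
      by linarith
    then show ?thesis
    proof cases
      case 1
      then show ?thesis
        using UWU[of a z "b - 6"] that sym(2)[of a b z] by simp
    next
      case 2
      then show ?thesis
        using UUU[of a b "z - 6"] that by simp
    next
      case 3
      then show ?thesis
        using K[of z a b] that n by simp
    qed
  qed
  have WWU: "s i j u = 0" if "i < 6" "j < 6" "6 \<le> u" "u < 12" for i j u
  proof -
    have "s i j (u - 6 + 6) = 0"
    proof (rule cubic_deformations[of "\<lambda>i j m. s i j (m + 6)"])
      fix i j k l :: nat assume "i < 6" "j < 6" "k < 6" "l < 6"
      then show "(\<Sum>m<6. cubic k l m * s i j (m + 6)) + (\<Sum>m<6. cubic i j m * s k l (m + 6)) =
          (\<Sum>m<6. cubic j l m * s i k (m + 6)) + (\<Sum>m<6. cubic i k m * s j l (m + 6))"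
        using E[of i j k l] n by (simp add: A)
    qed (use that Q1 sym(1) in auto)
    then show ?thesis using that by simp
  qed
  have WWW: "s i j k = 0" if "i < 6" "j < 6" "k < 6" for i j k
  proof -
    consider "i \<le> j" "j \<le> k" | "i \<le> k" "k \<le> j" | "j \<le> i" "i \<le> k" | "j \<le> k" "k \<le> i" | "k \<le> i" "i \<le> j"
      | "k \<le> j" "j \<le> i"
      by linarith
    then show ?thesis
      using Q2 that sym by cases metis+
  qed
  have perm: "s i j k = s i k j" "s i j k = s j k i" "s i j k = s k j i"
    using sym by metis+
  consider "12 \<le> i" | "12 \<le> j" | "12 \<le> k" | "i < 12" "j < 12" "k < 12"
    by linarith
  then show ?thesis
  proof cases
    case 4
    then show ?thesis
      using UU[of i j k] UU[of i k j] UU[of j k i] WWU[of i j k] WWU[of i k j] WWU[of j k i] WWW[of i j k]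
        perm ijk by (cases "i < 6"; cases "j < 6"; cases "k < 6") simp_all
  qed (use K[of i k j] K[of j i k] K[of k i j] perm ijk in simp_all)
qed

context nondegenerate_symmetric_form
begin

subsection \<open>Deformations of odeco tensors\<close>

text \<open>The linearisation at \<open>T\<close> of the associativity equations \<open>T x y (z w) = T x z (y w)\<close>.\<close>
definition deformation :: "('v \<Rightarrow> 'v \<Rightarrow> 'v \<Rightarrow> complex) \<Rightarrow> ('v \<Rightarrow> 'v \<Rightarrow> 'v \<Rightarrow> complex) \<Rightarrow> bool" where
  "deformation T S \<longleftrightarrow> (\<forall>x y z w.
    S x y (mult T z w) + S z w (mult T x y) = S x z (mult T y w) + S y w (mult T x z))"

text \<open>The derivative of the cube of \<open>a\<close> in the direction
  \<open>b\<close>.\<close>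

definition square_times :: "'v \<Rightarrow> 'v \<Rightarrow> 'v \<Rightarrow> 'v \<Rightarrow> 'v \<Rightarrow> complex" where
  "square_times a b = (\<lambda>x y z. form a x * form a y * form b z + form a x * form b y * form a z
    + form b x * form a y * form a z)"

lemma square_times_symmetric: "square_times a b \<in> symmetric_tensors form"
  by (rule symmetric_tensorsI) (simp_all add: square_times_def form_bilinear algebra_simps)

lemma deformation_sum:
  assumes "\<And>i. i \<in> I \<Longrightarrow> deformation T (S i)"
  shows "deformation T (\<Sum>i\<in>I. tensor_scale (r i) (S i))"
  unfolding deformation_def sum_fun3_apply tensor_scale_def sum.distrib[symmetric] distrib_left[symmetric]
  using assms by (intro allI sum.cong refl arg_cong2[where f = "(*)"]) (simp add: deformation_def)

text \<open>
  The weights \<open>\<alpha>\<close>, \<open>\<beta>\<close> come from moving \<open>a\<close> towards \<open>b\<close> and \<open>b\<close> towards \<open>a\<close> while keeping them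
  orthogonal.
\<close>
lemma deformation_square_times:
  assumes a: "\<And>x y. form a (mult T x y) = p * form a x * form a y"
    and b: "\<And>x y. form b (mult T x y) = r * form b x * form b y"
    and rel: "\<alpha> * r + \<beta> * p = 0"
  shows "deformation T (tensor_scale \<alpha> (square_times a b) + tensor_scale \<beta> (square_times b a))"
  unfolding deformation_def
proof (intro allI)
  fix x y z w
  let ?S = "tensor_scale \<alpha> (square_times a b) + tensor_scale \<beta> (square_times b a)"
  have "?S x y (mult T z w) + ?S z w (mult T x y) - (?S x z (mult T y w) + ?S y w (mult T x z)) =
    (\<alpha> * r + \<beta> * p) * (form a x * form a y * form b z * form b w + form b x * form b y * form a z * form a w
      - form a x * form a z * form b y * form b w - form b x * form b z * form a y * form a w)"
    by (simp add: tensor_scale_def square_times_def a b algebra_simps)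
  then show "?S x y (mult T z w) + ?S z w (mult T x y) = ?S x z (mult T y w) + ?S y w (mult T x z)"
    by (simp add: rel)
qed

lemma deformation_cube:
  assumes "\<And>x y. form a (mult T x y) = p * form a x * form a y"
  shows "deformation T (tensor3 form a a a)"
  by (simp add: deformation_def tensor3_def assms)

text \<open>Rescaling n orthogonal vectors and rotating the n (n - 1) / 2 pairs gives n (n + 1) / 2
  independent deformations. Fewer conditions than that admit a common nonzero solution.\<close>

lemma odeco_deformations:
  assumes odeco: "strongly_odeco form T" and n: "n = dim (UNIV :: 'v set)"
    and Q: "finite Q" "2 * card Q < n * (n + 1)"
  shows "\<exists>S\<in>symmetric_tensors form. deformation T S \<and> S \<noteq> 0 \<and> (\<forall>(x, y, z)\<in>Q. S x y z = 0)"
proof -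
  obtain k and v :: "nat \<Rightarrow> 'v" where Tv: "T = (\<Sum>i<k. tensor3 form (v i) (v i) (v i))"
    and v: "orthogonal_family {..<k} v"
    using odeco by (auto simp: strongly_odeco_def orthogonal_family_def)
  have "k \<le> n"
    using orthogonal_family_card(1)[OF v] n by simp
  obtain g where g: "orthogonal_family {..<n} g" and gv: "\<And>i. i < k \<Longrightarrow> g i = v i"
    using orthogonal_family_extend_basis[OF v] n by auto
  \<comment> \<open>The decomposition may have fewer than \<open>n\<close> terms; the added vectors
    get weight 0, so that all \<open>T\<close> are treated uniformly.\<close>
  define c where "c i = (if i < k then 1 else 0 :: complex)" for i
  have T: "T = (\<Sum>i<n. tensor_scale (c i) (tensor3 form (g i) (g i) (g i)))"
  proof -
    have "(\<Sum>i<n. tensor_scale (c i) (tensor3 form (g i) (g i) (g i))) =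
        (\<Sum>i<k. tensor_scale (c i) (tensor3 form (g i) (g i) (g i)))"
      by (rule sum.mono_neutral_right) (use \<open>k \<le> n\<close> in \<open>auto simp: c_def tensor_scale_def fun_eq_iff\<close>)
    also have "\<dots> = T"
      unfolding Tv by (rule sum.cong) (auto simp: c_def tensor_scale_def gv)
    finally show ?thesis ..
  qed
  define N where "N i = form (g i) (g i)" for i
  have N: "N i \<noteq> 0" if "i < n" for i
    using g that by (simp add: orthogonal_family_def N_def)
  have orth: "form (g i) (g j) = (if i = j then N i else 0)" if "i < n" "j < n" for i j
    using g that by (simp add: orthogonal_family_def N_def)
  have gm: "form (g i) (mult T x y) = (c i * N i) * form (g i) x * form (g i) y" if "i < n" for i x y
    unfolding N_def
    by (rule form_mult_sum_cubes[OF _ _ T]) (use that g in \<open>auto simp: orthogonal_family_def\<close>)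
  \<comment> \<open>The weights solve the relation of \<open>deformation_square_times\<close> for
    the character factors \<open>c i * N i\<close> and \<open>c j * N j\<close>. The value 1 at c j
    = 0 keeps them from vanishing together.\<close>
  define \<alpha> where "\<alpha> i j = (if c j = 0 then 1 else - (c i * N i))" for i j
  define \<beta> where "\<beta> j = c j * N j" for j
  define D where "D = (\<lambda>(j, i). if i = j then tensor3 form (g i) (g i) (g i)
    else tensor_scale (\<alpha> i j) (square_times (g i) (g j)) + tensor_scale (\<beta> j) (square_times (g j) (g i)))"
  define P where "P = (SIGMA j:{..<n}. {..j})"
  have finP: "finite P"
    by (simp add: P_def)
  have cardP: "2 * card P = n * (n + 1)"
  proof -
    have "card P = (\<Sum>j<n. Suc j)"
      by (simp add: P_def)
    also have "2 * \<dots> = n * (n + 1)"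
      by (induction n) simp_all
    finally show ?thesis .
  qed
  \<comment> \<open>Independence is read off at the triples (i, i, j) and (j, j, i), where among the
    chosen deformations only the one for the pair i, j can be nonzero.\<close>
  have D_g: "D (j, i) (g a) (g a) (g b) = (if i = j then if a = i \<and> b = i then N i ^ 3 else 0
      else (if a = i \<and> b = j then \<alpha> i j * (N i * N i * N j) else 0)
        + (if a = j \<and> b = i then \<beta> j * (N j * N j * N i) else 0))"
    if "i < n" "j < n" "a < n" "b < n" for i j a b
    using that by (cases "i = j") (auto simp: D_def tensor3_def tensor_scale_def square_times_def orth
        power3_eq_cube)
  have D_sym: "D p \<in> symmetric_tensors form" for p
    unfolding D_def by (auto split: prod.splits
        intro!: symmetric_tensors_add symmetric_tensors_scale tensor3_cube_symmetric square_times_symmetric)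
  have D_def': "deformation T (D p)" if p: "p \<in> P" for p
  proof -
    obtain i j where ij: "p = (j, i)" "i < n" "j < n"
      using p by (auto simp: P_def)
    have "deformation T (tensor_scale (\<alpha> i j) (square_times (g i) (g j))
        + tensor_scale (\<beta> j) (square_times (g j) (g i)))"
      by (rule deformation_square_times[OF gm[OF ij(2)] gm[OF ij(3)]]) (simp add: \<alpha>_def \<beta>_def)
    then show ?thesis
      using deformation_cube[OF gm[OF ij(2)]] by (cases "i = j") (simp_all add: D_def ij)
  qed
  have "card Q < card P"
    using cardP Q by simp
  from underdetermined_system[OF Q(1) finP this, of "\<lambda>(x, y, z) p. D p x y z"]
  obtain r where r: "\<exists>p\<in>P. r p \<noteq> 0" and sol: "\<forall>q\<in>Q. (\<Sum>p\<in>P. (case q of (x, y, z) \<Rightarrow> D p x y z) * r p) = 0"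
    by (auto simp: case_prod_unfold)
  define S where "S = (\<Sum>p\<in>P. tensor_scale (r p) (D p))"
  have S_apply: "S x y z = (\<Sum>p\<in>P. r p * D p x y z)" for x y z
    by (simp add: S_def sum_fun3_apply tensor_scale_def)
  have "S \<noteq> 0"
  proof
    assume "S = 0"
    obtain i j where ij: "(j, i) \<in> P" and rij: "r (j, i) \<noteq> 0"
      using r by (auto simp: P_def)
    then have i: "i \<le> j" "i < n" "j < n"
      by (auto simp: P_def)
    have single: False if y: "\<And>p. p \<in> P \<Longrightarrow> D p (g a) (g a) (g b) = (if p = (j, i) then y else 0)" "y \<noteq> 0" for a b y
    proof -
      have "0 = S (g a) (g a) (g b)"
        by (simp add: \<open>S = 0\<close>)
      also have "\<dots> = (\<Sum>p\<in>P. if p = (j, i) then r (j, i) * y else 0)"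
        unfolding S_apply by (rule sum.cong) (auto simp: y)
      also have "\<dots> = r (j, i) * y"
        using finP ij by simp
      finally show False
        using rij y(2) by simp
    qed
    consider "i = j" | "i \<noteq> j" "\<alpha> i j \<noteq> 0" | "i \<noteq> j" "\<beta> j \<noteq> 0"
      using N[OF i(3)] by (cases "c j = 0") (auto simp: \<alpha>_def \<beta>_def)
    then show False
    proof cases
      case 1
      show False
      proof (rule single[of i i "N i ^ 3"])
        show "D p (g i) (g i) (g i) = (if p = (j, i) then N i ^ 3 else 0)" if "p \<in> P" for p
          using that i 1 by (auto simp: P_def D_g split: if_splits)
      qed (use N i in simp)
    next
      case 2
      show False
      proof (rule single[of i j "\<alpha> i j * (N i * N i * N j)"])
        show "D p (g i) (g i) (g j) = (if p = (j, i) then \<alpha> i j * (N i * N i * N j) else 0)" if "p \<in> P" for p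
          using that i 2 by (auto simp: P_def D_g split: if_splits)
      qed (use N i 2 in simp)
    next
      case 3
      show False
      proof (rule single[of j i "\<beta> j * (N j * N j * N i)"])
        show "D p (g j) (g j) (g i) = (if p = (j, i) then \<beta> j * (N j * N j * N i) else 0)" if "p \<in> P" for p
          using that i 3 by (auto simp: P_def D_g split: if_splits)
      qed (use N i 3 in simp)
    qed
  qed
  moreover have "S \<in> symmetric_tensors form"
    unfolding S_def by (intro symmetric_tensors_sum symmetric_tensors_scale D_sym)
  moreover have "deformation T S"
    unfolding S_def by (rule deformation_sum) (rule D_def')
  moreover have "\<forall>(x, y, z)\<in>Q. S x y z = 0"
    using sol by (auto simp: S_apply mult.commute)
  ultimately show ?thesis by blast
qed

text \<open>The unknowns are the n^3 coordinates of \<open>S\<close>. Symmetry, the deformation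
  equations and vanishing on \<open>Q\<close> form one linear system with coefficients polynomial in
  \<open>T\<close>, so \<open>kernel_on_zariski_closure\<close> carries a nonzero solution to the
  closure.\<close>

lemma odeco_variety_deformations:
  assumes n: "n = dim (UNIV :: 'v set)"
    and dual: "\<And>i j. i < n \<Longrightarrow> j < n \<Longrightarrow> form (f i) (g j) = (if i = j then 1 else 0)"
    and Q: "finite Q" "2 * card Q < n * (n + 1)" "Q \<subseteq> {..<n} \<times> {..<n} \<times> {..<n}"
    and T: "T \<in> odeco_variety form"
  shows "\<exists>S\<in>symmetric_tensors form. S \<noteq> 0 \<and> (\<forall>(i, j, k)\<in>Q. S (f i) (f j) (f k) = 0) \<and>
    (\<forall>i<n. \<forall>j<n. \<forall>k<n. \<forall>l<n.
      S (f i) (f j) (mult T (f k) (f l)) + S (f k) (f l) (mult T (f i) (f j)) =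
      S (f i) (f k) (mult T (f j) (f l)) + S (f j) (f l) (mult T (f i) (f k)))"
proof -
  have span: "span (f ` {..<n}) = UNIV"
    using dual_family_card(2)[of "{..<n}" f g "\<lambda>_. 1"] dual n by auto
  have exp: "y = (\<Sum>i<n. scale (form y (g i)) (f i))" for y
    by (rule dual_family_expansion[OF _ span]) (use dual in auto)
  have S_mult: "S x y (mult U z w) = (\<Sum>m<n. U z w (g m) * S x y (f m))"
    if S: "S \<in> symmetric_tensors form" and U: "U \<in> symmetric_tensors form" for S U x y z w
    by (subst exp[of "mult U z w"])
       (simp add: form_mult[OF U] symmetric_tensor_sum[OF S] symmetric_tensor_scale[OF S])
  define I where "I = {..<n} \<times> {..<n} \<times> {..<n}"
  have I: "finite I"
    by (simp add: I_def)
  have mem_I: "(i, j, k) \<in> I \<longleftrightarrow> i < n \<and> j < n \<and> k < n" for i j k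
    by (simp add: I_def)
  define \<delta> where "\<delta> t t' = (if t' = t then 1 else 0 :: complex)" for t t' :: "nat \<times> nat \<times> nat"
  have \<delta>: "(\<Sum>t'\<in>I. \<delta> t t' * s t') = s t" if "t \<in> I" for s t
  proof -
    have "(\<Sum>t'\<in>I. \<delta> t t' * s t') = (\<Sum>t'\<in>I. if t' = t then s t else 0)"
      by (rule sum.cong) (auto simp: \<delta>_def)
    then show ?thesis using I that by simp
  qed
  define r1 where "r1 = (\<lambda>(i, j, k) t (U :: 'v \<Rightarrow> 'v \<Rightarrow> 'v \<Rightarrow> complex). \<delta> (i, j, k) t - \<delta> (j, i, k) t)"
  define r2 where "r2 = (\<lambda>(i, j, k) t (U :: 'v \<Rightarrow> 'v \<Rightarrow> 'v \<Rightarrow> complex). \<delta> (i, j, k) t - \<delta> (i, k, j) t)"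
  define r3 where "r3 = (\<lambda>((i, j), k, l) t (U :: 'v \<Rightarrow> 'v \<Rightarrow> 'v \<Rightarrow> complex). \<Sum>m<n.
      (U (f k) (f l) (g m) * \<delta> (i, j, m) t + U (f i) (f j) (g m) * \<delta> (k, l, m) t)
    - (U (f j) (f l) (g m) * \<delta> (i, k, m) t + U (f i) (f k) (g m) * \<delta> (j, l, m) t))"
  define r4 where "r4 = (\<lambda>q t (U :: 'v \<Rightarrow> 'v \<Rightarrow> 'v \<Rightarrow> complex). \<delta> q t)"
  \<comment> \<open>Each equation is identified with its coefficient function, so \<open>J\<close>
    indexes itself and the identity serves as the matrix.\<close>
  define J where "J = r1 ` I \<union> r2 ` I \<union> r3 ` (({..<n} \<times> {..<n}) \<times> {..<n} \<times> {..<n}) \<union> r4 ` Q"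
  have r1: "(\<Sum>t\<in>I. r1 (i, j, k) t U * s t) = s (i, j, k) - s (j, i, k)"
    and r2: "(\<Sum>t\<in>I. r2 (i, j, k) t U * s t) = s (i, j, k) - s (i, k, j)"
    if "(i, j, k) \<in> I" for i j k U s
    using that by (simp_all add: r1_def r2_def left_diff_distrib sum_subtractf \<delta> mem_I)
  have r4: "(\<Sum>t\<in>I. r4 q t U * s t) = s q" if "q \<in> Q" for q U s
    using that Q(3)[folded I_def] by (auto simp: r4_def \<delta>)
  have r3: "(\<Sum>t\<in>I. r3 ((i, j), k, l) t U * s t) =
      ((\<Sum>m<n. U (f k) (f l) (g m) * s (i, j, m)) + (\<Sum>m<n. U (f i) (f j) (g m) * s (k, l, m)))
      - ((\<Sum>m<n. U (f j) (f l) (g m) * s (i, k, m)) + (\<Sum>m<n. U (f i) (f k) (g m) * s (j, l, m)))"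
    if "i < n" "j < n" "k < n" "l < n" for i j k l U s
  proof -
    have "(\<Sum>t\<in>I. r3 ((i, j), k, l) t U * s t) = (\<Sum>m<n. \<Sum>t\<in>I.
        (U (f k) (f l) (g m) * (\<delta> (i, j, m) t * s t) + U (f i) (f j) (g m) * (\<delta> (k, l, m) t * s t))
      - (U (f j) (f l) (g m) * (\<delta> (i, k, m) t * s t) + U (f i) (f k) (g m) * (\<delta> (j, l, m) t * s t)))"
      unfolding r3_def prod.case sum_distrib_right
      by (subst sum.swap) (simp add: left_diff_distrib distrib_right mult.assoc)
    also have "\<dots> = (\<Sum>m<n.
        (U (f k) (f l) (g m) * s (i, j, m) + U (f i) (f j) (g m) * s (k, l, m))
      - (U (f j) (f l) (g m) * s (i, k, m) + U (f i) (f k) (g m) * s (j, l, m)))"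
      unfolding sum_subtractf sum.distrib sum_distrib_left[symmetric]
      by (intro arg_cong2[where f = "(-)"] arg_cong2[where f = "(+)"] sum.cong refl)
         (use that in \<open>simp_all add: \<delta> mem_I\<close>)
    finally show ?thesis
      by (simp add: sum.distrib sum_subtractf)
  qed
  have "\<exists>s. (\<exists>t\<in>I. s t \<noteq> 0) \<and> (\<forall>r\<in>J. (\<Sum>t\<in>I. r t T * s t) = 0)"
  proof (rule kernel_on_zariski_closure[of I J "\<lambda>r. r", OF I _ _ _ T[unfolded odeco_variety_def]])
    show "finite J"
      using I Q(1) by (simp add: J_def)
    show "r t \<in> polynomial_functions tensor_scale (symmetric_tensors form)" if "t \<in> I" "r \<in> J" for t r
      using that(2) unfolding J_def r1_def r2_def r3_def r4_def
      by (auto intro!: polynomial_functions.const polynomial_functions_sum polynomial_functions_diff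
          polynomial_functions.add polynomial_functions.mult polynomial_functions_evaluation)
    fix U assume "U \<in> {T \<in> symmetric_tensors form. strongly_odeco form T}"
    then have U: "U \<in> symmetric_tensors form" "strongly_odeco form U"
      by auto
    define Q' where "Q' = (\<lambda>(i, j, k). (f i, f j, f k)) ` Q"
    have "finite Q'" "2 * card Q' < n * (n + 1)"
      using Q card_image_le[OF Q(1), of "\<lambda>(i, j, k). (f i, f j, f k)"] by (auto simp: Q'_def)
    then obtain S where S: "S \<in> symmetric_tensors form" "deformation U S" "S \<noteq> 0" "\<forall>(x, y, z)\<in>Q'. S x y z = 0"
      using odeco_deformations[OF U(2) n] by blast
    define s where "s = (\<lambda>(i, j, k). S (f i) (f j) (f k))"
    have "\<exists>t\<in>I. s t \<noteq> 0"
    proof (rule ccontr)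
      assume "\<not> (\<exists>t\<in>I. s t \<noteq> 0)"
      then have "S (f i) (f j) (f k) = 0" if "i < n" "j < n" "k < n" for i j k
        using that by (auto simp: s_def I_def)
      then have "S = 0"
        by (intro symmetric_tensor_eqI[OF S(1) symmetric_tensors_zero span]) auto
      then show False
        using S(3) by simp
    qed
    moreover have "(\<Sum>t\<in>I. r t U * s t) = 0" if "r \<in> J" for r
      using that unfolding J_def
    proof (elim UnE imageE)
      fix p assume p: "r = r1 p" "p \<in> I"
      then show ?thesis
        using symmetric_tensor_swap12[OF S(1)] by (cases p) (simp add: r1 s_def)
    next
      fix p assume p: "r = r2 p" "p \<in> I"
      then show ?thesis
        using symmetric_tensor_swap23[OF S(1)] by (cases p) (simp add: r2 s_def)
    next
      fix p assume p: "r = r3 p" "p \<in> ({..<n} \<times> {..<n}) \<times> {..<n} \<times> {..<n}"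
      then obtain i j k l where q: "p = ((i, j), k, l)" "i < n" "j < n" "k < n" "l < n"
        by auto
      show ?thesis
        using S(2) unfolding p q(1) r3[OF q(2-5)] by (simp add: s_def S_mult[OF S(1) U(1), symmetric] deformation_def)
    next
      fix p assume p: "r = r4 p" "p \<in> Q"
      obtain i j k where q: "p = (i, j, k)"
        by (cases p)
      have "(f i, f j, f k) \<in> Q'"
        unfolding Q'_def by (rule image_eqI[OF _ p(2)]) (simp add: q)
      then have "s p = 0"
        using S(4) by (auto simp: s_def q)
      then show ?thesis
        using p by (simp add: r4)
    qed
    ultimately show "\<exists>s. (\<exists>t\<in>I. s t \<noteq> 0) \<and> (\<forall>r\<in>J. (\<Sum>t\<in>I. r t U * s t) = 0)"
      by blast
  qed
  then obtain s where s0: "\<exists>t\<in>I. s t \<noteq> 0" and sol: "\<And>r. r \<in> J \<Longrightarrow> (\<Sum>t\<in>I. r t T * s t) = 0"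
    by blast
  have s1: "s (i, j, k) = s (j, i, k)" and s2: "s (i, j, k) = s (i, k, j)" if "i < n" "j < n" "k < n" for i j k
  proof -
    have t: "(i, j, k) \<in> I"
      using that by (simp add: I_def)
    then have "r1 (i, j, k) \<in> J" "r2 (i, j, k) \<in> J"
      by (auto simp: J_def)
    then show "s (i, j, k) = s (j, i, k)" "s (i, j, k) = s (i, k, j)"
      using sol[of "r1 (i, j, k)"] sol[of "r2 (i, j, k)"] r1[OF t, of T s] r2[OF t, of T s] by simp_all
  qed
  define S where "S x y z = (\<Sum>i<n. \<Sum>j<n. \<Sum>k<n. s (i, j, k) * (form x (g i) * form y (g j) * form z (g k)))" for x y z
  have S: "S \<in> symmetric_tensors form"
  proof (rule symmetric_tensorsI)
    fix x y z
    show "S x y z = S y x z"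
      unfolding S_def by (subst sum.swap) (intro sum.cong refl, simp add: s1 mult_ac)
    show "S x y z = S x z y"
      unfolding S_def
    proof (rule sum.cong[OF refl])
      fix i assume "i \<in> {..<n}"
      then show "(\<Sum>j<n. \<Sum>k<n. s (i, j, k) * (form x (g i) * form y (g j) * form z (g k))) =
          (\<Sum>j<n. \<Sum>k<n. s (i, j, k) * (form x (g i) * form z (g j) * form y (g k)))"
        by (subst sum.swap) (intro sum.cong refl, simp add: s2 mult_ac)
    qed
  qed (simp_all add: S_def form_bilinear algebra_simps sum.distrib sum_distrib_left)
  have Sf: "S (f a) (f b) (f c) = s (a, b, c)" if abc: "a < n" "b < n" "c < n" for a b c
  proof -
    have "S (f a) (f b) (f c) = (\<Sum>i<n. \<Sum>j<n. \<Sum>k<n. if k = c then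
        (if j = b then (if i = a then s (a, b, c) else 0) else 0) else 0)"
      unfolding S_def by (intro sum.cong refl) (simp add: dual abc)
    then show ?thesis using abc by simp
  qed
  have T': "T \<in> symmetric_tensors form"
    using T by (auto simp: odeco_variety_def zariski_closure_def)
  show ?thesis
  proof (intro bexI[OF _ S] conjI allI impI ballI)
    show "S \<noteq> 0"
      using s0 Sf by (force simp: I_def)
    show "case q of (i, j, k) \<Rightarrow> S (f i) (f j) (f k) = 0" if "q \<in> Q" for q
    proof -
      obtain i j k where q: "q = (i, j, k)" "i < n" "j < n" "k < n"
        using \<open>q \<in> Q\<close> Q(3) by auto
      have "r4 q \<in> J"
        using \<open>q \<in> Q\<close> by (simp add: J_def)
      from sol[OF this] have "s q = 0"
        by (simp add: r4[OF \<open>q \<in> Q\<close>])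
      then show ?thesis
        using q Sf by simp
    qed
    fix i j k l assume ijkl: "i < n" "j < n" "k < n" "l < n"
    then have "r3 ((i, j), k, l) \<in> J"
      by (auto simp: J_def)
    from sol[OF this] show "S (f i) (f j) (mult T (f k) (f l)) + S (f k) (f l) (mult T (f i) (f j)) =
      S (f i) (f k) (mult T (f j) (f l)) + S (f j) (f l) (mult T (f i) (f k))"
      unfolding r3[OF ijkl] S_mult[OF S T'] using ijkl by (simp add: Sf)
  qed
qed

end
subsection \<open>Dimension at least twelve\<close>

text \<open>The index of the dual vector in a basis consisting of six hyperbolic pairs, i with i +
  6, followed by orthonormal vectors.\<close>

definition partner :: "nat \<Rightarrow> nat" where
  "partner i = (if i < 6 then i + 6 else if i < 12 then i - 6 else i)"

context nondegenerate_symmetric_form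
begin

lemma hyperbolic_basis:
  assumes n: "n = dim (UNIV :: 'v set)" "n \<ge> 12"
  shows "\<exists>c. \<forall>i<n. \<forall>j<n. form (c i) (c (partner j)) = (if i = j then 1 else 0)"
proof -
  obtain e where e: "\<And>i j. i < n \<Longrightarrow> j < n \<Longrightarrow> form (e i) (e j) = (if i = j then 1 else 0)"
    using orthonormal_basis n(1) by blast
  \<comment> \<open>Two orthonormal vectors e, e' give the isotropic vectors e + \<i> e' and (e -
    \<i> e') / 2; the factor 1/2 makes their pairing 1.\<close>
  define c where "c i = (if i < 6 then scale (1/2) (e (2 * i) - scale \<i> (e (2 * i + 1)))
    else if i < 12 then e (2 * (i - 6)) + scale \<i> (e (2 * (i - 6) + 1)) else e i)" for i
  have ww: "form (c i) (c j) = 0" if "i < 6" "j < 6" for i j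
    using that n(2) by (simp add: c_def form_bilinear e; presburger)
  have wu: "form (c i) (c (j + 6)) = (if i = j then 1 else 0)" if "i < 6" "j < 6" for i j
    using that n(2) by (simp add: c_def form_bilinear e; presburger)
  have uu: "form (c (i + 6)) (c (j + 6)) = 0" if "i < 6" "j < 6" for i j
    using that n(2) by (simp add: c_def form_bilinear e; presburger)
  have ec: "form (c i) (c j) = (if i = j then 1 else 0)" if "i < n" "12 \<le> j" "j < n" for i j
    using that n(2) by (auto simp: c_def form_bilinear e)
  have ce: "form (c i) (c j) = (if i = j then 1 else 0)" if "12 \<le> i" "i < n" "j < n" for i j
    using ec[of j i] that form_sym[of "c i" "c j"] by auto
  have uw: "form (c (i + 6)) (c j) = (if i = j then 1 else 0)" if "i < 6" "j < 6" for i j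
    using wu[of j i] that form_sym[of "c (i + 6)" "c j"] by auto
  have "form (c i) (c (partner j)) = (if i = j then 1 else 0)" if ij: "i < n" "j < n" for i j
  proof -
    consider "12 \<le> j" | "j < 12" "12 \<le> i" | "i < 6" "j < 6" | "i < 6" "6 \<le> j" "j < 12"
      | "6 \<le> i" "i < 12" "j < 6" | "6 \<le> i" "i < 12" "6 \<le> j" "j < 12"
      by linarith
    then show ?thesis
    proof cases
      case 1
      then show ?thesis using ec[of i j] ij by (simp add: partner_def)
    next
      case 2
      then show ?thesis using ce[of i "partner j"] ij n(2) by (auto simp: partner_def)
    next
      case 3
      then show ?thesis using wu[of i j] by (simp add: partner_def)
    next
      case 4
      then show ?thesis using ww[of i "j - 6"] by (simp add: partner_def)
    next
      case 5
      then show ?thesis using uu[of "i - 6" j] by (simp add: partner_def)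
    next
      case 6
      then show ?thesis using uw[of "i - 6" "j - 6"] by (auto simp: partner_def)
    qed
  qed
  then show ?thesis by blast
qed

theorem associative_not_in_variety:
  assumes n: "n = dim (UNIV :: 'v set)" "n \<ge> 12"
  shows "\<exists>T\<in>associative_tensors scale form. T \<notin> odeco_variety form"
proof -
  obtain c where c: "\<And>i j. i < n \<Longrightarrow> j < n \<Longrightarrow> form (c i) (c (partner j)) = (if i = j then 1 else 0)"
    using hyperbolic_basis[OF n] by blast
  have partner: "partner i < n" "partner (partner i) = i" if "i < n" for i
    using that n(2) by (auto simp: partner_def)
  have cc: "form (c i) (c j) = (if i = partner j then 1 else 0)" if "i < n" "j < n" for i j
    using c[of i "partner j"] partner[OF that(2)] that by simp
  have span: "span (c ` {..<n}) = UNIV"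
    using dual_family_card(2)[of "{..<n}" c "\<lambda>j. c (partner j)" "\<lambda>_. 1"] c n(1) by auto
  define K where "K = {12..<n}"
  \<comment> \<open>Pairing with \<open>c (i + 6)\<close> is the coordinate along
    \<open>c i\<close>, so the first sum is the cubic placed on the isotropic span of the
    \<open>c (i + 6)\<close>; the second adds the idempotents.\<close>
  define T where "T x y z = (\<Sum>i<6. \<Sum>j<6. \<Sum>k<6. of_real (cubic i j k) *
      (form (c (i + 6)) x * form (c (j + 6)) y * form (c (k + 6)) z))
    + (\<Sum>e\<in>K. form (c e) x * form (c e) y * form (c e) z)" for x y z
  have T: "T \<in> symmetric_tensors form"
  proof (rule symmetric_tensorsI)
    fix x y z
    show "T x y z = T y x z"
      unfolding T_def
      by (rule arg_cong2[where f = "(+)"], subst sum.swap)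
         (intro sum.cong refl, simp add: cubic_symmetric(1) mult_ac)+
    show "T x y z = T x z y"
      unfolding T_def
    proof (rule arg_cong2[where f = "(+)"])
      show "(\<Sum>i<6. \<Sum>j<6. \<Sum>k<6. of_real (cubic i j k) *
          (form (c (i + 6)) x * form (c (j + 6)) y * form (c (k + 6)) z)) =
        (\<Sum>i<6. \<Sum>j<6. \<Sum>k<6. of_real (cubic i j k) *
          (form (c (i + 6)) x * form (c (j + 6)) z * form (c (k + 6)) y))"
      proof (rule sum.cong[OF refl])
        fix i :: nat
        show "(\<Sum>j<6. \<Sum>k<6. of_real (cubic i j k) *
            (form (c (i + 6)) x * form (c (j + 6)) y * form (c (k + 6)) z)) =
          (\<Sum>j<6. \<Sum>k<6. of_real (cubic i j k) *
            (form (c (i + 6)) x * form (c (j + 6)) z * form (c (k + 6)) y))"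
          by (subst sum.swap) (intro sum.cong refl, simp add: cubic_symmetric(2) mult_ac)
      qed
    qed (intro sum.cong refl, simp add: mult_ac)
  qed (simp_all add: T_def form_bilinear algebra_simps sum.distrib sum_distrib_left)
  have cu: "form (c (i + 6)) (c j) = (if i = j then 1 else 0)" if "i < 6" "j < n" for i j
    using cc[of "i + 6" j] that n(2) by (auto simp: partner_def)
  have ce: "form (c e) (c j) = (if e = j then 1 else 0)" if "e \<in> K" "j < n" for e j
    using cc[of e j] that n(2) by (auto simp: partner_def K_def)
  have T_u: "T x y (c (l + 6)) = 0" if "l < 6" for x y l
    using that n(2) by (auto simp: T_def cu ce K_def intro!: sum.neutral)
  have T_e: "T x y (c e) = form (c e) x * form (c e) y" if "e \<in> K" for x y e
  proof -
    have e: "e < n" "finite K" "\<not> e < 6"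
      using that by (auto simp: K_def)
    have "(\<Sum>i<6. \<Sum>j<6. \<Sum>k<6. of_real (cubic i j k) *
        (form (c (i + 6)) x * form (c (j + 6)) y * form (c (k + 6)) (c e))) = 0"
      using e by (intro sum.neutral ballI) (auto simp: cu)
    moreover have "(\<Sum>e'\<in>K. form (c e') x * form (c e') y * form (c e') (c e)) =
        (\<Sum>e'\<in>K. if e' = e then form (c e) x * form (c e) y else 0)"
      using e by (intro sum.cong) (auto simp: ce)
    ultimately show ?thesis
      using e that by (simp add: T_def)
  qed
  \<comment> \<open>Products have no component along the first six basis vectors, so a product as an
    argument of \<open>T\<close> kills the cubic part. Only the idempotents remain in the
    associator.\<close>
  have u_mult: "form (c (l + 6)) (mult T x y) = 0" if "l < 6" for x y l
    using T_u[OF that] form_mult[OF T] form_sym by metis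
  have e_mult: "form (c e) (mult T x y) = form (c e) x * form (c e) y" if "e \<in> K" for x y e
    using T_e[OF that] form_mult[OF T] form_sym by metis
  have assoc: "T \<in> associative_tensors scale form"
    unfolding associative_tensors_iff[OF T]
    by (simp add: T_def[of "mult T _ _"] u_mult e_mult mult_ac)
  have mult_c: "mult T (c k) (c l) = (if k < 6 \<and> l < 6 then \<Sum>m<6. scale (of_real (cubic k l m)) (c (m + 6))
      else if k = l \<and> 12 \<le> k then c k else 0)" if kl: "k < n" "l < n" for k l
  proof (rule mult_eqI[OF T])
    fix z
    have 1: "(\<Sum>i<6. \<Sum>j<6. \<Sum>m<6. of_real (cubic i j m) *
        (form (c (i + 6)) (c k) * form (c (j + 6)) (c l) * form (c (m + 6)) z)) =
      (if k < 6 \<and> l < 6 then \<Sum>m<6. of_real (cubic k l m) * form (c (m + 6)) z else 0)"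
    proof -
      have "(\<Sum>i<6. \<Sum>j<6. \<Sum>m<6. of_real (cubic i j m) *
          (form (c (i + 6)) (c k) * form (c (j + 6)) (c l) * form (c (m + 6)) z)) =
        (\<Sum>i<6. \<Sum>j<6. if j = l then (if i = k then \<Sum>m<6. of_real (cubic k l m) * form (c (m + 6)) z else 0) else 0)"
        by (rule sum.cong[OF refl], rule sum.cong[OF refl]) (simp add: cu kl)
      then show ?thesis
        by (cases "l < 6") simp_all
    qed
    have 2: "(\<Sum>e\<in>K. form (c e) (c k) * form (c e) (c l) * form (c e) z) =
        (if k = l \<and> 12 \<le> k then form (c k) z else 0)"
    proof -
      have "(\<Sum>e\<in>K. form (c e) (c k) * form (c e) (c l) * form (c e) z) =
          (\<Sum>e\<in>K. if e = k then (if k = l then form (c k) z else 0) else 0)"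
        by (rule sum.cong) (use ce kl in auto)
      then show ?thesis
        using kl by (auto simp: K_def)
    qed
    show "form (if k < 6 \<and> l < 6 then \<Sum>m<6. scale (of_real (cubic k l m)) (c (m + 6))
        else if k = l \<and> 12 \<le> k then c k else 0) z = T (c k) (c l) z"
      unfolding T_def 1 2 by (simp add: form_sum_left form_scale_left)
  qed
  have "T \<notin> odeco_variety form"
  proof
    assume "T \<in> odeco_variety form"
    have sub: "determining_triples n \<subseteq> {..<n} \<times> {..<n} \<times> {..<n}"
      using n(2) by (auto simp: determining_triples_def free_triples_def)
    obtain S where S: "S \<in> symmetric_tensors form" "S \<noteq> 0"
      and Q: "\<forall>(i, j, k)\<in>determining_triples n. S (c i) (c j) (c k) = 0"
      and E: "\<forall>i<n. \<forall>j<n. \<forall>k<n. \<forall>l<n.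
        S (c i) (c j) (mult T (c k) (c l)) + S (c k) (c l) (mult T (c i) (c j)) =
        S (c i) (c k) (mult T (c j) (c l)) + S (c j) (c l) (mult T (c i) (c k))"
      using odeco_variety_deformations[OF n(1), of c "\<lambda>j. c (partner j)", OF c determining_triples_finite
          card_determining_triples[OF n(2)] sub \<open>T \<in> odeco_variety form\<close>] by blast
    have S_mult: "S (c i) (c j) (mult T (c k) (c l)) =
        (if k < 6 \<and> l < 6 then \<Sum>m<6. of_real (cubic k l m) * S (c i) (c j) (c (m + 6))
         else if k = l \<and> 12 \<le> k then S (c i) (c j) (c k) else 0)" if "k < n" "l < n" for i j k l
      by (simp add: mult_c[OF that] symmetric_tensor_sum[OF S(1)] symmetric_tensor_scale[OF S(1)]
          symmetric_tensor_zero[OF S(1)])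
    \<comment> \<open>The cubic has real coefficients, so the real and imaginary parts of a
      deformation satisfy the same equations separately, and the real elimination applies to
      each.\<close>
    have part: "\<phi> (S (c i) (c j) (c k)) = 0" if "i < n" "j < n" "k < n"
      and \<phi>: "\<And>x y. \<phi> (x + y) = \<phi> x + \<phi> y" "\<And>r x. \<phi> (of_real r * x) = r * \<phi> x" "\<phi> 0 = 0"
      for i j k and \<phi> :: "complex \<Rightarrow> real"
    proof (rule deformation_coordinates_trivial[OF n(2), of "\<lambda>i j k. \<phi> (S (c i) (c j) (c k))"])
      let ?A = "\<lambda>k l i j. if k < 6 \<and> l < 6 then \<Sum>m<6. cubic k l m * \<phi> (S (c i) (c j) (c (m + 6)))
        else if k = l \<and> 12 \<le> k then \<phi> (S (c i) (c j) (c k)) else 0"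
      have A: "\<phi> (S (c i) (c j) (mult T (c k) (c l))) = ?A k l i j" if "k < n" "l < n" for i j k l
      proof -
        have "\<phi> (\<Sum>m<N. g m) = (\<Sum>m<N. \<phi> (g m))" for g and N :: nat
          by (induction N) (simp_all add: \<phi>)
        then show ?thesis
          unfolding S_mult[OF that] by (simp add: \<phi>)
      qed
      show "?A k l i j + ?A i j k l = ?A j l i k + ?A i k j l" if "i < n" "j < n" "k < n" "l < n" for i j k l
        using E that by (simp only: A[symmetric] \<phi>(1)[symmetric])
    qed (use Q symmetric_tensor_swap12[OF S(1)] symmetric_tensor_swap23[OF S(1)] that \<phi>(3) in auto)
    have "S (c i) (c j) (c k) = 0" if "i < n" "j < n" "k < n" for i j k
      using part[OF that, of Re] part[OF that, of Im] by (simp add: complex_eq_iff)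
    then have "S = 0"
      by (intro symmetric_tensor_eqI[OF S(1) symmetric_tensors_zero span]) auto
    then show False
      using S(2) by simp
  qed
  then show ?thesis
    using assoc by blast
qed

end

theorem theorem2p10:
  fixes scale :: "complex \<Rightarrow> 'v::ab_group_add \<Rightarrow> 'v" and Basis :: "'v set"
    and form :: "'v \<Rightarrow> 'v \<Rightarrow> complex" and n :: nat
  assumes "nondegenerate_symmetric_form scale Basis form"
    and "n = vector_space.dim scale (UNIV :: 'v set)"
  shows "(n \<le> 3 \<longrightarrow> associative_tensors scale form = odeco_variety form) \<and>
         (n \<ge> 12 \<longrightarrow> odeco_variety form \<subset> associative_tensors scale form)"
proof -
  interpret nondegenerate_symmetric_form scale Basis form
    by fact
  show ?thesis
    using odeco_variety_subset_associative associative_in_variety_dim_le_3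
      associative_not_in_variety[OF assms(2)] assms(2)
    by blast
qed

end
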